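(* Let $k\ge 2$, let $0<p<1$ be a fixed constant, and let $\{H_n\}_{n\to\infty}$ be a sequence of $k$-uniform hypergraphs with loops such that $|V(H_n)|=n$ and $|E(H_n)|\ge p\binom{n}{k}$. Let $\pi=k_1+\dots+k_t$ be a proper partition of $k$ and let $\ell\ge 1$ be an integer. Assume that the number of labeled copies of $C_{\pi,4\ell}$ in $H_n$ is at most $p^{|E(C_{\pi,4\ell})|}n^{|V(C_{\pi,4\ell})|}+o(n^{|V(C_{\pi,4\ell})|})$. Then $\lambda_{1,\pi}(H_n)=pn^{k/2}+o(n^{k/2})$ and $\lambda_{2,\pi}(H_n)=o(n^{k/2})$.
   Context: All asymptotic notation is as $n\to\infty$. A proper partition of $k$ is an unordered list of at least two positive integers summing to $k$; an ordering $\vec\pi=(k_1,\dots,k_t)$ of it is a proper ordered partition, and $t$ denotes the number of parts. A $k$-uniform hypergraph with loops $H$ consists of a finite vertex set $V(H)$ and a collection $E(H)$ of $k$-element multisets of elements of $V(H)$. A labeled copy of a hypergraph $F$ in $H$ is an injection $\alpha:V(F)\to V(H)$ such that for every edge $E$ of $F$, $\{\alpha(x):x\in E\}$ is an edge of $H$. Adjacency map: let $W=\mathbb{R}^{V(H)}$ with standard basis $\{e_v\}$. The adjacency map $\tau_H:W^k\to\mathbb{R}$ is the $k$-linear map with $\tau_H(e_{v_1},\dots,e_{v_k})=1$ if the multiset $\{v_1,\dots,v_k\}\in E(H)$ and $0$ otherwise, extended linearly. For a $k$-linear $\sigma:W^k\to\mathbb{R}$ and ordered partition $\vec\pi=(k_1,\dots,k_t)$,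 define the $t$-linear map $\sigma_{\vec\pi}:W^{\otimes k_1}\times\dots\times W^{\otimes k_t}\to\mathbb{R}$ on tensors of standard basis vectors by $\sigma_{\vec\pi}(b_{1,1}\otimes\dots\otimes b_{1,k_1},\dots,b_{t,1}\otimes\dots\otimes b_{t,k_t})=\sigma(b_{1,1},\dots,b_{1,k_1},\dots,b_{t,1},\dots,b_{t,k_t})$, extended linearly. The spectral norm of a multilinear map $\phi:W_1\times\dots\times W_t\to\mathbb{R}$ is $\|\phi\|=\sup\{|\phi(x_1,\dots,x_t)|: x_i\in W_i,\ \|x_i\|=1\}$ (Euclidean norms). Let $J:W^k\to\mathbb{R}$ be the all-ones $k$-linear map ($J(e_{v_1},\dots,e_{v_k})=1$ for all $v_i$). With $n=|V(H)|$ and any ordering $\vec\pi$ of $\pi$, define $\lambda_{1,\pi}(H)=\|\tau_{\vec\pi}\|$ and $\lambda_{2,\pi}(H)=\|\tau_{\vec\pi}-\frac{k!|E(H)|}{n^k}J_{\vec\pi}\|$ (these do not depend on the ordering). The cycle $C_{\pi,4\ell}$. First for $\vec\pi=(1,\dots,1)$ with $t$ parts, the step $S_{\vec\pi}$: let $A$ be a set of $2^{t-1}$ vertices labeled by the binary strings of length $t-1$, and $B_2,\dots,B_t$ disjoint sets of $2^{t-2}$ vertices each labeled by binary strings of length $t-2$; the vertex set is $A\cup B_2\cup\dots\cup B_t$, and $\{a,b_2,\dots,b_t\}$ ($a\in A$, $b_j\in B_j$) is an edge iff for each $j\in\{1,\dots,t-1\}$ the code of $b_{j+1}$ equals the code of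 $a$ with its $j$-th bit removed. For general $\vec\pi=(k_1,\dots,k_t)$, $S_{\vec\pi}$ has vertex set $(A\times[k_1])\cup(B_2\times[k_2])\cup\dots\cup(B_t\times[k_t])$ and for each edge $\{a,b_2,\dots,b_t\}$ of $S_{(1,\dots,1)}$ the edge $\{(a,1),\dots,(a,k_1),(b_2,1),\dots,(b_2,k_2),\dots,(b_t,1),\dots,(b_t,k_t)\}$. The attach tuples $A^{(0)}$, $A^{(1)}$ are the ordered tuples (in lexicographic order) of vertices coming from $A$ whose binary code ends in $0$, respectively $1$. The path $P_{\vec\pi,2m}$ ($m\ge1$) is formed from $m$ copies $T_1,\dots,T_m$ of $S_{\vec\pi}$ by identifying, coordinatewise, the attach tuple $A^{(1)}$ of $T_i$ with the attach tuple $A^{(0)}$ of $T_{i+1}$ for $1\le i\le m-1$; its attach tuples are $A^{(0)}$ of $T_1$ and $A^{(1)}$ of $T_m$. For $m\ge2$, the cycle $C_{\pi,2m}$ is obtained by choosing any ordering $\vec\pi$ of $\pi$ and identifying (coordinatewise) the two attach tuples of $P_{\vec\pi,2m}$. Here $C_{\pi,4\ell}$ is this with $2m=4\ell$. *)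

theory Defs
  imports "HOL-Analysis.Analysis" "HOL-Library.Multiset" "HOL-Library.Landau_Symbols"
begin

section \<open>Hypergraphs with loops and labeled copies\<close>

record 'a hypergraph =
  verts :: "'a set"
  edges :: "'a multiset set"

definition uniform_hypergraph_with_loops :: "nat \<Rightarrow> 'a hypergraph \<Rightarrow> bool" where
  "uniform_hypergraph_with_loops k H \<longleftrightarrow>
     finite (verts H) \<and> (\<forall>E\<in>edges H. size E = k \<and> set_mset E \<subseteq> verts H)"

definition labeled_copies :: "'b hypergraph \<Rightarrow> 'a hypergraph \<Rightarrow> ('b \<Rightarrow> 'a) set" where
  "labeled_copies F H =
     {\<alpha> \<in> verts F \<rightarrow>\<^sub>E verts H.
        inj_on \<alpha> (verts F) \<and> (\<forall>E\<in>edges F. image_mset \<alpha> E \<in> edges H)}"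

definition proper_partition :: "nat \<Rightarrow> nat multiset \<Rightarrow> bool" where
  "proper_partition k \<pi> \<longleftrightarrow> size \<pi> \<ge> 2 \<and> (\<forall>i\<in>#\<pi>. i > 0) \<and> sum_mset \<pi> = k"


section \<open>Multilinear maps and the two spectral quantities\<close>

text \<open>
  A vector of $W = R^V$ is a function \<^typ>\<open>'a \<Rightarrow> real\<close>, of which only the values on
  \<open>V\<close> matter. An element of the \<open>j\<close>-fold tensor power of \<open>W\<close> is given by its coordinates
  in the basis of tensors of standard basis vectors, that is, by a function on lists, of
  which only the values on \<open>tuples V j\<close> matter. The arguments of a multilinear map are
  collected in a list.
\<close>

definition tuples :: "'a set \<Rightarrow> nat \<Rightarrow> 'a list set" where
  "tuples V j = {vs. length vs = j \<and> set vs \<subseteq> V}"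

definition std_basis :: "'a \<Rightarrow> 'a \<Rightarrow> real" where
  "std_basis v = (\<lambda>u. if u = v then 1 else 0)"

text \<open>The \<open>k\<close>-linear map on $W^k$ with value \<open>c [v\<^sub>1, \<dots>, v\<^sub>k]\<close> at the basis vectors
  of \<open>v\<^sub>1, \<dots>, v\<^sub>k\<close>.\<close>

definition multilinear_extension ::
    "'a set \<Rightarrow> nat \<Rightarrow> ('a list \<Rightarrow> real) \<Rightarrow> ('a \<Rightarrow> real) list \<Rightarrow> real" where
  "multilinear_extension V k c xs =
     (\<Sum>vs\<in>tuples V k. c vs * (\<Prod>i<k. (xs ! i) (vs ! i)))"

definition adjacency_map :: "nat \<Rightarrow> 'a hypergraph \<Rightarrow> ('a \<Rightarrow> real) list \<Rightarrow> real" where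
  "adjacency_map k H =
     multilinear_extension (verts H) k (\<lambda>vs. if mset vs \<in> edges H then 1 else 0)"

definition all_ones_map :: "nat \<Rightarrow> 'a set \<Rightarrow> ('a \<Rightarrow> real) list \<Rightarrow> real" where
  "all_ones_map k V = multilinear_extension V k (\<lambda>_. 1)"

text \<open>The map $\sigma_{\vec\pi}$ for the ordered partition \<open>ks\<close>.\<close>

definition partition_map ::
    "'a set \<Rightarrow> nat list \<Rightarrow> (('a \<Rightarrow> real) list \<Rightarrow> real) \<Rightarrow> ('a list \<Rightarrow> real) list \<Rightarrow> real" where
  "partition_map V ks \<sigma> xs =
     (\<Sum>bs | length bs = length ks \<and> (\<forall>i<length ks. bs ! i \<in> tuples V (ks ! i)).
        \<sigma> (map std_basis (concat bs)) * (\<Prod>i<length ks. (xs ! i) (bs ! i)))"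

definition spectral_norm ::
    "'a set \<Rightarrow> nat list \<Rightarrow> (('a list \<Rightarrow> real) list \<Rightarrow> real) \<Rightarrow> real" where
  "spectral_norm V ks \<phi> =
     (SUP xs \<in> {xs. length xs = length ks \<and>
                    (\<forall>i<length ks. L2_set (xs ! i) (tuples V (ks ! i)) = 1)}. \<bar>\<phi> xs\<bar>)"

definition lambda1 :: "nat list \<Rightarrow> 'a hypergraph \<Rightarrow> real" where
  "lambda1 ks H =
     spectral_norm (verts H) ks (partition_map (verts H) ks (adjacency_map (sum_list ks) H))"

definition lambda2 :: "nat list \<Rightarrow> 'a hypergraph \<Rightarrow> real" where
  "lambda2 ks H =
     (let V = verts H; k = sum_list ks in
      spectral_norm V ks (\<lambda>xs.
        partition_map V ks (adjacency_map k H) xs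
        - fact k * real (card (edges H)) / real (card V) ^ k
          * partition_map V ks (all_ones_map k V) xs))"


section \<open>Steps, paths and cycles\<close>

text \<open>
  Parts are numbered from \<open>0\<close>: \<open>PartA\<close> belongs to part \<open>0\<close> and \<open>PartB j\<close>, with
  \<open>1 \<le> j < t\<close>, is the set usually written $B_{j+1}$. Its codes arise from
  those of \<open>A\<close> by removing the \<open>j\<close>-th bit, where bits are counted from \<open>1\<close>.
\<close>

datatype step_vertex = PartA "bool list" | PartB nat "bool list"

fun part_of :: "step_vertex \<Rightarrow> nat" where
  "part_of (PartA w) = 0"
| "part_of (PartB j w) = j"

definition remove_bit :: "nat \<Rightarrow> bool list \<Rightarrow> bool list" where
  "remove_bit j w = take (j - 1) w @ drop j w"

definition simple_step :: "nat \<Rightarrow> step_vertex hypergraph" where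
  "simple_step t =
     \<lparr>verts = {PartA w | w. length w = t - 1} \<union>
              {PartB j w | j w. j \<in> {1..<t} \<and> length w = t - 2},
      edges = {mset (PartA w # map (\<lambda>j. PartB j (remove_bit j w)) [1..<t]) | w.
                 length w = t - 1}\<rparr>"

definition step :: "nat list \<Rightarrow> (step_vertex \<times> nat) hypergraph" where
  "step ks =
     (let S = simple_step (length ks) in
      \<lparr>verts = {(v, i). v \<in> verts S \<and> i \<in> {1..ks ! part_of v}},
       edges = (\<lambda>E. mset_set {(v, i). v \<in># E \<and> i \<in> {1..ks ! part_of v}}) ` edges S\<rparr>)"

text \<open>All bit strings of length \<open>n\<close> in lexicographic order.\<close>

fun bit_strings :: "nat \<Rightarrow> bool list list" where
  "bit_strings 0 = [[]]"
| "bit_strings (Suc n) = map ((#) False) (bit_strings n) @ map ((#) True) (bit_strings n)"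

definition step_attach :: "bool \<Rightarrow> nat list \<Rightarrow> (step_vertex \<times> nat) list" where
  "step_attach b ks =
     concat (map (\<lambda>w. map (\<lambda>i. (PartA (w @ [b]), i)) [1..<Suc (ks ! 0)])
       (bit_strings (length ks - 2)))"

text \<open>Identification of vertices: the quotient by the equivalence relation generated by \<open>R\<close>.\<close>

definition glue_class :: "('a \<times> 'a) set \<Rightarrow> 'a \<Rightarrow> 'a set" where
  "glue_class R v = (R \<union> R\<inverse>)\<^sup>* `` {v}"

definition glue :: "('a \<times> 'a) set \<Rightarrow> 'a hypergraph \<Rightarrow> 'a set hypergraph" where
  "glue R H =
     \<lparr>verts = glue_class R ` verts H, edges = image_mset (glue_class R) ` edges H\<rparr>"

definition disjoint_copies :: "nat \<Rightarrow> 'a hypergraph \<Rightarrow> (nat \<times> 'a) hypergraph" where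
  "disjoint_copies m H =
     \<lparr>verts = {..<m} \<times> verts H, edges = (\<Union>i<m. image_mset (Pair i) ` edges H)\<rparr>"

definition path_identifications ::
    "nat list \<Rightarrow> nat \<Rightarrow> ((nat \<times> step_vertex \<times> nat) \<times> (nat \<times> step_vertex \<times> nat)) set" where
  "path_identifications ks m =
     (\<Union>i\<in>{i. Suc i < m}.
        set (zip (map (Pair i) (step_attach True ks)) (map (Pair (Suc i)) (step_attach False ks))))"

text \<open>\<open>hpath ks m\<close> and \<open>hcycle ks m\<close> are the path and the cycle of length \<open>2 * m\<close>,
  built from \<open>m\<close> steps.\<close>

definition hpath :: "nat list \<Rightarrow> nat \<Rightarrow> (nat \<times> step_vertex \<times> nat) set hypergraph" where
  "hpath ks m = glue (path_identifications ks m) (disjoint_copies m (step ks))"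

definition hpath_attach_first :: "nat list \<Rightarrow> nat \<Rightarrow> (nat \<times> step_vertex \<times> nat) set list" where
  "hpath_attach_first ks m =
     map (\<lambda>v. glue_class (path_identifications ks m) (0, v)) (step_attach False ks)"

definition hpath_attach_last :: "nat list \<Rightarrow> nat \<Rightarrow> (nat \<times> step_vertex \<times> nat) set list" where
  "hpath_attach_last ks m =
     map (\<lambda>v. glue_class (path_identifications ks m) (m - 1, v)) (step_attach True ks)"

definition hcycle :: "nat list \<Rightarrow> nat \<Rightarrow> (nat \<times> step_vertex \<times> nat) set set hypergraph" where
  "hcycle ks m = glue (set (zip (hpath_attach_first ks m) (hpath_attach_last ks m))) (hpath ks m)"

end

theory Submission
  imports Defs "HOL-Combinatorics.Multiset_Permutations"
begin

text \<open>
  Divide the adjacency kernel by $n^{k/2}$ and let \<open>e\<close> denote the constant unit vector of each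
  tensor power. Summing out the second part of two copies of a \<open>t\<close>-partite kernel \<open>g\<close> gives a
  \<open>(t - 1)\<close>-partite kernel \<open>g'\<close> on doubled blocks. After \<open>t - 1\<close> such eliminations one is left
  with a Gram matrix \<open>K\<close>, and the trace of its \<open>m\<close>-th power is the homomorphism density of the
  cycle built from \<open>m\<close> steps.

  By Cauchy--Schwarz the edge density bounds \<open>\<langle>e, K e\<rangle>\<close> from below by \<open>c - o(1)\<close>, where \<open>c\<close> is
  \<open>p\<close> raised to the number of edges of a step, while the cycle count bounds the trace of
  $K^{2l}$ by $c^{2l} + o(1)$. For unit vectors \<open>e\<close> and \<open>h\<close> with \<open>h\<close> orthogonal to \<open>e\<close>,
  $\langle e, K e\rangle^{2l} + \langle h, K h\rangle^{2l}$ is at most this trace, so \<open>K\<close> is close to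
  the rank one form \<open>c e \<otimes> e\<close>. This closeness lifts back through the eliminations: if the
  form of \<open>g'\<close> is close to $p^2$ times the product of the functionals \<open>\<langle>_, e\<rangle>\<close>, and \<open>g\<close> has density
  at least \<open>p - o(1)\<close>, then the form of \<open>g\<close> is close to \<open>p\<close> times that product. All
  estimates are in terms of Euclidean norms, so the last one is the claim.
\<close>

section \<open>Gram kernels\<close>

text \<open>The trace exponent is even because the trace of K^(2l) is the squared Hilbert-Schmidt
  norm of K^l: Bessel's inequality for matrices then replaces a spectral decomposition, and
  log-convexity of the moments of K carries bounds on K^l back to K. The constant vector need not be
  an eigenvector; the cross terms are paid for by Cauchy-Schwarz in the semi-inner product of K.

  An elimination turns p into p^2 and doubles the blocks. The induction therefore ranges over all p,
  all block lengths and arbitrary kernels, with a delta independent of the vertex set. Reordering of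
  parts is done on the adjacency kernel itself, which depends only on the multiset of its entries.

  Inner products of slices determine the slices only up to a common rotation; the density bound
  fixes the direction. No upper bound on the number of edges is assumed: the one that the second
  spectral quantity requires comes out of the closeness itself. Homomorphisms of the cycle are
  counted through tuples assigned to whole blocks, and those that are not injective number only
  O(n^(v-1)) for a cycle on v vertices.\<close>

locale gram_kernel =
  fixes Y :: "'y set" and Z :: "'z set" and Q :: "'y \<Rightarrow> 'z \<Rightarrow> real"
  assumes finite_Y: "finite Y" and finite_Z: "finite Z"
begin

definition K :: "'y \<Rightarrow> 'y \<Rightarrow> real" where
  "K x y = (\<Sum>z\<in>Z. Q x z * Q y z)"

definition ip :: "('y \<Rightarrow> real) \<Rightarrow> ('y \<Rightarrow> real) \<Rightarrow> real" where
  "ip u v = (\<Sum>x\<in>Y. u x * v x)"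

definition T :: "('y \<Rightarrow> real) \<Rightarrow> 'y \<Rightarrow> real" where
  "T u x = (\<Sum>y\<in>Y. K x y * u y)"

text \<open>Kept beside the iterates \<open>T ^^ j\<close>: moments need the operator, while traces
  and walk counts need the matrix entries.\<close>

primrec kpow :: "nat \<Rightarrow> 'y \<Rightarrow> 'y \<Rightarrow> real" where
  "kpow 0 x y = (if x = y then 1 else 0)"
| "kpow (Suc j) x y = (\<Sum>z\<in>Y. kpow j x z * K z y)"

lemma K_sym: "K x y = K y x"
  by (simp add: K_def mult.commute)

lemma ip_sym: "ip u v = ip v u"
  by (simp add: ip_def mult.commute)

lemma ip_T: "ip u (T v) = (\<Sum>z\<in>Z. (\<Sum>x\<in>Y. u x * Q x z) * (\<Sum>y\<in>Y. v y * Q y z))"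
proof -
  have "ip u (T v) = (\<Sum>x\<in>Y. \<Sum>y\<in>Y. \<Sum>z\<in>Z. (u x * Q x z) * (v y * Q y z))"
    by (simp add: ip_def T_def K_def sum_distrib_left sum_distrib_right mult_ac)
  also have "\<dots> = (\<Sum>x\<in>Y. \<Sum>z\<in>Z. \<Sum>y\<in>Y. (u x * Q x z) * (v y * Q y z))"
    by (intro sum.cong refl sum.swap)
  also have "\<dots> = (\<Sum>z\<in>Z. \<Sum>x\<in>Y. \<Sum>y\<in>Y. (u x * Q x z) * (v y * Q y z))"
    by (rule sum.swap)
  finally show ?thesis
    by (simp add: sum_product)
qed

lemma ip_T_sym: "ip (T u) v = ip u (T v)"
  by (subst ip_sym) (simp add: ip_T mult.commute)

lemma ip_T_nonneg: "0 \<le> ip u (T u)"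
  by (simp add: ip_T sum_nonneg)

lemma ip_self_nonneg: "0 \<le> ip u u"
  by (simp add: ip_def sum_nonneg)

lemma ip_Cauchy_Schwarz: "(ip u v)\<^sup>2 \<le> ip u u * ip v v"
  using Cauchy_Schwarz_ineq_sum[of u v Y] by (simp add: ip_def power2_eq_square)

lemma ip_T_Cauchy_Schwarz: "(ip u (T v))\<^sup>2 \<le> ip u (T u) * ip v (T v)"
  using Cauchy_Schwarz_ineq_sum[of "\<lambda>z. \<Sum>x\<in>Y. u x * Q x z" "\<lambda>z. \<Sum>x\<in>Y. v x * Q x z" Z]
  by (simp add: ip_T power2_eq_square)

lemma ip_funpow_shift: "ip ((T ^^ i) u) ((T ^^ j) v) = ip u ((T ^^ (i + j)) v)"
proof (induction i arbitrary: j)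
  case (Suc i)
  have "ip ((T ^^ Suc i) u) ((T ^^ j) v) = ip ((T ^^ i) u) ((T ^^ Suc j) v)"
    by (simp add: ip_T_sym)
  also have "\<dots> = ip u ((T ^^ (i + Suc j)) v)"
    by (rule Suc.IH)
  finally show ?case by simp
qed simp

text \<open>Cauchy-Schwarz between neighbouring iterates of \<open>u\<close>. For even
  \<open>j\<close> the plain inner product suffices; for odd \<open>j\<close> the semi-inner product
  \<open>ip u (T v)\<close> absorbs the extra power, so no square root of \<open>T\<close> is
  needed.\<close>

lemma moment_log_convex:
  "(ip u ((T ^^ Suc j) u))\<^sup>2 \<le> ip u ((T ^^ j) u) * ip u ((T ^^ Suc (Suc j)) u)"
proof (cases "even j")
  case True
  then obtain a where j: "j = a + a" by (auto elim: evenE simp: mult_2)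
  have "(ip ((T ^^ a) u) ((T ^^ Suc a) u))\<^sup>2
      \<le> ip ((T ^^ a) u) ((T ^^ a) u) * ip ((T ^^ Suc a) u) ((T ^^ Suc a) u)"
    by (rule ip_Cauchy_Schwarz)
  then show ?thesis
    by (simp only: ip_funpow_shift j add_Suc add_Suc_right)
next
  case False
  then obtain a where j: "j = Suc (a + a)" by (auto elim: oddE simp: mult_2)
  have "(ip ((T ^^ a) u) (T ((T ^^ Suc a) u)))\<^sup>2
      \<le> ip ((T ^^ a) u) (T ((T ^^ a) u)) * ip ((T ^^ Suc a) u) (T ((T ^^ Suc a) u))"
    by (rule ip_T_Cauchy_Schwarz)
  then have "(ip ((T ^^ a) u) ((T ^^ Suc (Suc a)) u))\<^sup>2
      \<le> ip ((T ^^ a) u) ((T ^^ Suc a) u) * ip ((T ^^ Suc a) u) ((T ^^ Suc (Suc a)) u)"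
    by simp
  then show ?thesis
    by (simp only: ip_funpow_shift j add_Suc add_Suc_right)
qed

lemma moment_nonneg: "0 \<le> ip u ((T ^^ j) u)"
proof (cases "even j")
  case True
  then obtain a where "j = a + a" by (auto elim: evenE simp: mult_2)
  then show ?thesis
    using ip_self_nonneg[of "(T ^^ a) u"] by (simp only: ip_funpow_shift)
next
  case False
  then obtain a where j: "j = a + Suc a" by (auto elim: oddE simp: mult_2)
  have "0 \<le> ip ((T ^^ a) u) ((T ^^ Suc a) u)"
    using ip_T_nonneg[of "(T ^^ a) u"] by simp
  then show ?thesis
    by (simp only: ip_funpow_shift j)
qed

text \<open>Log-convexity makes the ratios of consecutive moments nondecreasing, and the first ratio
  is \<open>ip u (T u)\<close> because the zeroth moment is 1.\<close>

lemma moment_power: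
  assumes "ip u u = 1"
  shows "ip u (T u) ^ j \<le> ip u ((T ^^ j) u)"
proof -
  define s where "s j = ip u ((T ^^ j) u)" for j
  have nonneg: "0 \<le> s j" for j
    by (simp add: s_def moment_nonneg)
  have conv: "s (Suc j) * s (Suc j) \<le> s j * s (Suc (Suc j))" for j
    unfolding s_def using moment_log_convex[of u j] by (simp only: power2_eq_square)
  have step: "s 1 * s j \<le> s (Suc j)" for j
  proof (induction j)
    case 0
    then show ?case by (simp add: s_def assms)
  next
    case (Suc j)
    show ?case
    proof (cases "s j = 0")
      \<comment> \<open>No ratio can be formed at a vanishing moment, but by log-convexity the next
        moment vanishes as well.\<close>
      case True
      then have "s (Suc j) = 0"
        using conv[of j] by (simp add: mult_le_0_iff) (metis nonneg order.antisym)
      then show ?thesis using nonneg by simp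
    next
      case False
      then have pos: "s j > 0" using nonneg[of j] by simp
      have "s j * (s 1 * s (Suc j)) = (s 1 * s j) * s (Suc j)" by simp
      also have "\<dots> \<le> s (Suc j) * s (Suc j)"
        by (rule mult_right_mono[OF Suc.IH nonneg])
      also have "\<dots> \<le> s j * s (Suc (Suc j))" by (rule conv)
      finally show ?thesis using pos by simp
    qed
  qed
  have "s 1 ^ j \<le> s j"
  proof (induction j)
    case 0
    then show ?case by (simp add: s_def assms)
  next
    case (Suc j)
    have "s 1 ^ Suc j \<le> s 1 * s j"
      using mult_left_mono[OF Suc.IH nonneg[of 1]] by simp
    also have "\<dots> \<le> s (Suc j)" by (rule step)
    finally show ?case .
  qed
  then show ?thesis by (simp add: s_def)
qed

section \<open>Matrix powers and Bessel bounds for the trace\<close>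

lemma kpow_ip: "(\<Sum>x\<in>Y. \<Sum>y\<in>Y. u x * kpow j x y * v y) = ip u ((T ^^ j) v)"
proof (induction j arbitrary: v)
  case 0
  have "(\<Sum>y\<in>Y. u x * kpow 0 x y * v y) = u x * v x" if "x \<in> Y" for x
  proof -
    have "(\<Sum>y\<in>Y. u x * kpow 0 x y * v y) = (\<Sum>y\<in>Y. if x = y then u x * v x else 0)"
      by (intro sum.cong) auto
    then show ?thesis using that finite_Y by simp
  qed
  then show ?case by (simp add: ip_def)
next
  case (Suc j)
  have "(\<Sum>x\<in>Y. \<Sum>y\<in>Y. u x * kpow (Suc j) x y * v y)
      = (\<Sum>x\<in>Y. \<Sum>y\<in>Y. \<Sum>z\<in>Y. u x * kpow j x z * (K z y * v y))"
    by (simp add: sum_distrib_left sum_distrib_right mult_ac)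
  also have "\<dots> = (\<Sum>x\<in>Y. \<Sum>z\<in>Y. \<Sum>y\<in>Y. u x * kpow j x z * (K z y * v y))"
    by (intro sum.cong refl sum.swap)
  also have "\<dots> = (\<Sum>x\<in>Y. \<Sum>z\<in>Y. u x * kpow j x z * T v z)"
    by (simp add: T_def sum_distrib_left)
  also have "\<dots> = ip u ((T ^^ j) (T v))" by (rule Suc.IH)
  finally show ?case by (simp only: funpow_Suc_right comp_apply)
qed

lemma kpow_add:
  assumes "y \<in> Y"
  shows "kpow (i + j) x y = (\<Sum>z\<in>Y. kpow i x z * kpow j z y)"
  using assms
proof (induction j arbitrary: y)
  case 0
  have "(\<Sum>z\<in>Y. kpow i x z * kpow 0 z y) = (\<Sum>z\<in>Y. if y = z then kpow i x y else 0)"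
    by (intro sum.cong) auto
  then show ?case using 0 finite_Y by simp
next
  case (Suc j)
  have "kpow (i + Suc j) x y = (\<Sum>z\<in>Y. (\<Sum>w\<in>Y. kpow i x w * kpow j w z) * K z y)"
    using Suc.IH by simp
  also have "\<dots> = (\<Sum>z\<in>Y. \<Sum>w\<in>Y. kpow i x w * (kpow j w z * K z y))"
    by (simp add: sum_distrib_right mult.assoc)
  also have "\<dots> = (\<Sum>w\<in>Y. \<Sum>z\<in>Y. kpow i x w * (kpow j w z * K z y))"
    by (rule sum.swap)
  finally show ?case by (simp add: sum_distrib_left)
qed

lemma kpow_1: "x \<in> Y \<Longrightarrow> kpow (Suc 0) x y = K x y"
proof -
  assume "x \<in> Y"
  have "kpow (Suc 0) x y = (\<Sum>z\<in>Y. if x = z then K x y else 0)"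
    by (simp, intro sum.cong) auto
  then show ?thesis using \<open>x \<in> Y\<close> finite_Y by simp
qed

lemma kpow_sym: "x \<in> Y \<Longrightarrow> y \<in> Y \<Longrightarrow> kpow j x y = kpow j y x"
proof (induction j arbitrary: x y)
  case (Suc j)
  have "kpow (Suc j) y x = (\<Sum>z\<in>Y. K y z * kpow j z x)"
    using kpow_add[of x "Suc 0" j y] Suc.prems kpow_1 by (simp del: kpow.simps)
  also have "\<dots> = (\<Sum>z\<in>Y. kpow j x z * K z y)"
    using Suc by (intro sum.cong) (auto simp: K_sym[of y])
  finally show ?case by simp
qed auto

definition trace_pow :: "nat \<Rightarrow> real" where
  "trace_pow m = (\<Sum>x\<in>Y. kpow m x x)"

text \<open>Evenness enters here: for a symmetric matrix the trace of the square is a sum of squares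
  of entries, a Hilbert-Schmidt norm.\<close>

lemma trace_pow_double: "trace_pow (2 * l) = (\<Sum>x\<in>Y. \<Sum>y\<in>Y. (kpow l x y)\<^sup>2)"
  unfolding trace_pow_def
proof (intro sum.cong refl)
  fix x assume "x \<in> Y"
  then show "kpow (2 * l) x x = (\<Sum>y\<in>Y. (kpow l x y)\<^sup>2)"
    using kpow_add[of x l l x] kpow_sym[of _ x l]
    by (simp add: mult_2 power2_eq_square)
qed

text \<open>Bessel's inequality for \<open>kpow l\<close> against the orthonormal family \<open>e \<otimes> e\<close>, \<open>h \<otimes> h\<close>.\<close>

lemma orthonormal_moments_le_trace:
  assumes e: "ip e e = 1" and h: "ip h h = 1" and eh: "ip e h = 0"
  shows "ip e (T e) ^ (2 * l) + ip h (T h) ^ (2 * l) \<le> trace_pow (2 * l)"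
proof -
  define A where "A = ip e ((T ^^ l) e)"
  define B where "B = ip h ((T ^^ l) h)"
  have dbl: "(\<Sum>x\<in>Y. u x * v x * (\<Sum>y\<in>Y. u' y * v' y)) = ip u v * ip u' v'" for u v u' v'
    by (simp only: ip_def sum_distrib_right)
  have "0 \<le> (\<Sum>x\<in>Y. \<Sum>y\<in>Y. (kpow l x y - A * (e x * e y) - B * (h x * h y))\<^sup>2)"
    by (intro sum_nonneg) simp
  also have "\<dots> = (\<Sum>x\<in>Y. \<Sum>y\<in>Y. (kpow l x y)\<^sup>2 - 2 * A * (e x * kpow l x y * e y)
      - 2 * B * (h x * kpow l x y * h y) + A\<^sup>2 * ((e x * e x) * (e y * e y))
      + B\<^sup>2 * ((h x * h x) * (h y * h y)) + 2 * A * B * ((e x * h x) * (e y * h y)))"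
    by (intro sum.cong refl) (simp add: power2_eq_square algebra_simps)
  also have "\<dots> = trace_pow (2 * l) - 2 * A * A - 2 * B * B + A\<^sup>2 + B\<^sup>2"
    by (simp only: sum.distrib sum_subtractf sum_distrib_left[symmetric] dbl)
       (simp add: e h eh kpow_ip A_def B_def trace_pow_double)
  finally have "A\<^sup>2 + B\<^sup>2 \<le> trace_pow (2 * l)"
    by (simp add: power2_eq_square)
  moreover have "ip e (T e) ^ (2 * l) \<le> A\<^sup>2"
    using power_mono[OF moment_power[OF e, of l], of 2] ip_T_nonneg[of e]
    by (simp add: A_def power_mult[symmetric] mult.commute)
  moreover have "ip h (T h) ^ (2 * l) \<le> B\<^sup>2"
    using power_mono[OF moment_power[OF h, of l], of 2] ip_T_nonneg[of h]
    by (simp add: B_def power_mult[symmetric] mult.commute)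
  ultimately show ?thesis by linarith
qed

text \<open>The one-vector case of Bessel is separate because a unit vector orthogonal to
  \<open>e\<close> need not exist, for instance when \<open>Y\<close> is a single point.\<close>

lemma moment_le_trace:
  assumes e: "ip e e = 1"
  shows "ip e (T e) ^ (2 * l) \<le> trace_pow (2 * l)"
proof -
  define A where "A = ip e ((T ^^ l) e)"
  have dbl: "(\<Sum>x\<in>Y. u x * v x * (\<Sum>y\<in>Y. u' y * v' y)) = ip u v * ip u' v'" for u v u' v'
    by (simp only: ip_def sum_distrib_right)
  have "0 \<le> (\<Sum>x\<in>Y. \<Sum>y\<in>Y. (kpow l x y - A * (e x * e y))\<^sup>2)"
    by (intro sum_nonneg) simp
  also have "\<dots> = (\<Sum>x\<in>Y. \<Sum>y\<in>Y. (kpow l x y)\<^sup>2 - 2 * A * (e x * kpow l x y * e y)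
      + A\<^sup>2 * ((e x * e x) * (e y * e y)))"
    by (intro sum.cong refl) (simp add: power2_eq_square algebra_simps)
  also have "\<dots> = trace_pow (2 * l) - 2 * A * A + A\<^sup>2"
    by (simp only: sum.distrib sum_subtractf sum_distrib_left[symmetric] dbl)
       (simp add: e kpow_ip A_def trace_pow_double)
  finally have "A\<^sup>2 \<le> trace_pow (2 * l)"
    by (simp add: power2_eq_square)
  moreover have "ip e (T e) ^ (2 * l) \<le> A\<^sup>2"
    using power_mono[OF moment_power[OF e, of l], of 2] ip_T_nonneg[of e]
    by (simp add: A_def power_mult[symmetric] mult.commute)
  ultimately show ?thesis by linarith
qed

section \<open>Closeness of the Gram form to rank one\<close>

lemma ip_T_linear:
  "ip u (T (\<lambda>x. a * v x + b * w x)) = a * ip u (T v) + b * ip u (T w)"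
  "ip (\<lambda>x. a * v x + b * w x) u = a * ip v u + b * ip w u"
proof -
  show "ip (\<lambda>x. a * v x + b * w x) u = a * ip v u + b * ip w u" for v w u
    by (simp add: ip_def sum.distrib sum_distrib_left algebra_simps)
  then show "ip u (T (\<lambda>x. a * v x + b * w x)) = a * ip u (T v) + b * ip u (T w)"
    using ip_T_sym[of u "\<lambda>x. a * v x + b * w x"] ip_T_sym[of u v] ip_T_sym[of u w]
    by (simp add: ip_sym[of "T u"])
qed

text \<open>The vector \<open>e\<close> uses up all of the trace except
  \<open>\<eta> ^ (2 * l)\<close>, and a unit vector orthogonal to \<open>e\<close> has to fit into
  the rest. A shorter \<open>h\<close> is normalised first.\<close>

lemma ip_T_orthogonal_le:
  assumes e: "ip e e = 1" and h: "ip h h \<le> 1" and eh: "ip e h = 0" and "l \<ge> 1" "0 \<le> \<eta>"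
    and tr: "trace_pow (2 * l) \<le> ip e (T e) ^ (2 * l) + \<eta> ^ (2 * l)"
  shows "ip h (T h) \<le> \<eta>"
proof (cases "ip h h = 0")
  case True
  then have "\<forall>x\<in>Y. h x = 0"
    using finite_Y by (simp add: ip_def sum_nonneg_eq_0_iff)
  then have "ip h (T h) = 0" by (simp add: ip_def)
  then show ?thesis using assms by simp
next
  case False
  define r where "r = sqrt (ip h h)"
  have r: "r > 0" "r\<^sup>2 = ip h h" "r \<le> 1"
    using False ip_self_nonneg[of h] h by (auto simp: r_def)
  \<comment> \<open>The idle summand \<open>0 * h x\<close> gives \<open>h'\<close> the shape of a
    linear combination that \<open>ip_T_linear\<close> can rewrite.\<close>
  define h' where "h' x = (1 / r) * h x + 0 * h x" for x
  have 1: "ip h' h' = 1"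
    using r False by (simp add: h'_def ip_def sum_divide_distrib[symmetric] power2_eq_square)
  have 2: "ip e h' = 0"
    using eh by (simp add: h'_def ip_def sum_divide_distrib[symmetric])
  have "ip h' (T h') ^ (2 * l) \<le> \<eta> ^ (2 * l)"
    using orthonormal_moments_le_trace[OF e 1 2, of l] tr by linarith
  then have 3: "ip h' (T h') \<le> \<eta>"
    using power_le_imp_le_base[of _ "2 * l - 1"] assms by (cases "2 * l") auto
  have "ip h' (T h') = ip h (T h) / r\<^sup>2"
    unfolding h'_def by (simp only: ip_T_linear) (simp add: power2_eq_square)
  then have "ip h (T h) = r\<^sup>2 * ip h' (T h')" using r False by simp
  also have "\<dots> \<le> 1 * ip h' (T h')"
    using r h ip_T_nonneg by (intro mult_right_mono) (auto simp: power_le_one)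
  finally show ?thesis using 3 by simp
qed

text \<open>Split \<open>u\<close> and \<open>v\<close> into components along \<open>e\<close> and
  remainders \<open>hu\<close>, \<open>hv\<close>. Since \<open>e\<close> need not be an
  eigenvector, mixed terms survive; Cauchy-Schwarz for the form of \<open>T\<close> bounds each by
  \<open>sqrt (s * \<eta>)\<close> and the term of the two remainders by \<eta>.\<close>

lemma near_rank_one:
  assumes e: "ip e e = 1" and u: "ip u u = 1" and v: "ip v v = 1" and "l \<ge> 1" "0 \<le> \<eta>"
    and tr: "trace_pow (2 * l) \<le> ip e (T e) ^ (2 * l) + \<eta> ^ (2 * l)"
  shows "\<bar>ip u (T v) - ip e (T e) * ip u e * ip v e\<bar> \<le> 2 * sqrt (ip e (T e) * \<eta>) + \<eta>"
proof -
  define s where "s = ip e (T e)"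
  define hu where "hu x = 1 * u x + (- ip u e) * e x" for x
  define hv where "hv x = 1 * v x + (- ip v e) * e x" for x
  have s0: "s \<ge> 0" by (simp add: s_def ip_T_nonneg)
  have orth: "ip e h = 0" "ip h h \<le> 1" "\<bar>ip w e\<bar> \<le> 1"
    if w: "ip w w = 1" and h: "h = (\<lambda>x. 1 * w x + (- ip w e) * e x)" for w h
  proof -
    have wh: "ip h z = ip w z - ip w e * ip e z" for z
      unfolding h by (simp add: ip_T_linear(2)[of 1 w "- ip w e" e z, simplified])
    show "ip e h = 0" using wh[of e] e by (simp add: ip_sym)
    then have "ip h h = ip w h" using wh[of h] by simp
    also have "\<dots> = 1 - (ip w e)\<^sup>2"
      using wh[of w] w by (simp add: ip_sym[of w h] ip_sym[of e w] power2_eq_square)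
    finally show "ip h h \<le> 1" by simp
    have "(ip w e)\<^sup>2 \<le> 1" using ip_Cauchy_Schwarz[of w e] w e by simp
    then show "\<bar>ip w e\<bar> \<le> 1" by (simp add: abs_square_le_1)
  qed
  note ou = orth[OF u, of hu] and ov = orth[OF v, of hv]
  have ou': "ip e hu = 0" "ip hu hu \<le> 1" "\<bar>ip u e\<bar> \<le> 1" using ou by (auto simp: hu_def[abs_def])
  have ov': "ip e hv = 0" "ip hv hv \<le> 1" "\<bar>ip v e\<bar> \<le> 1" using ov by (auto simp: hv_def[abs_def])
  have ku: "ip hu (T hu) \<le> \<eta>" by (rule ip_T_orthogonal_le[OF e ou'(2,1) assms(4,5) tr])
  have kv: "ip hv (T hv) \<le> \<eta>" by (rule ip_T_orthogonal_le[OF e ov'(2,1) assms(4,5) tr])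
  have ehu: "\<bar>ip e (T hu)\<bar> \<le> sqrt (s * \<eta>)"
  proof (rule real_le_rsqrt)
    have "(ip e (T hu))\<^sup>2 \<le> s * ip hu (T hu)" unfolding s_def by (rule ip_T_Cauchy_Schwarz)
    also have "\<dots> \<le> s * \<eta>" using ku s0 by (rule mult_left_mono)
    finally show "\<bar>ip e (T hu)\<bar>\<^sup>2 \<le> s * \<eta>" by simp
  qed
  have ehv: "\<bar>ip e (T hv)\<bar> \<le> sqrt (s * \<eta>)"
  proof (rule real_le_rsqrt)
    have "(ip e (T hv))\<^sup>2 \<le> s * ip hv (T hv)" unfolding s_def by (rule ip_T_Cauchy_Schwarz)
    also have "\<dots> \<le> s * \<eta>" using kv s0 by (rule mult_left_mono)
    finally show "\<bar>ip e (T hv)\<bar>\<^sup>2 \<le> s * \<eta>" by simp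
  qed
  have huv: "\<bar>ip hu (T hv)\<bar> \<le> \<eta>"
  proof (rule power2_le_imp_le[OF _ assms(5)])
    have "(ip hu (T hv))\<^sup>2 \<le> ip hu (T hu) * ip hv (T hv)" by (rule ip_T_Cauchy_Schwarz)
    also have "\<dots> \<le> \<eta> * \<eta>" using ku kv assms(5) ip_T_nonneg by (intro mult_mono) auto
    finally show "\<bar>ip hu (T hv)\<bar>\<^sup>2 \<le> \<eta>\<^sup>2" by (simp add: power2_eq_square)
  qed
  have hh: "ip hu (T hv) = ip u (T v) - ip v e * ip u (T e) - ip u e * ip e (T v) + ip u e * ip v e * s"
    unfolding hu_def hv_def by (simp only: ip_T_linear) (simp add: s_def algebra_simps)
  have he: "ip e (T hu) = ip u (T e) - ip u e * s"
    unfolding hu_def by (simp only: ip_T_linear) (simp add: s_def ip_sym[of u] ip_T_sym)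
  have he': "ip e (T hv) = ip e (T v) - ip v e * s"
    unfolding hv_def by (simp only: ip_T_linear) (simp add: s_def)
  have "ip u (T v) - s * ip u e * ip v e
      = ip u e * ip e (T hv) + ip v e * ip e (T hu) + ip hu (T hv)"
    unfolding hh he he' by (simp add: algebra_simps)
  moreover have "\<bar>ip u e * ip e (T hv)\<bar> \<le> 1 * sqrt (s * \<eta>)"
    unfolding abs_mult using ou' ehv by (intro mult_mono) auto
  moreover have "\<bar>ip v e * ip e (T hu)\<bar> \<le> 1 * sqrt (s * \<eta>)"
    unfolding abs_mult using ov' ehu by (intro mult_mono) auto
  ultimately show ?thesis using huv unfolding s_def by linarith
qed

text \<open>The weight \<open>h\<close> of the endpoints is arbitrary so that the induction can move
  the last edge of the walk into it; \<open>h x y = K y x\<close> then closes the walk.\<close>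

lemma closed_walk_sum_aux:
  "(\<Sum>a\<in>{..<Suc j} \<rightarrow>\<^sub>E Y. (\<Prod>i<j. K (a i) (a (Suc i))) * h (a 0) (a j))
     = (\<Sum>x\<in>Y. \<Sum>y\<in>Y. kpow j x y * h x y)"
proof (induction j arbitrary: h)
  case 0
  have "(\<Sum>a\<in>{..<Suc 0} \<rightarrow>\<^sub>E Y. h (a 0) (a 0)) = (\<Sum>x\<in>Y. h x x)"
    by (rule sum.reindex_bij_witness[of _ "\<lambda>x. \<lambda>i\<in>{..<Suc 0}. x" "\<lambda>a. a 0"])
       (auto simp: PiE_def extensional_def fun_eq_iff)
  moreover have "(\<Sum>y\<in>Y. kpow 0 x y * h x y) = h x x" if "x \<in> Y" for x
  proof -
    have "(\<Sum>y\<in>Y. kpow 0 x y * h x y) = (\<Sum>y\<in>Y. if x = y then h x x else 0)"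
      by (intro sum.cong) auto
    then show ?thesis using that finite_Y by simp
  qed
  ultimately show ?case by simp
next
  case (Suc j)
  have "(\<Sum>a\<in>{..<Suc (Suc j)} \<rightarrow>\<^sub>E Y. (\<Prod>i<Suc j. K (a i) (a (Suc i))) * h (a 0) (a (Suc j)))
      = (\<Sum>(z, a)\<in>Y \<times> ({..<Suc j} \<rightarrow>\<^sub>E Y).
          (\<Prod>i<j. K (a i) (a (Suc i))) * (K (a j) z * h (a 0) z))"
  proof (rule sum.reindex_bij_witness[of _ "\<lambda>(z, a). a(Suc j := z)"
          "\<lambda>a. (a (Suc j), restrict a {..<Suc j})"])
    fix a assume "a \<in> {..<Suc (Suc j)} \<rightarrow>\<^sub>E Y"
    then show "(case (a (Suc j), restrict a {..<Suc j}) of (z, a) \<Rightarrow> a(Suc j := z)) = a"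
      by (auto simp: PiE_def extensional_def fun_eq_iff)
  next
    fix a assume a: "a \<in> {..<Suc (Suc j)} \<rightarrow>\<^sub>E Y"
    have "a i \<in> Y" if "i < Suc (Suc j)" for i
      using PiE_mem[OF a, of i] that by simp
    then show "(a (Suc j), restrict a {..<Suc j}) \<in> Y \<times> ({..<Suc j} \<rightarrow>\<^sub>E Y)"
      by (simp add: restrict_PiE_iff)
    have "(\<Prod>i<j. K (restrict a {..<Suc j} i) (restrict a {..<Suc j} (Suc i)))
        = (\<Prod>i<j. K (a i) (a (Suc i)))"
      by (intro prod.cong) auto
    then show "(case (a (Suc j), restrict a {..<Suc j}) of (z, a) \<Rightarrow>
         (\<Prod>i<j. K (a i) (a (Suc i))) * (K (a j) z * h (a 0) z)) =
         (\<Prod>i<Suc j. K (a i) (a (Suc i))) * h (a 0) (a (Suc j))"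
      by simp
  next
    fix b assume "b \<in> Y \<times> ({..<Suc j} \<rightarrow>\<^sub>E Y)"
    then obtain z a where b: "b = (z, a)" "z \<in> Y" "a \<in> {..<Suc j} \<rightarrow>\<^sub>E Y" by auto
    then show "((case b of (z, a) \<Rightarrow> a(Suc j := z)) (Suc j),
          restrict (case b of (z, a) \<Rightarrow> a(Suc j := z)) {..<Suc j}) = b"
      by (auto simp: PiE_def extensional_def fun_eq_iff)
    show "(case b of (z, a) \<Rightarrow> a(Suc j := z)) \<in> {..<Suc (Suc j)} \<rightarrow>\<^sub>E Y"
      using b by (auto simp: PiE_def extensional_def Pi_def less_Suc_eq)
  qed
  also have "\<dots> = (\<Sum>z\<in>Y. \<Sum>a\<in>{..<Suc j} \<rightarrow>\<^sub>E Y.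
          (\<Prod>i<j. K (a i) (a (Suc i))) * (K (a j) z * h (a 0) z))"
    by (simp add: sum.cartesian_product)
  also have "\<dots> = (\<Sum>z\<in>Y. \<Sum>x\<in>Y. \<Sum>y\<in>Y. kpow j x y * (K y z * h x z))"
    by (intro sum.cong refl Suc.IH)
  also have "\<dots> = (\<Sum>x\<in>Y. \<Sum>z\<in>Y. \<Sum>y\<in>Y. kpow j x y * (K y z * h x z))"
    by (rule sum.swap)
  also have "\<dots> = (\<Sum>x\<in>Y. \<Sum>z\<in>Y. kpow (Suc j) x z * h x z)"
    by (simp add: sum_distrib_right mult.assoc)
  finally show ?case .
qed

lemma trace_pow_closed_walks:
  assumes "m \<ge> 1"
  shows "trace_pow m = (\<Sum>a\<in>{..<m} \<rightarrow>\<^sub>E Y. \<Prod>i<m. K (a i) (a (Suc i mod m)))"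
proof -
  obtain j where m: "m = Suc j" using assms by (cases m) auto
  have "(\<Prod>i<m. K (a i) (a (Suc i mod m))) = (\<Prod>i<j. K (a i) (a (Suc i))) * K (a j) (a 0)" for a
    by (simp add: m)
  then have "(\<Sum>a\<in>{..<m} \<rightarrow>\<^sub>E Y. \<Prod>i<m. K (a i) (a (Suc i mod m)))
      = (\<Sum>x\<in>Y. \<Sum>y\<in>Y. kpow j x y * K y x)"
    using closed_walk_sum_aux[of j "\<lambda>x y. K y x"] by (simp add: m)
  then show ?thesis by (simp add: trace_pow_def m)
qed

end

text \<open>For exact inner products, \<open>F\<close> would equal \<open>a * G\<close> and
  \<open>G\<close> would have norm \<open>p\<close>. Approximately, the squared distance from
  \<open>F\<close> to \<open>a * G\<close> is at most \<open>4 * \<delta>\<close>. Only the last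
  hypothesis fixes the direction of \<open>G\<close>: with it, expanding the square puts
  \<open>G\<close> near \<open>p * e\<close>.\<close>

lemma lift_near_constant:
  fixes F G v e :: "'y \<Rightarrow> real"
  assumes v: "(\<Sum>y\<in>Y. (v y)\<^sup>2) = 1" and e: "(\<Sum>y\<in>Y. (e y)\<^sup>2) = 1"
    and a: "\<bar>a\<bar> \<le> 1" and p: "0 < p"
    and FF: "\<bar>(\<Sum>y\<in>Y. F y * F y) - p\<^sup>2 * (a * a)\<bar> \<le> \<delta>"
    and FG: "\<bar>(\<Sum>y\<in>Y. F y * G y) - p\<^sup>2 * a\<bar> \<le> \<delta>"
    and GG: "\<bar>(\<Sum>y\<in>Y. G y * G y) - p\<^sup>2\<bar> \<le> \<delta>"
    and G: "p - \<delta>' \<le> (\<Sum>y\<in>Y. G y * e y)"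
  shows "\<bar>(\<Sum>y\<in>Y. v y * F y) - p * a * (\<Sum>y\<in>Y. v y * e y)\<bar> \<le> 2 * sqrt \<delta> + sqrt (\<delta> + 2 * p * \<delta>')"
proof -
  have CS: "\<bar>\<Sum>y\<in>Y. v y * w y\<bar> \<le> sqrt B" if "(\<Sum>y\<in>Y. (w y)\<^sup>2) \<le> B" for w B
    using Cauchy_Schwarz_ineq_sum[of v w Y] that v by (intro real_le_rsqrt) auto
  have d: "\<delta> \<ge> 0" using FF by linarith
  have "(\<Sum>y\<in>Y. (F y - a * G y)\<^sup>2)
      = (\<Sum>y\<in>Y. F y * F y) - 2 * a * (\<Sum>y\<in>Y. F y * G y) + a * a * (\<Sum>y\<in>Y. G y * G y)"
    by (simp add: power2_eq_square algebra_simps sum.distrib sum_subtractf sum_distrib_left)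
  also have "\<dots> = ((\<Sum>y\<in>Y. F y * F y) - p\<^sup>2 * (a * a)) - 2 * a * ((\<Sum>y\<in>Y. F y * G y) - p\<^sup>2 * a)
      + a * a * ((\<Sum>y\<in>Y. G y * G y) - p\<^sup>2)"
    by (simp add: algebra_simps)
  also have "\<dots> \<le> \<delta> + 2 * (1 * \<delta>) + 1 * 1 * \<delta>"
  proof -
    have "\<bar>a * ((\<Sum>y\<in>Y. F y * G y) - p\<^sup>2 * a)\<bar> \<le> 1 * \<delta>"
      unfolding abs_mult using a FG by (intro mult_mono) auto
    moreover have "\<bar>a * a * ((\<Sum>y\<in>Y. G y * G y) - p\<^sup>2)\<bar> \<le> 1 * 1 * \<delta>"
      unfolding abs_mult using a GG by (intro mult_mono) auto
    ultimately show ?thesis using FF by linarith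
  qed
  finally have 1: "\<bar>\<Sum>y\<in>Y. v y * (F y - a * G y)\<bar> \<le> sqrt (4 * \<delta>)"
    by (intro CS) simp
  have "(\<Sum>y\<in>Y. (G y - p * e y)\<^sup>2)
      = (\<Sum>y\<in>Y. G y * G y) - 2 * p * (\<Sum>y\<in>Y. G y * e y) + p\<^sup>2 * (\<Sum>y\<in>Y. (e y)\<^sup>2)"
    by (simp add: power2_eq_square algebra_simps sum.distrib sum_subtractf sum_distrib_left)
  also have "\<dots> \<le> (p\<^sup>2 + \<delta>) - 2 * p * (p - \<delta>') + p\<^sup>2"
  proof -
    have "2 * p * (p - \<delta>') \<le> 2 * p * (\<Sum>y\<in>Y. G y * e y)"
      using G p by (intro mult_left_mono) auto
    moreover have "(\<Sum>y\<in>Y. G y * G y) \<le> p\<^sup>2 + \<delta>" using GG by linarith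
    ultimately show ?thesis by (simp only: e)
  qed
  also have "\<dots> = \<delta> + 2 * p * \<delta>'" by (simp add: power2_eq_square algebra_simps)
  finally have 2: "\<bar>\<Sum>y\<in>Y. v y * (G y - p * e y)\<bar> \<le> sqrt (\<delta> + 2 * p * \<delta>')"
    by (rule CS)
  have "(\<Sum>y\<in>Y. v y * F y) - p * a * (\<Sum>y\<in>Y. v y * e y)
      = (\<Sum>y\<in>Y. v y * (F y - a * G y)) + a * (\<Sum>y\<in>Y. v y * (G y - p * e y))"
    by (simp add: algebra_simps sum.distrib sum_subtractf sum_distrib_left)
  moreover have "\<bar>a * (\<Sum>y\<in>Y. v y * (G y - p * e y))\<bar> \<le> 1 * sqrt (\<delta> + 2 * p * \<delta>')"
    unfolding abs_mult using a 2 by (intro mult_mono) auto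
  ultimately show ?thesis using 1 d by (simp add: real_sqrt_mult)
qed

section \<open>Kernels on lists of blocks\<close>

lemma finite_tuples [simp]: "finite V \<Longrightarrow> finite (tuples V L)"
  using finite_lists_length_eq[of V L] by (simp add: tuples_def conj_commute)

lemma card_tuples: "finite V \<Longrightarrow> card (tuples V L) = card V ^ L"
  using card_lists_length_eq[of V L] by (simp add: tuples_def conj_commute)

definition blocks :: "'a set \<Rightarrow> nat list \<Rightarrow> 'a list list set" where
  "blocks V ls = listset (map (tuples V) ls)"

lemma blocks_Nil [simp]: "blocks V [] = {[]}"
  by (simp add: blocks_def)

lemma blocks_Cons: "blocks V (L # ls) = (\<lambda>(b, bs). b # bs) ` (tuples V L \<times> blocks V ls)"
  by (auto simp: blocks_def set_Cons_def)

lemma length_blocks: "bs \<in> blocks V ls \<Longrightarrow> length bs = length ls"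
  by (induction ls arbitrary: bs) (auto simp: blocks_Cons)

lemma sum_blocks_Cons:
  "(\<Sum>bs\<in>blocks V (L # ls). h bs) = (\<Sum>b\<in>tuples V L. \<Sum>bs\<in>blocks V ls. h (b # bs))"
  unfolding blocks_Cons
  by (subst sum.reindex) (auto simp: inj_on_def sum.cartesian_product intro!: sum.cong)

fun weight :: "('b \<Rightarrow> real) list \<Rightarrow> 'b list \<Rightarrow> real" where
  "weight (u # us) (b # bs) = u b * weight us bs"
| "weight _ _ = 1"

definition form :: "'a set \<Rightarrow> ('a list list \<Rightarrow> real) \<Rightarrow> nat list \<Rightarrow> ('a list \<Rightarrow> real) list \<Rightarrow> real" where
  "form V g ls us = (\<Sum>bs\<in>blocks V ls. g bs * weight us bs)"

definition unit_vecs :: "'a set \<Rightarrow> nat list \<Rightarrow> ('a list \<Rightarrow> real) list \<Rightarrow> bool" where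
  "unit_vecs V ls us \<longleftrightarrow> list_all2 (\<lambda>u L. (\<Sum>b\<in>tuples V L. (u b)\<^sup>2) = 1) us ls"

text \<open>The normalised constant vector in every tensor power at once; it is multiplicative with
  respect to concatenation.\<close>

definition cvec :: "'a set \<Rightarrow> 'a list \<Rightarrow> real" where
  "cvec V z = (1 / sqrt (real (card V))) ^ length z"

text \<open>The normalised all-ones map; \<open>prodip_form\<close> writes it as the form of a
  constant kernel.\<close>

fun prodip :: "'a set \<Rightarrow> nat list \<Rightarrow> ('a list \<Rightarrow> real) list \<Rightarrow> real" where
  "prodip V (L # ls) (u # us) = (\<Sum>b\<in>tuples V L. u b * cvec V b) * prodip V ls us"
| "prodip V _ _ = 1"

text \<open>A block of a doubled kernel stores one block of each copy. Cutting at half the length of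
  the list saves carrying the block length as an argument.\<close>

definition lo :: "'a list \<Rightarrow> 'a list" where "lo z = take (length z div 2) z"
definition hi :: "'a list \<Rightarrow> 'a list" where "hi z = drop (length z div 2) z"

lemma lo_append [simp]: "length a = length b \<Longrightarrow> lo (a @ b) = a"
  and hi_append [simp]: "length a = length b \<Longrightarrow> hi (a @ b) = b"
  by (simp_all add: lo_def hi_def)

lemma lo_hi_append [simp]: "lo z @ hi z = z"
  by (simp add: lo_def hi_def)

lemma lo_hi_tuples:
  assumes "z \<in> tuples V (2 * L)"
  shows "lo z \<in> tuples V L" "hi z \<in> tuples V L"
  using assms set_take_subset[of L z] set_drop_subset[of L z] by (auto simp: tuples_def lo_def hi_def)

lemma sum_tuples_double:
  "(\<Sum>z\<in>tuples V (2 * L). h (lo z) (hi z)) = (\<Sum>a\<in>tuples V L. \<Sum>b\<in>tuples V L. h a b)"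
proof -
  have "(\<Sum>z\<in>tuples V (2 * L). h (lo z) (hi z)) = (\<Sum>(a, b)\<in>tuples V L \<times> tuples V L. h a b)"
    by (rule sum.reindex_bij_witness[of _ "\<lambda>(a, b). a @ b" "\<lambda>z. (lo z, hi z)"])
       (auto simp: lo_hi_tuples, auto simp: tuples_def)
  then show ?thesis by (simp add: sum.cartesian_product)
qed

lemma sum_blocks_double:
  "(\<Sum>cs\<in>blocks V (map ((*) 2) ls). h (map lo cs) (map hi cs))
     = (\<Sum>bs\<in>blocks V ls. \<Sum>bs'\<in>blocks V ls. h bs bs')"
proof (induction ls arbitrary: h)
  case (Cons L ls)
  have "(\<Sum>cs\<in>blocks V (map ((*) 2) (L # ls)). h (map lo cs) (map hi cs))
      = (\<Sum>z\<in>tuples V (2 * L). \<Sum>bs\<in>blocks V ls. \<Sum>bs'\<in>blocks V ls. h (lo z # bs) (hi z # bs'))"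
    using Cons.IH[of "\<lambda>bs bs'. h (lo _ # bs) (hi _ # bs')"] by (simp add: sum_blocks_Cons)
  also have "\<dots> = (\<Sum>a\<in>tuples V L. \<Sum>b\<in>tuples V L. \<Sum>bs\<in>blocks V ls. \<Sum>bs'\<in>blocks V ls.
      h (a # bs) (b # bs'))"
    by (rule sum_tuples_double[of "\<lambda>a b. \<Sum>bs\<in>blocks V ls. \<Sum>bs'\<in>blocks V ls. h (a # bs) (b # bs')"])
  also have "\<dots> = (\<Sum>a\<in>tuples V L. \<Sum>bs\<in>blocks V ls. \<Sum>b\<in>tuples V L. \<Sum>bs'\<in>blocks V ls.
      h (a # bs) (b # bs'))"
    by (intro sum.cong refl sum.swap)
  finally show ?case by (simp add: sum_blocks_Cons)
qed simp

definition tensor :: "('a list \<Rightarrow> real) \<Rightarrow> ('a list \<Rightarrow> real) \<Rightarrow> 'a list \<Rightarrow> real" where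
  "tensor u v z = u (lo z) * v (hi z)"

lemma weight_tensor:
  assumes "length us = length cs" "length vs = length cs"
  shows "weight (map2 tensor us vs) cs = weight us (map lo cs) * weight vs (map hi cs)"
  using assms
proof (induction cs arbitrary: us vs)
  case (Cons c cs)
  then show ?case by (cases us; cases vs) (auto simp: tensor_def)
qed auto

text \<open>Because constant vectors are stable under doubling, the density hypothesis passes
  through an elimination with the same kind of test vector.\<close>

lemma tensor_cvec: "tensor (cvec V) (cvec V) = cvec V"
proof
  fix z :: "'a list"
  have "length (lo z) + length (hi z) = length z" by (simp add: lo_def hi_def)
  then show "tensor (cvec V) (cvec V) z = cvec V z"
    by (simp add: tensor_def cvec_def power_add[symmetric] del: power_add)
qed

lemma prodip_tensor:
  assumes "length us = length ls" "length vs = length ls"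
  shows "prodip V (map ((*) 2) ls) (map2 tensor us vs) = prodip V ls us * prodip V ls vs"
  using assms
proof (induction ls arbitrary: us vs)
  case (Cons L ls)
  then obtain u us' v vs' where us: "us = u # us'" "vs = v # vs'"
    by (cases us; cases vs) auto
  have "(\<Sum>z\<in>tuples V (2 * L). tensor u v z * cvec V z)
      = (\<Sum>z\<in>tuples V (2 * L). (u (lo z) * cvec V (lo z)) * (v (hi z) * cvec V (hi z)))"
    by (intro sum.cong refl, subst tensor_cvec[symmetric]) (simp add: tensor_def)
  also have "\<dots> = (\<Sum>a\<in>tuples V L. u a * cvec V a) * (\<Sum>b\<in>tuples V L. v b * cvec V b)"
    by (subst sum_tuples_double[of "\<lambda>a b. (u a * cvec V a) * (v b * cvec V b)"])
       (simp add: sum_product)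
  finally show ?case using Cons us by simp
qed auto

lemma unit_tensor:
  assumes "unit_vecs V ls us" "unit_vecs V ls vs"
  shows "unit_vecs V (map ((*) 2) ls) (map2 tensor us vs)"
  using assms
proof (induction ls arbitrary: us vs)
  case (Cons L ls)
  then obtain u us' v vs' where us: "us = u # us'" "vs = v # vs'"
    by (auto simp: unit_vecs_def list_all2_Cons2)
  have "(\<Sum>z\<in>tuples V (2 * L). (tensor u v z)\<^sup>2)
      = (\<Sum>a\<in>tuples V L. (u a)\<^sup>2) * (\<Sum>b\<in>tuples V L. (v b)\<^sup>2)"
    using sum_tuples_double[of "\<lambda>a b. (u a)\<^sup>2 * (v b)\<^sup>2" V L]
    by (simp add: tensor_def power_mult_distrib sum_product)
  then show ?case using Cons us by (auto simp: unit_vecs_def)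
qed (auto simp: unit_vecs_def)

lemma sum_cvec:
  assumes "finite V" "V \<noteq> {}"
  shows "(\<Sum>b\<in>tuples V L. (cvec V b)\<^sup>2) = 1"
proof -
  have "(\<Sum>b\<in>tuples V L. (cvec V b)\<^sup>2) = (\<Sum>b\<in>tuples V L. (1 / real (card V)) ^ L)"
    by (intro sum.cong refl)
       (simp add: cvec_def tuples_def power2_eq_square power_mult_distrib[symmetric])
  also have "\<dots> = 1"
    using assms by (simp add: card_tuples power_divide)
  finally show ?thesis .
qed

lemma unit_cvec:
  assumes "finite V" "V \<noteq> {}"
  shows "unit_vecs V ls (replicate (length ls) (cvec V))"
  by (induction ls) (auto simp: unit_vecs_def sum_cvec[OF assms])

lemma prodip_cvec:
  assumes "finite V" "V \<noteq> {}"
  shows "prodip V ls (replicate (length ls) (cvec V)) = 1"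
  by (induction ls) (auto simp: sum_cvec[OF assms, unfolded power2_eq_square])

lemma abs_prodip_le:
  assumes "finite V" "V \<noteq> {}" "unit_vecs V ls us"
  shows "\<bar>prodip V ls us\<bar> \<le> 1"
  using assms(3)
proof (induction ls arbitrary: us)
  case (Cons L ls)
  then obtain u us' where us: "us = u # us'" by (auto simp: unit_vecs_def list_all2_Cons2)
  have "(\<Sum>b\<in>tuples V L. u b * cvec V b)\<^sup>2 \<le> 1"
    using Cauchy_Schwarz_ineq_sum[of u "cvec V" "tuples V L"] Cons.prems us sum_cvec[OF assms(1,2)]
    by (simp add: unit_vecs_def)
  then have "\<bar>\<Sum>b\<in>tuples V L. u b * cvec V b\<bar> \<le> 1" by (simp add: abs_square_le_1)
  moreover have "\<bar>prodip V ls us'\<bar> \<le> 1" using Cons us by (auto simp: unit_vecs_def)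
  ultimately show ?case by (simp add: us abs_mult mult_le_one)
qed auto

section \<open>Elimination of a part\<close>

text \<open>Summing out the second block of two copies of a kernel leaves a kernel with one part less,
  whose blocks are twice as long. This is the Cauchy--Schwarz step that produces the vertices
  \<open>PartB 1\<close> of the step.\<close>

definition double :: "'a set \<Rightarrow> nat \<Rightarrow> ('a list list \<Rightarrow> real) \<Rightarrow> 'a list list \<Rightarrow> real" where
  "double V L g cs = (\<Sum>y\<in>tuples V L.
     g (lo (hd cs) # y # map lo (tl cs)) * g (hi (hd cs) # y # map hi (tl cs)))"

text \<open>The part to be summed out sits at index 1. Index 0 is the part \<open>A\<close>, which
  survives all eliminations and finally indexes the Gram matrix.\<close>

definition slice ::
    "'a set \<Rightarrow> ('a list list \<Rightarrow> real) \<Rightarrow> nat list \<Rightarrow> ('a list \<Rightarrow> real) list \<Rightarrow> 'a list \<Rightarrow> real" where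
  "slice V g ls us y = (\<Sum>bs\<in>blocks V ls. g (hd bs # y # tl bs) * weight us bs)"

lemma form_slice:
  "form V g (l0 # l1 # ls) (u0 # u1 # us) = (\<Sum>y\<in>tuples V l1. u1 y * slice V g (l0 # ls) (u0 # us) y)"
proof -
  have "form V g (l0 # l1 # ls) (u0 # u1 # us)
      = (\<Sum>a\<in>tuples V l0. \<Sum>y\<in>tuples V l1. \<Sum>bs\<in>blocks V ls.
          u1 y * (g (a # y # bs) * (u0 a * weight us bs)))"
    by (simp add: form_def sum_blocks_Cons mult_ac)
  also have "\<dots> = (\<Sum>y\<in>tuples V l1. \<Sum>a\<in>tuples V l0. \<Sum>bs\<in>blocks V ls.
          u1 y * (g (a # y # bs) * (u0 a * weight us bs)))"
    by (rule sum.swap)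
  finally show ?thesis by (simp add: slice_def sum_blocks_Cons sum_distrib_left)
qed

text \<open>The two copies share only \<open>y\<close>, so on tensor products the sum factors. This
  is the polarised Cauchy-Schwarz step: closeness for \<open>double\<close> at tensor products
  controls all inner products of slices.\<close>

lemma form_double:
  assumes "length us = Suc (length ls)" "length vs = Suc (length ls)"
  shows "form V (double V L g) (map ((*) 2) (l0 # ls)) (map2 tensor us vs)
     = (\<Sum>y\<in>tuples V L. slice V g (l0 # ls) us y * slice V g (l0 # ls) vs y)"
proof -
  define B where "B = blocks V (l0 # ls)"
  have "form V (double V L g) (map ((*) 2) (l0 # ls)) (map2 tensor us vs)
     = (\<Sum>cs\<in>blocks V (map ((*) 2) (l0 # ls)).
         (\<lambda>bs bs'. (\<Sum>y\<in>tuples V L. g (hd bs # y # tl bs) * g (hd bs' # y # tl bs'))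
            * (weight us bs * weight vs bs')) (map lo cs) (map hi cs))"
    unfolding form_def
  proof (intro sum.cong refl)
    fix cs assume "cs \<in> blocks V (map ((*) 2) (l0 # ls))"
    then have "length cs = Suc (length ls)" by (auto dest: length_blocks)
    then show "double V L g cs * weight (map2 tensor us vs) cs
       = (\<lambda>bs bs'. (\<Sum>y\<in>tuples V L. g (hd bs # y # tl bs) * g (hd bs' # y # tl bs'))
            * (weight us bs * weight vs bs')) (map lo cs) (map hi cs)"
      using assms by (cases cs) (simp_all add: weight_tensor double_def)
  qed
  also have "\<dots> = (\<Sum>bs\<in>B. \<Sum>bs'\<in>B.
      (\<Sum>y\<in>tuples V L. g (hd bs # y # tl bs) * g (hd bs' # y # tl bs')) * (weight us bs * weight vs bs'))"
    unfolding B_def by (rule sum_blocks_double)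
  also have "\<dots> = (\<Sum>bs\<in>B. \<Sum>bs'\<in>B. \<Sum>y\<in>tuples V L.
      (g (hd bs # y # tl bs) * weight us bs) * (g (hd bs' # y # tl bs') * weight vs bs'))"
    by (simp only: sum_distrib_left sum_distrib_right mult_ac)
  also have "\<dots> = (\<Sum>bs\<in>B. \<Sum>y\<in>tuples V L. \<Sum>bs'\<in>B.
      (g (hd bs # y # tl bs) * weight us bs) * (g (hd bs' # y # tl bs') * weight vs bs'))"
    by (intro sum.cong refl sum.swap)
  also have "\<dots> = (\<Sum>y\<in>tuples V L. \<Sum>bs\<in>B. \<Sum>bs'\<in>B.
      (g (hd bs # y # tl bs) * weight us bs) * (g (hd bs' # y # tl bs') * weight vs bs'))"
    by (rule sum.swap)
  finally show ?thesis by (simp add: slice_def sum_product B_def)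
qed

text \<open>\<open>lift_near_constant\<close> with \<open>F\<close> the slice at the given vectors
  and \<open>G\<close> the slice at the constant ones; \<open>near\<close> supplies the three inner
  products formed from these two.\<close>

lemma form_near_product_lift:
  fixes V :: "'a set"
  assumes V: "finite V" "V \<noteq> {}" and p: "0 < p"
    and near: "\<And>us vs. unit_vecs V (l0 # ls) us \<Longrightarrow> unit_vecs V (l0 # ls) vs \<Longrightarrow>
      \<bar>(\<Sum>y\<in>tuples V l1. slice V g (l0 # ls) us y * slice V g (l0 # ls) vs y)
        - p\<^sup>2 * (prodip V (l0 # ls) us * prodip V (l0 # ls) vs)\<bar> \<le> \<delta>"
    and low: "p - \<delta>' \<le> form V g (l0 # l1 # ls) (replicate (Suc (Suc (length ls))) (cvec V))"
    and us: "unit_vecs V (l0 # l1 # ls) us"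
  shows "\<bar>form V g (l0 # l1 # ls) us - p * prodip V (l0 # l1 # ls) us\<bar>
     \<le> 2 * sqrt \<delta> + sqrt (\<delta> + 2 * p * \<delta>')"
proof -
  obtain u0 u1 us' where us': "us = u0 # u1 # us'"
    using us by (auto simp: unit_vecs_def list_all2_Cons2)
  define E where "E = replicate (Suc (length ls)) (cvec V)"
  define a where "a = prodip V (l0 # ls) (u0 # us')"
  have u: "unit_vecs V (l0 # ls) (u0 # us')" and u1: "(\<Sum>b\<in>tuples V l1. (u1 b)\<^sup>2) = 1"
    using us unfolding us' unit_vecs_def by auto
  have E: "unit_vecs V (l0 # ls) E" "prodip V (l0 # ls) E = 1"
    using unit_cvec[OF V, of "l0 # ls"] prodip_cvec[OF V, of "l0 # ls"] by (simp_all add: E_def)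
  have low': "p - \<delta>' \<le> (\<Sum>y\<in>tuples V l1. slice V g (l0 # ls) E y * cvec V y)"
    using low form_slice[of V g l0 l1 ls "cvec V" "cvec V" "replicate (length ls) (cvec V)"]
    by (simp add: E_def mult.commute)
  have "\<bar>(\<Sum>y\<in>tuples V l1. u1 y * slice V g (l0 # ls) (u0 # us') y)
      - p * a * (\<Sum>y\<in>tuples V l1. u1 y * cvec V y)\<bar> \<le> 2 * sqrt \<delta> + sqrt (\<delta> + 2 * p * \<delta>')"
  proof (rule lift_near_constant[OF u1 sum_cvec[OF V] _ p _ _ _ low'])
    show "\<bar>a\<bar> \<le> 1" unfolding a_def by (rule abs_prodip_le[OF V u])
  qed (use near[OF u u] near[OF u E(1)] near[OF E(1) E(1)] in \<open>simp_all only: a_def E(2) mult_1_right\<close>)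
  then show ?thesis by (simp add: us' form_slice a_def mult_ac)
qed

text \<open>Recursion along the eliminations, ending in the trace of a power of the Gram matrix;
  \<open>cyc_unroll\<close> turns it into a sum over block assignments. The value 0 for fewer than
  two parts is a mere default.\<close>

fun cyc :: "nat \<Rightarrow> 'a set \<Rightarrow> ('a list list \<Rightarrow> real) \<Rightarrow> nat list \<Rightarrow> real" where
  "cyc m V g [l0, l1] = (\<Sum>a\<in>{..<m} \<rightarrow>\<^sub>E tuples V l0. \<Prod>i<m. \<Sum>y\<in>tuples V l1.
     g [a i, y] * g [a (Suc i mod m), y])"
| "cyc m V g (l0 # l1 # l2 # ls) = cyc m V (double V l1 g) (map ((*) 2) (l0 # l2 # ls))"
| "cyc m V g _ = 0"

text \<open>All conditions hold strictly in the limit, so \<eta> is chosen from \<epsilon> and then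
  \<delta> from \<eta>. The conditions on powers bound what the trace leaves beside the constant
  vector, and the size of \<open>s\<close> in \<open>slice_near_product_base\<close>.\<close>

lemma small_parameters_exist:
  fixes p \<epsilon> :: real
  assumes "0 < p" "0 < \<epsilon>" "l \<ge> 1"
  obtains \<eta> \<delta> where "0 < \<eta>" "0 < \<delta>" "2 * \<eta> + 2 * sqrt ((p\<^sup>2 + \<eta>) * \<eta>) \<le> \<epsilon>" "\<delta> \<le> p" "2 * p * \<delta> \<le> \<eta>"
    "p ^ (4 * l) + \<delta> - (p - \<delta>) ^ (4 * l) \<le> \<eta> ^ (2 * l)" "p ^ (4 * l) + \<delta> \<le> (p\<^sup>2 + \<eta>) ^ (2 * l)"
    "2 * p * \<delta> \<le> \<epsilon>"
proof -
  have "((\<lambda>\<eta>. 2 * \<eta> + 2 * sqrt ((p\<^sup>2 + \<eta>) * \<eta>)) \<longlongrightarrow> 2 * 0 + 2 * sqrt ((p\<^sup>2 + 0) * 0)) (at_right 0)"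
    by (intro tendsto_intros)
  then have "eventually (\<lambda>\<eta>. 2 * \<eta> + 2 * sqrt ((p\<^sup>2 + \<eta>) * \<eta>) < \<epsilon>) (at_right 0)"
    using assms by (intro order_tendstoD(2)) auto
  moreover have "eventually (\<lambda>\<eta>::real. \<eta> > 0) (at_right 0)"
    by (rule eventually_at_right_less)
  ultimately have "eventually (\<lambda>\<eta>. \<eta> > 0 \<and> 2 * \<eta> + 2 * sqrt ((p\<^sup>2 + \<eta>) * \<eta>) < \<epsilon>) (at_right 0)"
    by eventually_elim auto
  then obtain \<eta> where \<eta>: "\<eta> > 0" "2 * \<eta> + 2 * sqrt ((p\<^sup>2 + \<eta>) * \<eta>) < \<epsilon>"
    using eventually_happens[of _ "at_right (0::real)"] by auto
  have 1: "((\<lambda>\<delta>. p ^ (4 * l) + \<delta> - (p - \<delta>) ^ (4 * l)) \<longlongrightarrow> p ^ (4 * l) + 0 - (p - 0) ^ (4 * l)) (at_right 0)"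
    by (intro tendsto_intros)
  have 2: "((\<lambda>\<delta>. p ^ (4 * l) + \<delta>) \<longlongrightarrow> p ^ (4 * l) + 0) (at_right 0)"
    by (intro tendsto_intros)
  have 3: "((\<lambda>\<delta>. 2 * p * \<delta>) \<longlongrightarrow> 2 * p * 0) (at_right 0)"
    by (intro tendsto_intros)
  have 4: "((\<lambda>\<delta>. \<delta>) \<longlongrightarrow> (0::real)) (at_right 0)"
    by (intro tendsto_intros)
  have pl: "p ^ (4 * l) < (p\<^sup>2 + \<eta>) ^ (2 * l)"
  proof -
    have "p ^ (4 * l) = (p\<^sup>2) ^ (2 * l)" by (simp add: power_mult[symmetric])
    also have "\<dots> < (p\<^sup>2 + \<eta>) ^ (2 * l)" using \<eta> assms by (intro power_strict_mono) auto
    finally show ?thesis .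
  qed
  have "eventually (\<lambda>\<delta>. p ^ (4 * l) + \<delta> - (p - \<delta>) ^ (4 * l) < \<eta> ^ (2 * l)) (at_right 0)"
    by (rule order_tendstoD(2)[OF 1]) (use \<eta> in simp)
  moreover have "eventually (\<lambda>\<delta>. p ^ (4 * l) + \<delta> < (p\<^sup>2 + \<eta>) ^ (2 * l)) (at_right 0)"
    by (rule order_tendstoD(2)[OF 2]) (use pl in simp)
  moreover have "eventually (\<lambda>\<delta>. 2 * p * \<delta> < min \<eta> \<epsilon>) (at_right 0)"
    by (rule order_tendstoD(2)[OF 3]) (use \<eta> assms in simp)
  moreover have "eventually (\<lambda>\<delta>. \<delta> < p) (at_right 0)"
    by (rule order_tendstoD(2)[OF 4]) (use assms in simp)
  moreover have "eventually (\<lambda>\<delta>::real. \<delta> > 0) (at_right 0)"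
    by (rule eventually_at_right_less)
  ultimately have "eventually (\<lambda>\<delta>. p ^ (4 * l) + \<delta> - (p - \<delta>) ^ (4 * l) < \<eta> ^ (2 * l) \<and>
     p ^ (4 * l) + \<delta> < (p\<^sup>2 + \<eta>) ^ (2 * l) \<and> 2 * p * \<delta> < min \<eta> \<epsilon> \<and> \<delta> < p \<and> \<delta> > 0) (at_right 0)"
    by eventually_elim auto
  then obtain \<delta> where "p ^ (4 * l) + \<delta> - (p - \<delta>) ^ (4 * l) < \<eta> ^ (2 * l)"
     "p ^ (4 * l) + \<delta> < (p\<^sup>2 + \<eta>) ^ (2 * l)" "2 * p * \<delta> < min \<eta> \<epsilon>" "\<delta> < p" "\<delta> > 0"
    using eventually_happens[of _ "at_right (0::real)"] by auto
  then show ?thesis using \<eta> that[of \<eta> \<delta>] by simp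
qed

text \<open>Density and trace squeeze \<open>s\<close> between \<open>p\<^sup>2 - \<eta>\<close> and
  \<open>p\<^sup>2 + \<eta>\<close>; replacing \<open>s\<close> by \<open>p\<^sup>2\<close> in
  \<open>near_rank_one\<close> costs the second \<eta>. The exponent \<open>4 * l\<close> counts the
  edges of the cycle with two parts.\<close>

lemma slice_near_product_base:
  fixes V :: "'a set"
  assumes V: "finite V" "V \<noteq> {}" and "0 < p" "l \<ge> 1"
    and par: "0 < \<eta>" "0 < \<delta>" "\<delta> \<le> p" "2 * p * \<delta> \<le> \<eta>"
    "p ^ (4 * l) + \<delta> - (p - \<delta>) ^ (4 * l) \<le> \<eta> ^ (2 * l)" "p ^ (4 * l) + \<delta> \<le> (p\<^sup>2 + \<eta>) ^ (2 * l)"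
    and low: "p - \<delta> \<le> form V g [l0, l1] [cvec V, cvec V]"
    and up: "cyc (2 * l) V g [l0, l1] \<le> p ^ (4 * l) + \<delta>"
    and us: "unit_vecs V [l0] us" and vs: "unit_vecs V [l0] vs"
  shows "\<bar>(\<Sum>y\<in>tuples V l1. slice V g [l0] us y * slice V g [l0] vs y)
        - p\<^sup>2 * (prodip V [l0] us * prodip V [l0] vs)\<bar> \<le> 2 * \<eta> + 2 * sqrt ((p\<^sup>2 + \<eta>) * \<eta>)"
proof -
  interpret gram_kernel "tuples V l0" "tuples V l1" "\<lambda>x y. g [x, y]"
    by unfold_locales (use V in auto)
  obtain u v where uv: "us = [u]" "vs = [v]"
    using us vs by (auto simp: unit_vecs_def list_all2_Cons2)
  define e where "e = (cvec V :: 'a list \<Rightarrow> real)"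
  have sl: "slice V g [l0] [w] y = (\<Sum>x\<in>tuples V l0. w x * g [x, y])" for w y
    by (simp add: slice_def sum_blocks_Cons mult.commute)
  have ipT: "ip w (T w') = (\<Sum>y\<in>tuples V l1. slice V g [l0] [w] y * slice V g [l0] [w'] y)" for w w'
    by (simp add: ip_T sl)
  have e1: "ip e e = 1" using sum_cvec[OF V, of l0] by (simp add: ip_def e_def power2_eq_square)
  have u1: "ip u u = 1" "ip v v = 1"
    using us vs by (simp_all add: ip_def uv unit_vecs_def power2_eq_square)
  have pr: "prodip V [l0] [w] = ip w e" for w by (simp add: ip_def e_def)
  have tr: "trace_pow (2 * l) = cyc (2 * l) V g [l0, l1]"
    using assms(4) by (simp add: trace_pow_closed_walks K_def)
  define s where "s = ip e (T e)"
  \<comment> \<open>Cauchy-Schwarz against the constant vector of part 1;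
    \<open>\<delta> \<le> p\<close> allows the density bound to be squared.\<close>
  have "(p - \<delta>)\<^sup>2 \<le> (\<Sum>y\<in>tuples V l1. cvec V y * slice V g [l0] [e] y)\<^sup>2"
    using low par(3) by (intro power_mono) (simp_all add: form_slice e_def)
  also have "\<dots> \<le> (\<Sum>y\<in>tuples V l1. (cvec V y)\<^sup>2) * (\<Sum>y\<in>tuples V l1. (slice V g [l0] [e] y)\<^sup>2)"
    by (rule Cauchy_Schwarz_ineq_sum)
  also have "\<dots> = s" by (simp only: sum_cvec[OF V] s_def ipT) (simp add: power2_eq_square)
  finally have s: "(p - \<delta>)\<^sup>2 \<le> s" .
  then have "((p - \<delta>)\<^sup>2) ^ (2 * l) \<le> s ^ (2 * l)" by (intro power_mono) auto
  then have s2: "(p - \<delta>) ^ (4 * l) \<le> s ^ (2 * l)" by (simp add: power_mult[symmetric])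
  have "s ^ (2 * l) \<le> (p\<^sup>2 + \<eta>) ^ (2 * l)"
    using moment_le_trace[OF e1, of l] tr up par(6) unfolding s_def by linarith
  then have s3: "s \<le> p\<^sup>2 + \<eta>"
    using power_le_imp_le_base[of s "2 * l - 1"] assms(4) par by (cases "2 * l") auto
  have s4: "p\<^sup>2 - \<eta> \<le> s"
  proof -
    have "(p - \<delta>)\<^sup>2 = p\<^sup>2 - 2 * p * \<delta> + \<delta>\<^sup>2" by (simp add: power2_eq_square algebra_simps)
    then have "p\<^sup>2 - 2 * p * \<delta> \<le> (p - \<delta>)\<^sup>2" by simp
    then show ?thesis using s par(4) by linarith
  qed
  have "trace_pow (2 * l) \<le> s ^ (2 * l) + \<eta> ^ (2 * l)"
    using tr up par(5) s2 by linarith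
  then have "\<bar>ip u (T v) - s * ip u e * ip v e\<bar> \<le> 2 * sqrt (s * \<eta>) + \<eta>"
    unfolding s_def using par assms(4) by (intro near_rank_one e1 u1) auto
  moreover have "sqrt (s * \<eta>) \<le> sqrt ((p\<^sup>2 + \<eta>) * \<eta>)" using s3 par by simp
  moreover have "\<bar>(s - p\<^sup>2) * (ip u e * ip v e)\<bar> \<le> \<eta> * (1 * 1)"
    unfolding abs_mult
    using abs_prodip_le[OF V us] abs_prodip_le[OF V vs] s3 s4 par
    by (intro mult_mono) (auto simp: uv pr simp del: prodip.simps)
  moreover have "ip u (T v) - p\<^sup>2 * (ip u e * ip v e)
      = (ip u (T v) - s * ip u e * ip v e) + (s - p\<^sup>2) * (ip u e * ip v e)"
    by (simp add: algebra_simps)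
  ultimately show ?thesis unfolding uv pr ipT[symmetric] by linarith
qed

text \<open>One Cauchy-Schwarz against the constant vector of the eliminated part; this is how a
  density near \<open>p\<close> becomes one near \<open>p\<^sup>2\<close>.\<close>

lemma form_cvec_double:
  fixes V :: "'a set"
  assumes V: "finite V" "V \<noteq> {}"
  shows "(form V g (l0 # l1 # ls) (replicate (Suc (Suc (length ls))) (cvec V)))\<^sup>2
    \<le> form V (double V l1 g) (map ((*) 2) (l0 # ls)) (replicate (Suc (length ls)) (cvec V))"
proof -
  define E :: "('a list \<Rightarrow> real) list" where "E = replicate (Suc (length ls)) (cvec V)"
  have "map2 tensor E E = E"
    by (simp add: E_def zip_replicate tensor_cvec)
  then have "form V (double V l1 g) (map ((*) 2) (l0 # ls)) E
      = (\<Sum>y\<in>tuples V l1. (slice V g (l0 # ls) E y)\<^sup>2)"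
    using form_double[of E ls E V l1 g l0] by (simp add: E_def power2_eq_square)
  moreover have "form V g (l0 # l1 # ls) (replicate (Suc (Suc (length ls))) (cvec V))
      = (\<Sum>y\<in>tuples V l1. cvec V y * slice V g (l0 # ls) E y)"
    by (simp add: form_slice E_def)
  ultimately show ?thesis
    using Cauchy_Schwarz_ineq_sum[of "cvec V" "slice V g (l0 # ls) E" "tuples V l1"] sum_cvec[OF V]
    by (simp add: E_def)
qed

text \<open>Induction on the number of parts, which is \<open>t + 2\<close> here. An elimination
  replaces \<open>g\<close> by \<open>double V l1 g\<close> and \<open>p\<close> by
  \<open>p\<^sup>2\<close>; the power of \<open>p\<close> in the cycle bound keeps its value, as
  squaring \<open>p\<close> makes up for halving the exponent. That \<delta> is uniform in
  \<open>V\<close> is what later lets the vertex set grow.\<close>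

lemma form_near_product:
  fixes p \<epsilon> :: real
  assumes "0 < p" "0 < \<epsilon>" "l \<ge> 1"
  shows "\<exists>\<delta>>0. \<forall>(V :: 'a set) ls g us. finite V \<longrightarrow> V \<noteq> {} \<longrightarrow> length ls = Suc (Suc t) \<longrightarrow>
     p - \<delta> \<le> form V g ls (replicate (Suc (Suc t)) (cvec V)) \<longrightarrow>
     cyc (2 * l) V g ls \<le> p ^ (2 * l * 2 ^ Suc t) + \<delta> \<longrightarrow> unit_vecs V ls us \<longrightarrow>
     \<bar>form V g ls us - p * prodip V ls us\<bar> \<le> \<epsilon>"
  using assms
proof (induction t arbitrary: p \<epsilon>)
  case 0
  \<comment> \<open>Then \<open>sqrt \<epsilon>1 = \<epsilon> / 4\<close>, and both summands in the
    bound of \<open>form_near_product_lift\<close> are at most \<open>\<epsilon> / 2\<close> once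
    \<open>2 * p * \<delta> \<le> \<epsilon>1\<close>.\<close>
  define \<epsilon>1 where "\<epsilon>1 = \<epsilon>\<^sup>2 / 16"
  have e1: "\<epsilon>1 > 0" using 0 by (simp add: \<epsilon>1_def)
  obtain \<eta> \<delta> where par: "0 < \<eta>" "0 < \<delta>" "2 * \<eta> + 2 * sqrt ((p\<^sup>2 + \<eta>) * \<eta>) \<le> \<epsilon>1" "\<delta> \<le> p" "2 * p * \<delta> \<le> \<eta>"
    "p ^ (4 * l) + \<delta> - (p - \<delta>) ^ (4 * l) \<le> \<eta> ^ (2 * l)" "p ^ (4 * l) + \<delta> \<le> (p\<^sup>2 + \<eta>) ^ (2 * l)"
    "2 * p * \<delta> \<le> \<epsilon>1"
    by (rule small_parameters_exist[OF 0(1) e1 0(3)])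
  have fin: "2 * sqrt \<epsilon>1 + sqrt (\<epsilon>1 + 2 * p * \<delta>) \<le> \<epsilon>"
  proof -
    have a: "sqrt \<epsilon>1 = \<epsilon> / 4" using 0 by (simp add: \<epsilon>1_def real_sqrt_divide)
    have "sqrt (\<epsilon>1 + 2 * p * \<delta>) \<le> sqrt (4 * \<epsilon>1)" using par(8) e1 by (intro real_sqrt_le_mono) linarith
    also have "\<dots> = 2 * (\<epsilon> / 4)" by (simp add: real_sqrt_mult a)
    finally show ?thesis by (simp add: a)
  qed
  show ?case
  proof (intro exI[of _ \<delta>] conjI allI impI)
    fix V :: "'a set" and ls g us
    assume V: "finite V" "V \<noteq> {}" and len: "length ls = Suc (Suc 0)"
      and low: "p - \<delta> \<le> form V g ls (replicate (Suc (Suc 0)) (cvec V))"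
      and up: "cyc (2 * l) V g ls \<le> p ^ (2 * l * 2 ^ Suc 0) + \<delta>" and us: "unit_vecs V ls us"
    obtain l0 l1 where ls: "ls = [l0, l1]"
      using len by (auto simp: length_Suc_conv)
    have "\<bar>(\<Sum>y\<in>tuples V l1. slice V g [l0] us y * slice V g [l0] vs y)
        - p\<^sup>2 * (prodip V [l0] us * prodip V [l0] vs)\<bar> \<le> \<epsilon>1"
      if "unit_vecs V [l0] us" "unit_vecs V [l0] vs" for us vs
    proof -
      have up': "cyc (2 * l) V g [l0, l1] \<le> p ^ (4 * l) + \<delta>"
        using up by (simp add: ls mult.commute mult.assoc del: cyc.simps)
      have low': "p - \<delta> \<le> form V g [l0, l1] [cvec V, cvec V]" using low by (simp add: ls)
      show ?thesis
        using slice_near_product_base[OF V 0(1,3) par(1,2,4,5,6,7) low' up' that] par(3) by linarith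
    qed
    then have "\<bar>form V g ls us - p * prodip V ls us\<bar> \<le> 2 * sqrt \<epsilon>1 + sqrt (\<epsilon>1 + 2 * p * \<delta>)"
      using us low unfolding ls by (intro form_near_product_lift[OF V 0(1)]) auto
    then show "\<bar>form V g ls us - p * prodip V ls us\<bar> \<le> \<epsilon>" using fin by linarith
  qed (use par in auto)
next
  case (Suc t)
  define \<epsilon>1 where "\<epsilon>1 = \<epsilon>\<^sup>2 / 16"
  have e1: "\<epsilon>1 > 0" using Suc.prems by (simp add: \<epsilon>1_def)
  obtain \<delta>1 where d1: "\<delta>1 > 0" and IH: "\<And>(V :: 'a set) ls g us. finite V \<Longrightarrow> V \<noteq> {} \<Longrightarrow>
     length ls = Suc (Suc t) \<Longrightarrow> p\<^sup>2 - \<delta>1 \<le> form V g ls (replicate (Suc (Suc t)) (cvec V)) \<Longrightarrow>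
     cyc (2 * l) V g ls \<le> p\<^sup>2 ^ (2 * l * 2 ^ Suc t) + \<delta>1 \<Longrightarrow> unit_vecs V ls us \<Longrightarrow>
     \<bar>form V g ls us - p\<^sup>2 * prodip V ls us\<bar> \<le> \<epsilon>1"
    using Suc.IH[of "p\<^sup>2" \<epsilon>1] Suc.prems e1 by auto
  \<comment> \<open>The four entries serve, in turn: squaring \<open>p - \<delta>\<close>, the cycle
    bound of the induction hypothesis, its density bound via
    \<open>(p - \<delta>)\<^sup>2 \<ge> p\<^sup>2 - 2 * p * \<delta>\<close>, and the final
    error.\<close>
  define \<delta> where "\<delta> = Min {p, \<delta>1, \<delta>1 / (2 * p), \<epsilon>1 / (2 * p)}"
  have d: "0 < \<delta>" "\<delta> \<le> p" "\<delta> \<le> \<delta>1" "2 * p * \<delta> \<le> \<delta>1" "2 * p * \<delta> \<le> \<epsilon>1"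
  proof -
    show "0 < \<delta>" "\<delta> \<le> p" "\<delta> \<le> \<delta>1" using d1 e1 Suc.prems by (simp_all add: \<delta>_def)
    have "\<delta> \<le> \<delta>1 / (2 * p)" "\<delta> \<le> \<epsilon>1 / (2 * p)" by (simp_all add: \<delta>_def)
    then show "2 * p * \<delta> \<le> \<delta>1" "2 * p * \<delta> \<le> \<epsilon>1"
      using Suc.prems by (simp_all add: field_simps)
  qed
  have fin: "2 * sqrt \<epsilon>1 + sqrt (\<epsilon>1 + 2 * p * \<delta>) \<le> \<epsilon>"
  proof -
    have a: "sqrt \<epsilon>1 = \<epsilon> / 4" using Suc.prems by (simp add: \<epsilon>1_def real_sqrt_divide)
    have "sqrt (\<epsilon>1 + 2 * p * \<delta>) \<le> sqrt (4 * \<epsilon>1)" using d(5) e1 by (intro real_sqrt_le_mono) linarith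
    also have "\<dots> = 2 * (\<epsilon> / 4)" by (simp add: real_sqrt_mult a)
    finally show ?thesis by (simp add: a)
  qed
  show ?case
  proof (intro exI[of _ \<delta>] conjI allI impI)
    fix V :: "'a set" and ls g us
    assume V: "finite V" "V \<noteq> {}" and len: "length ls = Suc (Suc (Suc t))"
      and low: "p - \<delta> \<le> form V g ls (replicate (Suc (Suc (Suc t))) (cvec V))"
      and up: "cyc (2 * l) V g ls \<le> p ^ (2 * l * 2 ^ Suc (Suc t)) + \<delta>" and us: "unit_vecs V ls us"
    obtain l0 l1 l2 ls' where ls: "ls = l0 # l1 # l2 # ls'" "length ls' = t"
      using len by (auto simp: length_Suc_conv)
    define D where "D = double V l1 g"
    define ms where "ms = map ((*) 2) (l0 # l2 # ls')"
    have "p\<^sup>2 - \<delta>1 \<le> (p - \<delta>)\<^sup>2"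
      using d(4) zero_le_power2[of \<delta>] unfolding power2_diff by linarith
    also have "\<dots> \<le> (form V g ls (replicate (Suc (Suc (Suc t))) (cvec V)))\<^sup>2"
      using low d(2) by (intro power_mono) auto
    also have "\<dots> \<le> form V D ms (replicate (Suc (Suc t)) (cvec V))"
      using form_cvec_double[OF V, of g l0 l1 "l2 # ls'"] by (simp add: ls D_def ms_def del: replicate_Suc)
    finally have low': "p\<^sup>2 - \<delta>1 \<le> form V D ms (replicate (Suc (Suc t)) (cvec V))" .
    have up': "cyc (2 * l) V D ms \<le> p\<^sup>2 ^ (2 * l * 2 ^ Suc t) + \<delta>1"
    proof -
      have "p\<^sup>2 ^ (2 * l * 2 ^ Suc t) = p ^ (2 * l * 2 ^ Suc (Suc t))"
        by (simp add: power_mult[symmetric] mult_ac)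
      then show ?thesis using up d(3) by (simp add: ls D_def ms_def)
    qed
    have "\<bar>(\<Sum>y\<in>tuples V l1. slice V g (l0 # l2 # ls') us y * slice V g (l0 # l2 # ls') vs y)
        - p\<^sup>2 * (prodip V (l0 # l2 # ls') us * prodip V (l0 # l2 # ls') vs)\<bar> \<le> \<epsilon>1"
      if u: "unit_vecs V (l0 # l2 # ls') us" and v: "unit_vecs V (l0 # l2 # ls') vs" for us vs
    proof -
      have lu: "length us = length (l0 # l2 # ls')" "length vs = length (l0 # l2 # ls')"
        using u v by (auto simp: unit_vecs_def dest: list_all2_lengthD)
      \<comment> \<open>The doubled kernel is tested on tensor products only, which are again lists
        of unit vectors.\<close>
      have "\<bar>form V D ms (map2 tensor us vs) - p\<^sup>2 * prodip V ms (map2 tensor us vs)\<bar> \<le> \<epsilon>1"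
        using IH[OF V _ low' up', of "map2 tensor us vs"] unit_tensor[OF u v] ls by (simp add: ms_def)
      then show ?thesis
        using form_double[of us "l2 # ls'" vs V l1 g l0] prodip_tensor[OF lu, of V] lu
        by (simp add: D_def ms_def)
    qed
    then have "\<bar>form V g ls us - p * prodip V ls us\<bar> \<le> 2 * sqrt \<epsilon>1 + sqrt (\<epsilon>1 + 2 * p * \<delta>)"
      using us low unfolding ls(1)
      by (intro form_near_product_lift[OF V Suc.prems(1)]) (auto simp: ls(2))
    then show "\<bar>form V g ls us - p * prodip V ls us\<bar> \<le> \<epsilon>" using fin by linarith
  qed (use d in auto)
qed

section \<open>Block assignments of the cycle\<close>

definition bits :: "nat \<Rightarrow> bool list set" where
  "bits s = {w. length w = s}"

lemma finite_bits [simp]: "finite (bits s)"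
  using finite_lists_length_eq[of "UNIV :: bool set" s] by (simp add: bits_def)

lemma card_bits: "card (bits s) = 2 ^ s"
  using card_lists_length_eq[of "UNIV :: bool set" s] by (simp add: bits_def)

lemma prod_bits_Suc: "(\<Prod>w\<in>bits (Suc s). h w) = (\<Prod>w\<in>bits s. h (False # w) * h (True # w))"
proof -
  have "(\<Prod>w\<in>bits (Suc s). h w) = (\<Prod>(w, b)\<in>bits s \<times> UNIV. h (b # w))"
    by (rule prod.reindex_bij_witness[of _ "\<lambda>(w, b). b # w" "\<lambda>w. (tl w, hd w)"])
       (auto simp: bits_def length_Suc_conv)
  also have "\<dots> = (\<Prod>w\<in>bits s. \<Prod>b\<in>UNIV. h (b # w))"
    by (simp add: prod.cartesian_product)
  finally show ?thesis by (simp add: UNIV_bool mult.commute)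
qed

text \<open>Throughout, \<open>s\<close> stands for \<open>t - 2\<close>. After all identifications, the blocks in \<open>A\<close> whose
  code ends in \<open>False\<close> represent every block in \<open>A\<close>.\<close>

fun cycle_block :: "nat \<Rightarrow> step_vertex \<Rightarrow> bool" where
  "cycle_block s (PartA w) \<longleftrightarrow> length w = Suc s \<and> \<not> last w"
| "cycle_block s (PartB j w) \<longleftrightarrow> 1 \<le> j \<and> j \<le> Suc s \<and> length w = s"

definition cycle_blocks :: "nat \<Rightarrow> nat \<Rightarrow> (nat \<times> step_vertex) set" where
  "cycle_blocks m s = {..<m} \<times> {v. cycle_block s v}"

text \<open>The attach identifications in block form: an \<open>A\<close> block of step
  \<open>i\<close> ending in \<open>True\<close> is represented in step \<open>i + 1\<close>, and
  \<open>mod m\<close> closes the path to a cycle.\<close>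

fun block_rep :: "nat \<Rightarrow> nat \<times> step_vertex \<Rightarrow> nat \<times> step_vertex" where
  "block_rep m (i, PartA w) =
     (if last w then (Suc i mod m, PartA (butlast w @ [False])) else (i, PartA w))"
| "block_rep m (i, PartB j w) = (i, PartB j w)"

text \<open>One tuple per block instead of one vertex per cycle vertex: an elimination only changes
  the lengths of the tuples, so this form follows the recursion of \<open>cyc\<close>.\<close>

definition assignments :: "nat \<Rightarrow> 'a set \<Rightarrow> nat list \<Rightarrow> (nat \<times> step_vertex \<Rightarrow> 'a list) set" where
  "assignments m V ls =
     PiE (cycle_blocks m (length ls - 2)) (\<lambda>x. tuples V (ls ! part_of (snd x)))"

definition edge_blocks :: "nat \<Rightarrow> nat \<Rightarrow> (nat \<times> step_vertex \<Rightarrow> 'b) \<Rightarrow> nat \<Rightarrow> bool list \<Rightarrow> 'b list" where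
  "edge_blocks m s \<phi> i w =
     \<phi> (block_rep m (i, PartA w)) # map (\<lambda>j. \<phi> (i, PartB j (remove_bit j w))) [1..<Suc (Suc s)]"

definition half :: "bool \<Rightarrow> 'a list \<Rightarrow> 'a list" where
  "half b z = (if b then hi z else lo z)"

text \<open>Inverse of an elimination. The new leading bit of a code tells from which copy, hence
  from which half of a doubled tuple, a block is read. Blocks of part 1 lose exactly this bit, so
  both copies share them and they come from \<eta>.\<close>

definition join_assignment ::
  "nat \<Rightarrow> nat \<Rightarrow> (nat \<times> step_vertex \<Rightarrow> 'a list) \<Rightarrow> (nat \<times> bool list \<Rightarrow> 'a list)
     \<Rightarrow> nat \<times> step_vertex \<Rightarrow> 'a list" where
  "join_assignment m s \<psi> \<eta> = (\<lambda>x\<in>cycle_blocks m s. case x of (i, v) \<Rightarrow>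
     (case v of PartA w \<Rightarrow> half (hd w) (\<psi> (i, PartA (tl w)))
      | PartB j w \<Rightarrow> if j = 1 then \<eta> (i, w) else half (hd w) (\<psi> (i, PartB (j - 1) (tl w)))))"

definition merged_assignment ::
  "nat \<Rightarrow> nat \<Rightarrow> (nat \<times> step_vertex \<Rightarrow> 'a list) \<Rightarrow> nat \<times> step_vertex \<Rightarrow> 'a list" where
  "merged_assignment m s \<phi> = (\<lambda>x\<in>cycle_blocks m s. case x of (i, v) \<Rightarrow>
     (case v of PartA w \<Rightarrow> \<phi> (i, PartA (False # w)) @ \<phi> (i, PartA (True # w))
      | PartB j w \<Rightarrow> \<phi> (i, PartB (Suc j) (False # w)) @ \<phi> (i, PartB (Suc j) (True # w))))"

definition eliminated_blocks ::
  "nat \<Rightarrow> nat \<Rightarrow> (nat \<times> step_vertex \<Rightarrow> 'a list) \<Rightarrow> nat \<times> bool list \<Rightarrow> 'a list" where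
  "eliminated_blocks m s \<phi> = (\<lambda>(i, w)\<in>{..<m} \<times> bits s. \<phi> (i, PartB 1 w))"

section \<open>Splitting and merging assignments along an elimination\<close>

lemma half_tuples: "z \<in> tuples V (2 * L) \<Longrightarrow> half b z \<in> tuples V L"
  by (simp add: half_def lo_hi_tuples)

lemma remove_bit_Suc_Cons: "1 \<le> j \<Longrightarrow> remove_bit (Suc j) (b # w) = b # remove_bit j w"
  by (cases j) (auto simp: remove_bit_def)

lemma remove_bit_1_Cons: "remove_bit (Suc 0) (b # w) = w"
  by (simp add: remove_bit_def)

lemma length_remove_bit: "1 \<le> j \<Longrightarrow> j \<le> length w \<Longrightarrow> length (remove_bit j w) = length w - 1"
  by (auto simp: remove_bit_def)

text \<open>The edge \<open>b # w\<close> has the shape of a factor in \<open>double\<close>: copy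
  \<open>b\<close> of the edge \<open>w\<close> with the shared block at index 1. This matches the
  bit removal in the step with the order of eliminations.\<close>

lemma edge_blocks_join:
  assumes "i < m" "w \<in> bits (Suc s)"
  shows "edge_blocks m (Suc s) (join_assignment m (Suc s) \<psi> \<eta>) i (b # w)
     = half b (hd (edge_blocks m s \<psi> i w)) # \<eta> (i, w) # map (half b) (tl (edge_blocks m s \<psi> i w))"
proof -
  have w: "length w = Suc s" "w \<noteq> []" using assms by (auto simp: bits_def)
  have m: "Suc i mod m < m" using assms by simp
  have 1: "join_assignment m (Suc s) \<psi> \<eta> (block_rep m (i, PartA (b # w))) = half b (\<psi> (block_rep m (i, PartA w)))"
    using w m assms by (auto simp: join_assignment_def cycle_blocks_def)
  have 2: "join_assignment m (Suc s) \<psi> \<eta> (i, PartB 1 (remove_bit 1 (b # w))) = \<eta> (i, w)"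
    using w assms by (simp add: join_assignment_def cycle_blocks_def remove_bit_1_Cons)
  have 3: "join_assignment m (Suc s) \<psi> \<eta> (i, PartB (Suc j) (remove_bit (Suc j) (b # w)))
      = half b (\<psi> (i, PartB j (remove_bit j w)))" if "j \<in> set [1..<Suc (Suc s)]" for j
    using that w assms
    by (auto simp: join_assignment_def cycle_blocks_def remove_bit_Suc_Cons length_remove_bit)
  have "[1..<Suc (Suc (Suc s))] = 1 # map Suc [1..<Suc (Suc s)]"
    by (simp only: map_Suc_upt) (simp add: upt_rec)
  then show ?thesis
    unfolding edge_blocks_def using 1 2 3 by (simp del: upt_Suc)
qed

lemma cycle_block_Suc_cases:
  assumes "cycle_block (Suc s) v"
  obtains b w where "v = PartA (b # w)" "cycle_block s (PartA w)"
  | w where "v = PartB 1 w" "length w = Suc s"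
  | b j w where "v = PartB (Suc j) (b # w)" "cycle_block s (PartB j w)"
proof (cases v)
  case (PartA w)
  then show ?thesis using assms that(1)[of "hd w" "tl w"] by (cases w) (auto split: if_splits)
next
  case (PartB j w)
  show ?thesis
  proof (cases "j = 1")
    case True
    then show ?thesis using PartB assms that(2) by auto
  next
    case False
    then obtain j' where j: "j = Suc j'" "1 \<le> j'" using PartB assms by (cases j) auto
    obtain b w' where "w = b # w'" "length w' = s"
      using PartB assms by (auto simp: length_Suc_conv)
    then show ?thesis using PartB assms that(3)[of j' b w'] j by auto
  qed
qed

lemma join_in_assignments:
  assumes "\<psi> \<in> assignments m V (map ((*) 2) (l0 # l2 # ls))"
    and "\<eta> \<in> ({..<m} \<times> bits (Suc (length ls))) \<rightarrow>\<^sub>E tuples V l1"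
  shows "join_assignment m (Suc (length ls)) \<psi> \<eta> \<in> assignments m V (l0 # l1 # l2 # ls)"
  unfolding assignments_def
proof (rule PiE_I)
  fix x assume "x \<in> cycle_blocks m (length (l0 # l1 # l2 # ls) - 2)"
  then obtain i v where x: "x = (i, v)" "i < m" and v: "cycle_block (Suc (length ls)) v"
    by (auto simp: cycle_blocks_def)
  have \<psi>: "\<psi> (i, v') \<in> tuples V (map ((*) 2) (l0 # l2 # ls) ! part_of v')"
    if "cycle_block (length ls) v'" for v'
    using assms(1) that x(2) by (auto simp: assignments_def cycle_blocks_def dest!: PiE_mem)
  show "join_assignment m (Suc (length ls)) \<psi> \<eta> x \<in> tuples V ((l0 # l1 # l2 # ls) ! part_of (snd x))"
  proof (cases rule: cycle_block_Suc_cases[OF v])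
    case (1 b w)
    then show ?thesis
      using \<psi>[OF 1(2)] x v half_tuples by (simp add: join_assignment_def cycle_blocks_def)
  next
    case (2 w)
    then show ?thesis using x v PiE_mem[OF assms(2), of "(i, w)"]
      by (simp add: join_assignment_def cycle_blocks_def bits_def)
  next
    case (3 b j w)
    obtain j' where "j = Suc j'" "j' < Suc (length ls)" using 3 by (cases j) auto
    then show ?thesis
      using \<psi>[OF 3(2)] x v 3 half_tuples nth_map[of j' "l2 # ls" "(*) 2"] by (simp add: join_assignment_def cycle_blocks_def)
  qed
qed (auto simp: join_assignment_def)

lemma merged_in_assignments:
  assumes "\<phi> \<in> assignments m V (l0 # l1 # l2 # ls)"
  shows "merged_assignment m (length ls) \<phi> \<in> assignments m V (map ((*) 2) (l0 # l2 # ls))"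
  unfolding assignments_def
proof (rule PiE_I)
  fix x assume "x \<in> cycle_blocks m (length (map ((*) 2) (l0 # l2 # ls)) - 2)"
  then obtain i v where x: "x = (i, v)" "i < m" and v: "cycle_block (length ls) v"
    by (auto simp: cycle_blocks_def)
  have \<phi>: "\<phi> (i, v') \<in> tuples V ((l0 # l1 # l2 # ls) ! part_of v')"
    if "cycle_block (Suc (length ls)) v'" for v'
    using assms(1) that x(2) by (auto simp: assignments_def cycle_blocks_def dest!: PiE_mem)
  have app: "a @ b \<in> tuples V (2 * L)" if "a \<in> tuples V L" "b \<in> tuples V L" for a b L
    using that by (auto simp: tuples_def)
  show "merged_assignment m (length ls) \<phi> x \<in> tuples V (map ((*) 2) (l0 # l2 # ls) ! part_of (snd x))"
  proof (cases v)
    case (PartA w)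
    then have "cycle_block (Suc (length ls)) (PartA (b # w))" for b using v by auto
    note \<phi>[OF this]
    then show ?thesis using x v PartA app
      by (simp add: merged_assignment_def cycle_blocks_def)
  next
    case (PartB j w)
    then have "cycle_block (Suc (length ls)) (PartB (Suc j) (b # w))" for b using v by auto
    note \<phi>[OF this]
    moreover obtain j' where "j = Suc j'" "j' < Suc (length ls)" using v PartB by (cases j) auto
    ultimately show ?thesis using x v PartB app nth_map[of j' "l2 # ls" "(*) 2"]
      by (simp add: merged_assignment_def cycle_blocks_def)
  qed
qed (auto simp: merged_assignment_def)

lemma eliminated_in:
  assumes "\<phi> \<in> assignments m V (l0 # l1 # l2 # ls)"
  shows "eliminated_blocks m (Suc (length ls)) \<phi> \<in> ({..<m} \<times> bits (Suc (length ls))) \<rightarrow>\<^sub>E tuples V l1"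
proof -
  have "\<phi> (i, PartB 1 w) \<in> tuples V l1" if "i < m" "w \<in> bits (Suc (length ls))" for i w
  proof -
    have "(i, PartB 1 w) \<in> cycle_blocks m (length (l0 # l1 # l2 # ls) - 2)"
      using that by (simp add: cycle_blocks_def bits_def)
    from PiE_mem[OF assms[unfolded assignments_def] this] show ?thesis by simp
  qed
  then show ?thesis by (auto simp: eliminated_blocks_def)
qed

lemma merged_join:
  assumes "\<psi> \<in> assignments m V (map ((*) 2) (l0 # l2 # ls))"
  shows "merged_assignment m (length ls) (join_assignment m (Suc (length ls)) \<psi> \<eta>) = \<psi>"
proof
  fix x
  show "merged_assignment m (length ls) (join_assignment m (Suc (length ls)) \<psi> \<eta>) x = \<psi> x"
  proof (cases "x \<in> cycle_blocks m (length ls)")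
    case True
    then obtain i v where x: "x = (i, v)" "i < m" and v: "cycle_block (length ls) v"
      by (auto simp: cycle_blocks_def)
    then show ?thesis
      by (cases v) (auto simp: merged_assignment_def join_assignment_def cycle_blocks_def half_def)
  next
    case False
    then show ?thesis
      using assms by (cases x) (auto simp: merged_assignment_def assignments_def PiE_def extensional_def)
  qed
qed

lemma eliminated_join:
  assumes "\<eta> \<in> ({..<m} \<times> bits (Suc s)) \<rightarrow>\<^sub>E tuples V l1"
  shows "eliminated_blocks m (Suc s) (join_assignment m (Suc s) \<psi> \<eta>) = \<eta>"
proof
  fix x :: "nat \<times> bool list"
  show "eliminated_blocks m (Suc s) (join_assignment m (Suc s) \<psi> \<eta>) x = \<eta> x"
  proof (cases "x \<in> {..<m} \<times> bits (Suc s)")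
    case True
    then show ?thesis
      by (auto simp: eliminated_blocks_def join_assignment_def cycle_blocks_def bits_def)
  next
    case False
    then show ?thesis
      using assms by (cases x) (auto simp: eliminated_blocks_def PiE_def extensional_def)
  qed
qed

lemma join_merged_eliminated:
  assumes "\<phi> \<in> assignments m V (l0 # l1 # l2 # ls)"
  shows "join_assignment m (Suc (length ls)) (merged_assignment m (length ls) \<phi>)
           (eliminated_blocks m (Suc (length ls)) \<phi>) = \<phi>"
proof
  fix x
  show "join_assignment m (Suc (length ls)) (merged_assignment m (length ls) \<phi>)
           (eliminated_blocks m (Suc (length ls)) \<phi>) x = \<phi> x"
  proof (cases "x \<in> cycle_blocks m (Suc (length ls))")
    case True
    then obtain i v where x: "x = (i, v)" "i < m" and v: "cycle_block (Suc (length ls)) v"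
      by (auto simp: cycle_blocks_def)
    have \<phi>: "\<phi> (i, v') \<in> tuples V ((l0 # l1 # l2 # ls) ! part_of v')"
      if "cycle_block (Suc (length ls)) v'" for v'
      using assms(1) that x(2) by (auto simp: assignments_def cycle_blocks_def dest!: PiE_mem)
    \<comment> \<open>Cutting a concatenation in the middle recovers both blocks because blocks of
      one part have equal length.\<close>
    have len: "length (\<phi> (i, v')) = length (\<phi> (i, v''))"
      if "cycle_block (Suc (length ls)) v'" "cycle_block (Suc (length ls)) v''" "part_of v' = part_of v''"
      for v' v''
      using \<phi>[OF that(1)] \<phi>[OF that(2)] that(3) by (simp add: tuples_def)
    show ?thesis
    proof (cases rule: cycle_block_Suc_cases[OF v])
      case (1 b w)
      have "length (\<phi> (i, PartA (False # w))) = length (\<phi> (i, PartA (True # w)))"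
        using 1 by (intro len) auto
      then show ?thesis using 1 x v
        by (auto simp: join_assignment_def merged_assignment_def cycle_blocks_def half_def)
    next
      case (2 w)
      then show ?thesis using x v
        by (auto simp: join_assignment_def eliminated_blocks_def cycle_blocks_def bits_def)
    next
      case (3 b j w)
      have "length (\<phi> (i, PartB (Suc j) (False # w))) = length (\<phi> (i, PartB (Suc j) (True # w)))"
        using 3 by (intro len) auto
      then show ?thesis using 3 x v
        by (auto simp: join_assignment_def merged_assignment_def cycle_blocks_def half_def)
    qed
  next
    case False
    then show ?thesis
      using assms by (cases x) (auto simp: join_assignment_def assignments_def PiE_def extensional_def)
  qed
qed

text \<open>With two parts each step contributes one representative \<open>A\<close> block and one
  \<open>B\<close> block; the codes \<open>[False]\<close> and \<open>[True]\<close> give the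
  factors with \<open>a i\<close> and \<open>a (Suc i mod m)\<close>.\<close>

lemma cyc_unroll_base:
  fixes g :: "'a list list \<Rightarrow> real"
  assumes V: "finite V"
  shows "cyc m V g [l0, l1]
     = (\<Sum>\<phi>\<in>assignments m V [l0, l1]. \<Prod>i<m. \<Prod>w\<in>bits (Suc 0). g (edge_blocks m 0 \<phi> i w))"
proof -
  have "cyc m V g [l0, l1] = (\<Sum>a\<in>{..<m} \<rightarrow>\<^sub>E tuples V l0. \<Sum>b\<in>{..<m} \<rightarrow>\<^sub>E tuples V l1.
      \<Prod>i<m. g [a i, b i] * g [a (Suc i mod m), b i])"
    using V by (simp add: prod_sum_PiE)
  also have "\<dots> = (\<Sum>(a, b)\<in>({..<m} \<rightarrow>\<^sub>E tuples V l0) \<times> ({..<m} \<rightarrow>\<^sub>E tuples V l1).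
      \<Prod>i<m. g [a i, b i] * g [a (Suc i mod m), b i])"
    by (simp add: sum.cartesian_product)
  also have "\<dots> = (\<Sum>\<phi>\<in>assignments m V [l0, l1].
      \<Prod>i<m. g [\<phi> (i, PartA [False]), \<phi> (i, PartB 1 [])]
           * g [\<phi> (Suc i mod m, PartA [False]), \<phi> (i, PartB 1 [])])"
  proof -
    have cb: "cycle_blocks m 0 = {..<m} \<times> {PartA [False], PartB 1 []}"
    proof -
      have "cycle_block 0 v \<longleftrightarrow> v = PartA [False] \<or> v = PartB 1 []" for v
        by (cases v) (auto simp: length_Suc_conv)
      then show ?thesis by (auto simp: cycle_blocks_def)
    qed
    have as: "assignments m V [l0, l1] = PiE ({..<m} \<times> {PartA [False], PartB 1 []})
        (\<lambda>x. tuples V ([l0, l1] ! part_of (snd x)))"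
      by (simp add: assignments_def cb)
    show ?thesis
    proof (rule sum.reindex_bij_witness[of _
          "\<lambda>\<phi>. (\<lambda>i\<in>{..<m}. \<phi> (i, PartA [False]), \<lambda>i\<in>{..<m}. \<phi> (i, PartB 1 []))"
          "\<lambda>(a, b). \<lambda>x\<in>{..<m} \<times> {PartA [False], PartB 1 []}. if part_of (snd x) = 0 then a (fst x) else b (fst x)"],
        goal_cases)
      case (1 c)
      then show ?case by (auto simp: fun_eq_iff PiE_def extensional_def)
    next
      case (2 c)
      then show ?case unfolding as by (auto simp: PiE_def Pi_def)
    next
      case (3 \<phi>)
      then show ?case unfolding as by (auto simp: fun_eq_iff PiE_def extensional_def)
    next
      case (4 \<phi>)
      have "\<phi> (i, PartA [False]) \<in> tuples V l0" "\<phi> (i, PartB 1 []) \<in> tuples V l1" if "i < m" for i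
        using PiE_mem[OF 4[unfolded as], of "(i, PartA [False])"]
          PiE_mem[OF 4[unfolded as], of "(i, PartB 1 [])"] that by simp_all
      then show ?case by (simp add: restrict_PiE_iff)
    next
      case (5 c)
      obtain a b where c: "c = (a, b)" by (cases c)
      have "Suc i mod m < m" if "i < m" for i using that by simp
      then show ?case unfolding c prod.case by (intro prod.cong refl) simp
    qed
  qed
  also have "\<dots> = (\<Sum>\<phi>\<in>assignments m V [l0, l1]. \<Prod>i<m. \<Prod>w\<in>bits (Suc 0). g (edge_blocks m 0 \<phi> i w))"
  proof -
    have "bits 0 = {[]}" by (auto simp: bits_def)
    then show ?thesis by (simp add: prod_bits_Suc edge_blocks_def remove_bit_def)
  qed
  finally show ?thesis .
qed

text \<open>Distributing the product over the sums in \<open>double\<close> chooses a block of the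
  eliminated part for every \<open>(i, w)\<close>; such choices \<eta> together with \<psi>
  correspond to assignments with one part more.\<close>

lemma cyc_unroll:
  fixes g :: "'a list list \<Rightarrow> real"
  assumes V: "finite V" and "length ls = Suc (Suc s)"
  shows "cyc m V g ls
     = (\<Sum>\<phi>\<in>assignments m V ls. \<Prod>i<m. \<Prod>w\<in>bits (Suc s). g (edge_blocks m s \<phi> i w))"
  using assms(2)
proof (induction s arbitrary: ls g)
  case 0
  then obtain l0 l1 where "ls = [l0, l1]" by (auto simp: length_Suc_conv)
  then show ?case using cyc_unroll_base[OF V] by (simp del: cyc.simps)
next
  case (Suc s)
  then obtain l0 l1 l2 ls' where ls: "ls = l0 # l1 # l2 # ls'" and s: "length ls' = s"
    by (auto simp: length_Suc_conv)
  define ms where "ms = map ((*) 2) (l0 # l2 # ls')"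
  define I where "I = {..<m} \<times> bits (Suc s)"
  define h where "h \<psi> x y b = (case x of (i, w) \<Rightarrow>
     g (half b (hd (edge_blocks m s \<psi> i w)) # y # map (half b) (tl (edge_blocks m s \<psi> i w))))" for \<psi> x y b
  have "cyc m V g ls = (\<Sum>\<psi>\<in>assignments m V ms. \<Prod>i<m. \<Prod>w\<in>bits (Suc s).
      double V l1 g (edge_blocks m s \<psi> i w))"
    using Suc.IH[of ms "double V l1 g"] s by (simp add: ls ms_def)
  also have "\<dots> = (\<Sum>\<psi>\<in>assignments m V ms. \<Prod>x\<in>I. \<Sum>y\<in>tuples V l1. h \<psi> x y False * h \<psi> x y True)"
    by (simp add: prod.cartesian_product double_def h_def I_def half_def[abs_def] case_prod_unfold)
  also have "\<dots> = (\<Sum>\<psi>\<in>assignments m V ms. \<Sum>\<eta>\<in>I \<rightarrow>\<^sub>E tuples V l1. \<Prod>x\<in>I. h \<psi> x (\<eta> x) False * h \<psi> x (\<eta> x) True)"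
    using V by (intro sum.cong refl prod_sum_PiE) (auto simp: I_def)
  also have "\<dots> = (\<Sum>(\<psi>, \<eta>)\<in>assignments m V ms \<times> (I \<rightarrow>\<^sub>E tuples V l1).
      \<Prod>x\<in>I. h \<psi> x (\<eta> x) False * h \<psi> x (\<eta> x) True)"
    by (simp add: sum.cartesian_product)
  also have "\<dots> = (\<Sum>\<phi>\<in>assignments m V ls. \<Prod>i<m. \<Prod>w\<in>bits (Suc (Suc s)). g (edge_blocks m (Suc s) \<phi> i w))"
  proof (rule sum.reindex_bij_witness[of _
        "\<lambda>\<phi>. (merged_assignment m s \<phi>, eliminated_blocks m (Suc s) \<phi>)"
        "\<lambda>(\<psi>, \<eta>). join_assignment m (Suc s) \<psi> \<eta>"], goal_cases)
    case (1 a)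
    then show ?case
      by (auto simp: ms_def I_def s[symmetric] merged_join eliminated_join simp del: list.map)
  next
    case (2 a)
    then show ?case
      by (auto simp: ms_def I_def s[symmetric] ls intro!: join_in_assignments simp del: list.map)
  next
    case (3 b)
    then show ?case by (simp add: ls s[symmetric] join_merged_eliminated)
  next
    case (4 b)
    then show ?case using merged_in_assignments[of b m V l0 l1 l2 ls'] eliminated_in[of b m V l0 l1 l2 ls']
      by (simp add: ls s ms_def I_def del: list.map)
  next
    case (5 a)
    then obtain \<psi> \<eta> where a: "a = (\<psi>, \<eta>)" by auto
    show ?case
      by (simp add: a prod_bits_Suc[of _ "Suc s"] prod.cartesian_product I_def h_def)
         (intro prod.cong refl, auto simp: edge_blocks_join)
  qed
  finally show ?case .
qed

section \<open>The identifications in the cycle\<close>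

lemma glue_class_self: "x \<in> glue_class R x"
  by (simp add: glue_class_def)

text \<open>The tool for showing that a gluing does not identify too much: an invariant of the
  generating pairs separates classes.\<close>

lemma glue_class_invariant:
  assumes "\<And>x y. (x, y) \<in> R \<Longrightarrow> h x = h y" and "y \<in> glue_class R x"
  shows "h y = h x"
proof -
  have "(x, y) \<in> (R \<union> R\<inverse>)\<^sup>*" using assms(2) by (simp add: glue_class_def)
  then show ?thesis
    by (induction rule: rtrancl_induct) (auto dest: assms(1))
qed

lemma glue_class_eqI:
  assumes "(x, y) \<in> R"
  shows "glue_class R x = glue_class R y"
proof -
  have "sym ((R \<union> R\<inverse>)\<^sup>*)" by (intro sym_rtrancl) (auto simp: sym_def)
  moreover have "(x, y) \<in> (R \<union> R\<inverse>)\<^sup>*" using assms by auto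
  ultimately have "(y, x) \<in> (R \<union> R\<inverse>)\<^sup>*" "(x, y) \<in> (R \<union> R\<inverse>)\<^sup>*" by (auto dest: symD)
  then show ?thesis unfolding glue_class_def by (auto intro: rtrancl_trans)
qed

section \<open>Explicit form of the identifications\<close>

lemma set_bit_strings: "set (bit_strings s) = bits s"
proof (induction s)
  case 0
  then show ?case by (auto simp: bits_def)
next
  case (Suc s)
  have "bits (Suc s) = (#) False ` bits s \<union> (#) True ` bits s"
    by (force simp: bits_def length_Suc_conv)
  then show ?case using Suc by simp
qed

text \<open>Both attach tuples run over this common list of indices, which turns the coordinatewise
  pairing into a single map.\<close>

definition attach_index :: "nat list \<Rightarrow> (bool list \<times> nat) list" where
  "attach_index ks =
     concat (map (\<lambda>w. map (Pair w) [1..<Suc (ks ! 0)]) (bit_strings (length ks - 2)))"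

lemma step_attach_map: "step_attach b ks = map (\<lambda>(w, r). (PartA (w @ [b]), r)) (attach_index ks)"
  by (simp add: step_attach_def attach_index_def map_concat comp_def)

lemma set_attach_index: "set (attach_index ks) = bits (length ks - 2) \<times> {1..ks ! 0}"
  by (simp add: attach_index_def set_bit_strings atLeastLessThanSuc_atLeastAtMost del: upt_Suc) auto

lemma image_case_prod_Times: "(\<lambda>(x, y). f x y) ` (A \<times> B) = {f x y | x y. x \<in> A \<and> y \<in> B}"
  by force

lemma path_identifications_eq:
  "path_identifications ks m = {((i, PartA (w @ [True]), r), (Suc i, PartA (w @ [False]), r)) | i w r.
     Suc i < m \<and> w \<in> bits (length ks - 2) \<and> r \<in> {1..ks ! 0}}"
proof -
  have "set (zip (map (Pair i) (step_attach True ks)) (map (Pair (Suc i)) (step_attach False ks)))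
     = (\<lambda>(w, r). ((i, PartA (w @ [True]), r), (Suc i, PartA (w @ [False]), r))) `
         (bits (length ks - 2) \<times> {1..ks ! 0})" for i
    by (simp add: step_attach_map zip_map_map zip_same_conv_map set_attach_index
        image_image case_prod_unfold comp_def)
  then show ?thesis unfolding path_identifications_def image_case_prod_Times by blast
qed

definition cycle_identifications ::
  "nat list \<Rightarrow> nat \<Rightarrow> ((nat \<times> step_vertex \<times> nat) set \<times> (nat \<times> step_vertex \<times> nat) set) set" where
  "cycle_identifications ks m = set (zip (hpath_attach_first ks m) (hpath_attach_last ks m))"

lemma cycle_identifications_eq:
  "cycle_identifications ks m =
     {(glue_class (path_identifications ks m) (0, PartA (w @ [False]), r),
       glue_class (path_identifications ks m) (m - 1, PartA (w @ [True]), r)) | w r.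
       w \<in> bits (length ks - 2) \<and> r \<in> {1..ks ! 0}}"
proof -
  have "cycle_identifications ks m = (\<lambda>(w, r).
      (glue_class (path_identifications ks m) (0, PartA (w @ [False]), r),
       glue_class (path_identifications ks m) (m - 1, PartA (w @ [True]), r))) `
         (bits (length ks - 2) \<times> {1..ks ! 0})"
    by (simp add: cycle_identifications_def hpath_attach_first_def hpath_attach_last_def
        step_attach_map zip_map_map zip_same_conv_map set_attach_index
        image_image case_prod_unfold comp_def)
  then show ?thesis unfolding image_case_prod_Times by blast
qed

text \<open>The cycle is glued in two rounds, so its vertices are classes of classes.\<close>

definition cycle_quot ::
  "nat list \<Rightarrow> nat \<Rightarrow> nat \<times> step_vertex \<times> nat \<Rightarrow> (nat \<times> step_vertex \<times> nat) set set" where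
  "cycle_quot ks m x =
     glue_class (cycle_identifications ks m) (glue_class (path_identifications ks m) x)"

lemma verts_hcycle_quot: "verts (hcycle ks m) = cycle_quot ks m ` ({..<m} \<times> verts (step ks))"
  by (simp add: hcycle_def hpath_def glue_def disjoint_copies_def image_image cycle_quot_def
      cycle_identifications_def)

lemma edges_hcycle_quot: "edges (hcycle ks m) =
    (\<lambda>(i, E). image_mset (cycle_quot ks m) (image_mset (Pair i) E)) ` ({..<m} \<times> edges (step ks))"
proof -
  have "edges (hcycle ks m) = (\<lambda>E. image_mset (cycle_quot ks m) E) `
      (\<Union>i<m. image_mset (Pair i) ` edges (step ks))"
    by (simp add: hcycle_def hpath_def glue_def disjoint_copies_def image_image
      cycle_identifications_def multiset.map_comp cycle_quot_def[abs_def] comp_def)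
  then show ?thesis by auto
qed

fun vertex_rep :: "nat \<Rightarrow> nat \<times> step_vertex \<times> nat \<Rightarrow> nat \<times> step_vertex \<times> nat" where
  "vertex_rep m (i, v, r) = (fst (block_rep m (i, v)), snd (block_rep m (i, v)), r)"

text \<open>\<open>vertex_rep\<close> is invariant under both rounds: it descends to path classes as
  \<open>h\<close>, evaluated at a chosen element, and \<open>h\<close> agrees on the pairs that
  close the cycle.\<close>

lemma vertex_rep_eq_of_cycle_quot_eq:
  assumes "m \<ge> 1" and eq: "cycle_quot ks m x = cycle_quot ks m y"
  shows "vertex_rep m x = vertex_rep m y"
proof -
  define h where "h c = vertex_rep m (SOME z. z \<in> c)" for c
  have h: "h (glue_class (path_identifications ks m) z) = vertex_rep m z" for z
  proof -
    have "(SOME z'. z' \<in> glue_class (path_identifications ks m) z) \<in> glue_class (path_identifications ks m) z"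
      using glue_class_self by (rule someI)
    then show ?thesis unfolding h_def
      by (rule glue_class_invariant[rotated]) (auto simp: path_identifications_eq)
  qed
  have "glue_class (path_identifications ks m) y \<in> cycle_quot ks m x"
    unfolding eq by (simp add: cycle_quot_def glue_class_self)
  then have "h (glue_class (path_identifications ks m) y) = h (glue_class (path_identifications ks m) x)"
    unfolding cycle_quot_def
    by (rule glue_class_invariant[rotated]) (use assms(1) in \<open>auto simp: cycle_identifications_eq h\<close>)
  then show ?thesis by (simp add: h)
qed

lemma in_verts_step:
  assumes "length ks = Suc (Suc s)"
  shows "(v, r) \<in> verts (step ks) \<longleftrightarrow> r \<in> {1..ks ! part_of v} \<and>
    (case v of PartA w \<Rightarrow> length w = Suc s | PartB j w \<Rightarrow> 1 \<le> j \<and> j \<le> Suc s \<and> length w = s)"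
  using assms by (cases v) (auto simp: step_def simple_step_def Let_def)

lemma cycle_quot_vertex_rep:
  assumes ks: "length ks = Suc (Suc s)" and x: "x \<in> {..<m} \<times> verts (step ks)"
  shows "cycle_quot ks m x = cycle_quot ks m (vertex_rep m x)"
proof -
  obtain i v r where xe: "x = (i, v, r)" by (cases x)
  show ?thesis
  proof (cases v)
    case (PartB j w)
    then show ?thesis by (simp add: xe)
  next
    case (PartA w)
    have i: "i < m" and w: "length w = Suc s" and r: "r \<in> {1..ks ! 0}"
      using x in_verts_step[OF ks, of v r] by (auto simp: xe PartA)
    show ?thesis
    proof (cases "last w")
      case False
      then show ?thesis by (simp add: xe PartA)
    next
      case True
      define u where "u = butlast w"
      have wu: "w = u @ [True]" using True w append_butlast_last_id[of w] by (cases "w = []") (auto simp: u_def)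
      have u: "u \<in> bits (length ks - 2)" using w wu ks by (simp add: bits_def)
      show ?thesis
      proof (cases "Suc i < m")
        case True
        then have "(x, vertex_rep m x) \<in> path_identifications ks m"
          using u r by (auto simp: path_identifications_eq xe PartA wu)
        then show ?thesis unfolding cycle_quot_def by (simp only: glue_class_eqI)
      next
        \<comment> \<open>The last step is glued to step 0 in the second round only; that pair lists
          step 0 first, hence the symmetric use of \<open>glue_class_eqI\<close>.\<close>
        case False
        then have m: "i = m - 1" "Suc i = m" using i by auto
        have "(glue_class (path_identifications ks m) (vertex_rep m x),
               glue_class (path_identifications ks m) x) \<in> cycle_identifications ks m"
          using u r m by (auto simp: cycle_identifications_eq xe PartA wu)
        then show ?thesis unfolding cycle_quot_def by (rule glue_class_eqI[symmetric])
      qed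
    qed
  qed
qed

text \<open>A transversal of the quotient: \<open>cycle_quot\<close> is injective on it and reaches
  every vertex of the cycle from it.\<close>

definition cycle_verts :: "nat list \<Rightarrow> nat \<Rightarrow> (nat \<times> step_vertex \<times> nat) set" where
  "cycle_verts ks m =
     {(i, v, r). (i, v) \<in> cycle_blocks m (length ks - 2) \<and> r \<in> {1..ks ! part_of v}}"

lemma vertex_rep_cycle_verts: "x \<in> cycle_verts ks m \<Longrightarrow> vertex_rep m x = x"
proof -
  assume x: "x \<in> cycle_verts ks m"
  obtain i v r where xe: "x = (i, v, r)" by (cases x)
  show ?thesis using x by (cases v) (auto simp: xe cycle_verts_def cycle_blocks_def)
qed

lemma cycle_verts_subset:
  assumes "length ks = Suc (Suc s)"
  shows "cycle_verts ks m \<subseteq> {..<m} \<times> verts (step ks)"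
proof
  fix x assume x: "x \<in> cycle_verts ks m"
  obtain i v r where xe: "x = (i, v, r)" by (cases x)
  show "x \<in> {..<m} \<times> verts (step ks)"
    using x assms by (cases v) (auto simp: xe cycle_verts_def cycle_blocks_def in_verts_step)
qed

lemma vertex_rep_in_cycle_verts:
  assumes "length ks = Suc (Suc s)" "x \<in> {..<m} \<times> verts (step ks)"
  shows "vertex_rep m x \<in> cycle_verts ks m"
proof -
  obtain i v r where xe: "x = (i, v, r)" by (cases x)
  have m: "Suc i mod m < m" using assms(2) by (cases m) (auto simp: xe)
  show ?thesis
    using assms m by (cases v) (auto simp: xe cycle_verts_def cycle_blocks_def in_verts_step)
qed

lemma inj_on_cycle_quot: "m \<ge> 1 \<Longrightarrow> inj_on (cycle_quot ks m) (cycle_verts ks m)"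
  by (rule inj_onI) (metis vertex_rep_eq_of_cycle_quot_eq vertex_rep_cycle_verts)

lemma verts_hcycle:
  assumes "length ks = Suc (Suc s)"
  shows "verts (hcycle ks m) = cycle_quot ks m ` cycle_verts ks m"
proof -
  have "cycle_quot ks m x \<in> cycle_quot ks m ` cycle_verts ks m" if "x \<in> {..<m} \<times> verts (step ks)" for x
    using cycle_quot_vertex_rep[OF assms that] vertex_rep_in_cycle_verts[OF assms that] by auto
  then show ?thesis using cycle_verts_subset[OF assms, of m] by (auto simp: verts_hcycle_quot)
qed

lemma card_cycle_verts:
  assumes ks: "length ks = Suc (Suc s)"
  shows "finite (cycle_verts ks m)" "card (cycle_verts ks m) = m * 2 ^ s * sum_list ks"
proof -
  \<comment> \<open>\<open>A\<close> has twice as many codes as a \<open>B\<close> part, but half of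
    its blocks are represented in the next step; so every part has \<open>2 ^ s\<close> blocks per
    step and one index set serves all.\<close>
  define I where "I = {..<m} \<times> bits s \<times> Sigma {..<length ks} (\<lambda>j. {1..ks ! j})"
  define f where "f = (\<lambda>(i::nat, w, j, r::nat). (i, if j = 0 then PartA (w @ [False]) else PartB j w, r))"
  have inj: "inj_on f I"
    by (rule inj_onI) (auto simp: f_def split: if_splits)
  have img: "f ` I = cycle_verts ks m"
  proof
    show "f ` I \<subseteq> cycle_verts ks m"
      using ks by (auto simp: f_def I_def cycle_verts_def cycle_blocks_def bits_def)
    show "cycle_verts ks m \<subseteq> f ` I"
    proof
      fix x assume x: "x \<in> cycle_verts ks m"
      obtain i v r where xe: "x = (i, v, r)" by (cases x)
      show "x \<in> f ` I"
      proof (cases v)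
        case (PartA w)
        have "w \<noteq> []" "\<not> last w" "length w = Suc s"
          using x ks by (auto simp: xe PartA cycle_verts_def cycle_blocks_def)
        then have w: "w = butlast w @ [False]" "butlast w \<in> bits s"
          using append_butlast_last_id[of w] by (auto simp: bits_def)
        have "x = f (i, butlast w, 0, r)" using w(1) by (simp add: f_def xe PartA)
        moreover have "(i, butlast w, 0, r) \<in> I"
          using x w ks by (auto simp: I_def xe PartA cycle_verts_def cycle_blocks_def)
        ultimately show ?thesis by blast
      next
        case (PartB j w)
        have "x = f (i, w, j, r)" "(i, w, j, r) \<in> I"
          using x ks by (auto simp: I_def xe PartB cycle_verts_def cycle_blocks_def f_def bits_def)
        then show ?thesis by blast
      qed
    qed
  qed
  have "card I = m * (2 ^ s * (\<Sum>j<length ks. ks ! j))"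
    by (simp add: I_def card_cartesian_product card_bits)
  also have "(\<Sum>j<length ks. ks ! j) = sum_list ks"
    by (simp add: sum_list_sum_nth atLeast0LessThan)
  finally show "card (cycle_verts ks m) = m * 2 ^ s * sum_list ks"
    using card_image[OF inj] by (simp add: img)
  have "finite I" by (auto simp: I_def)
  then show "finite (cycle_verts ks m)" unfolding img[symmetric] by (rule finite_imageI)
qed

lemma card_verts_hcycle:
  assumes "length ks = Suc (Suc s)" "m \<ge> 1"
  shows "finite (verts (hcycle ks m))" "card (verts (hcycle ks m)) = m * 2 ^ s * sum_list ks"
  using card_cycle_verts[OF assms(1), of m] card_image[OF inj_on_cycle_quot[OF assms(2), of ks]]
  by (auto simp: verts_hcycle[OF assms(1)])

section \<open>Edges of the cycle\<close>

definition step_edge :: "nat \<Rightarrow> bool list \<Rightarrow> step_vertex list" where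
  "step_edge s w = PartA w # map (\<lambda>j. PartB j (remove_bit j w)) [1..<Suc (Suc s)]"

definition cycle_edge :: "nat list \<Rightarrow> nat \<Rightarrow> nat \<Rightarrow> bool list \<Rightarrow> (nat \<times> step_vertex \<times> nat) list" where
  "cycle_edge ks s i w =
     concat (map (\<lambda>v. map (\<lambda>r. (i, v, r)) [1..<Suc (ks ! part_of v)]) (step_edge s w))"

lemma set_cycle_edge:
  "set (cycle_edge ks s i w) = {(i, v, r) | v r. v \<in> set (step_edge s w) \<and> r \<in> {1..ks ! part_of v}}"
  by (auto simp: cycle_edge_def atLeastLessThanSuc_atLeastAtMost simp del: upt_Suc)

lemma distinct_step_edge: "distinct (step_edge s w)"
  by (auto simp: step_edge_def distinct_map inj_on_def)

lemma distinct_concat_Pair: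
  assumes "distinct vs" "\<And>v. distinct (f v)"
  shows "distinct (concat (map (\<lambda>v. map (Pair v) (f v)) vs))"
  using assms(1) by (induction vs) (auto simp: distinct_map inj_on_def assms(2))

lemma mset_cycle_edge:
  "image_mset (Pair i) (mset_set {(v, r). v \<in># mset (step_edge s w) \<and> r \<in> {1..ks ! part_of v}})
     = mset (cycle_edge ks s i w)"
proof -
  define xs where "xs = concat (map (\<lambda>v. map (Pair v) [1..<Suc (ks ! part_of v)]) (step_edge s w))"
  have "distinct xs"
    unfolding xs_def by (intro distinct_concat_Pair distinct_step_edge distinct_upt)
  moreover have "set xs = {(v, r). v \<in># mset (step_edge s w) \<and> r \<in> {1..ks ! part_of v}}"
    by (auto simp: xs_def atLeastLessThanSuc_atLeastAtMost simp del: upt_Suc)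
  ultimately have "mset_set {(v, r). v \<in># mset (step_edge s w) \<and> r \<in> {1..ks ! part_of v}} = mset xs"
    using mset_set_set[of xs] by simp
  then show ?thesis
    by (simp add: xs_def cycle_edge_def map_concat comp_def flip: mset_map)
qed

lemma edges_hcycle:
  assumes "length ks = Suc (Suc s)"
  shows "edges (hcycle ks m) =
    (\<lambda>(i, w). mset (map (cycle_quot ks m) (cycle_edge ks s i w))) ` ({..<m} \<times> bits (Suc s))"
proof -
  have "edges (step ks) = (\<lambda>w. mset_set {(v, r). v \<in># mset (step_edge s w) \<and> r \<in> {1..ks ! part_of v}}) ` bits (Suc s)"
    using assms
    by (auto simp: step_def simple_step_def Let_def bits_def step_edge_def image_def simp del: upt_Suc)
  then have "edges (hcycle ks m) = (\<lambda>(i, w). image_mset (cycle_quot ks m) (image_mset (Pair i)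
      (mset_set {(v, r). v \<in># mset (step_edge s w) \<and> r \<in> {1..ks ! part_of v}}))) ` ({..<m} \<times> bits (Suc s))"
    unfolding edges_hcycle_quot by force
  then show ?thesis by (simp only: mset_cycle_edge mset_map)
qed

text \<open>The edges form a set, so the exponent of \<open>p\<close> is right only if gluing merges
  no two of them. Blocks of part 1 are never glued and reveal \<open>i\<close>; the \<open>A\<close>
  block then reveals \<open>w\<close>.\<close>

lemma card_edges_hcycle:
  assumes ks: "length ks = Suc (Suc s)" and pos: "\<forall>j\<in>set ks. j > 0" and m: "m \<ge> 2"
  shows "card (edges (hcycle ks m)) = m * 2 ^ Suc s"
proof -
  have "inj_on (\<lambda>(i, w). mset (map (cycle_quot ks m) (cycle_edge ks s i w))) ({..<m} \<times> bits (Suc s))"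
    (is "inj_on ?f _")
  proof (rule inj_onI)
    fix x x' assume "x \<in> {..<m} \<times> bits (Suc s)" "x' \<in> {..<m} \<times> bits (Suc s)" "?f x = ?f x'"
    then obtain i w i' w' where xx: "x = (i, w)" "x' = (i', w')"
      and i: "i \<in> {..<m}" "i' \<in> {..<m}" and w: "w \<in> bits (Suc s)" "w' \<in> bits (Suc s)"
      and eq: "mset (map (cycle_quot ks m) (cycle_edge ks s i w))
             = mset (map (cycle_quot ks m) (cycle_edge ks s i' w'))"
      by auto
    have sets: "cycle_quot ks m ` set (cycle_edge ks s i w) = cycle_quot ks m ` set (cycle_edge ks s i' w')"
      using mset_eq_setD[OF eq] by simp
    have ex: "\<exists>y\<in>set (cycle_edge ks s i' w'). vertex_rep m x = vertex_rep m y"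
      if x: "x \<in> set (cycle_edge ks s i w)" for x
    proof -
      have "cycle_quot ks m x \<in> cycle_quot ks m ` set (cycle_edge ks s i' w')"
        using x sets by blast
      then obtain y where y: "y \<in> set (cycle_edge ks s i' w')" "cycle_quot ks m x = cycle_quot ks m y"
        by (rule imageE) simp
      have "vertex_rep m x = vertex_rep m y"
        by (rule vertex_rep_eq_of_cycle_quot_eq[OF _ y(2)]) (use m in simp)
      then show ?thesis using y(1) by blast
    qed
    have ks0: "1 \<le> ks ! 0" "1 \<le> ks ! 1"
      using pos ks nth_mem[of 0 ks] nth_mem[of 1 ks] by (auto simp: Suc_le_eq)
    have "(i, PartB 1 (remove_bit 1 w), 1) \<in> set (cycle_edge ks s i w)"
      using ks0 by (auto simp: set_cycle_edge step_edge_def simp del: upt_Suc)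
    from ex[OF this] obtain v r where "v \<in> set (step_edge s w')"
      "(i, PartB 1 (remove_bit 1 w), 1) = vertex_rep m (i', v, r)"
      by (auto simp: set_cycle_edge simp del: vertex_rep.simps) (simp add: vertex_rep.simps)
    then have ii: "i = i'" by (cases v rule: step_vertex.exhaust) (auto split: if_splits)
    have "(i, PartA w, 1) \<in> set (cycle_edge ks s i w)"
      using ks0 by (auto simp: set_cycle_edge step_edge_def simp del: upt_Suc)
    from ex[OF this] obtain v r where v: "v \<in> set (step_edge s w')"
      "vertex_rep m (i, PartA w, 1) = vertex_rep m (i, v, r)"
      by (auto simp: set_cycle_edge ii simp del: vertex_rep.simps)
    then have "v = PartA w'"
      by (cases v rule: step_vertex.exhaust) (auto simp: step_edge_def split: if_splits)
    then have "block_rep m (i, PartA w) = block_rep m (i, PartA w')"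
      using v(2) by (simp add: prod_eq_iff del: block_rep.simps)
    \<comment> \<open>Here \<open>m \<ge> 2\<close> matters: it separates codes ending in
      \<open>True\<close>, represented in the next step, from those ending in
      \<open>False\<close>.\<close>
    moreover have "Suc i mod m \<noteq> i"
      using i m by (cases "Suc i = m") auto
    moreover have "w = butlast w @ [last w]" "w' = butlast w' @ [last w']"
      using w by (auto simp: bits_def intro!: append_butlast_last_id[symmetric])
    ultimately have "w = w'"
      by (auto split: if_splits)
    then show "x = x'" using ii xx by simp
  qed
  from card_image[OF this] show ?thesis
    by (simp add: edges_hcycle[OF ks] card_cartesian_product card_bits)
qed

section \<open>Homomorphisms of the cycle\<close>

definition homs :: "'b hypergraph \<Rightarrow> 'a hypergraph \<Rightarrow> ('b \<Rightarrow> 'a) set" where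
  "homs F H = {\<alpha> \<in> verts F \<rightarrow>\<^sub>E verts H. \<forall>E\<in>edges F. image_mset \<alpha> E \<in> edges H}"

definition good_assignments ::
    "nat list \<Rightarrow> nat \<Rightarrow> 'a hypergraph \<Rightarrow> (nat \<times> step_vertex \<Rightarrow> 'a list) set" where
  "good_assignments ks m H = {\<phi> \<in> assignments m (verts H) ks.
     \<forall>i<m. \<forall>w\<in>bits (length ks - 1). mset (concat (edge_blocks m (length ks - 2) \<phi> i w)) \<in> edges H}"

text \<open>A class is evaluated at its representative; the shift in \<open>r - 1\<close> is there
  because vertices of a block are numbered from 1.\<close>

definition hom_of_assignment ::
    "nat list \<Rightarrow> nat \<Rightarrow> (nat \<times> step_vertex \<Rightarrow> 'a list) \<Rightarrow> (nat \<times> step_vertex \<times> nat) set set \<Rightarrow> 'a" where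
  "hom_of_assignment ks m \<phi> = (\<lambda>c\<in>verts (hcycle ks m).
     case inv_into (cycle_verts ks m) (cycle_quot ks m) c of (i, v, r) \<Rightarrow> \<phi> (i, v) ! (r - 1))"

lemma hom_of_assignment_quot:
  assumes "length ks = Suc (Suc s)" "m \<ge> 1" "(i, v, r) \<in> {..<m} \<times> verts (step ks)"
  shows "hom_of_assignment ks m \<phi> (cycle_quot ks m (i, v, r)) = \<phi> (block_rep m (i, v)) ! (r - 1)"
proof -
  have c: "vertex_rep m (i, v, r) \<in> cycle_verts ks m"
    by (rule vertex_rep_in_cycle_verts[OF assms(1,3)])
  then have "cycle_quot ks m (vertex_rep m (i, v, r)) \<in> verts (hcycle ks m)"
    unfolding verts_hcycle[OF assms(1)] by (rule imageI)
  moreover have "inv_into (cycle_verts ks m) (cycle_quot ks m) (cycle_quot ks m (vertex_rep m (i, v, r)))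
      = vertex_rep m (i, v, r)"
    by (rule inv_into_f_f[OF inj_on_cycle_quot[OF assms(2)] c])
  ultimately show ?thesis
    unfolding cycle_quot_vertex_rep[OF assms(1,3)] hom_of_assignment_def by simp
qed

lemma block_rep_cycle_blocks:
  assumes "length ks = Suc (Suc s)" "(v, r) \<in> verts (step ks)" "i < m"
  shows "block_rep m (i, v) \<in> cycle_blocks m s" "part_of (snd (block_rep m (i, v))) = part_of v"
proof -
  have "Suc i mod m < m" using assms(3) by simp
  then show "block_rep m (i, v) \<in> cycle_blocks m s" "part_of (snd (block_rep m (i, v))) = part_of v"
    using assms in_verts_step[OF assms(1), of v r] by (cases v; auto simp: cycle_blocks_def)+
qed

lemma assignment_block:
  assumes "length ks = Suc (Suc s)" "(v, r) \<in> verts (step ks)" "i < m" "\<phi> \<in> assignments m V ks"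
  shows "\<phi> (block_rep m (i, v)) \<in> tuples V (ks ! part_of v)"
  using PiE_mem[OF assms(4)[unfolded assignments_def], of "block_rep m (i, v)"]
    block_rep_cycle_blocks[OF assms(1-3)] assms(1) by simp

lemma map_nth_from_1: "length xs = n \<Longrightarrow> map (\<lambda>r. xs ! (r - 1)) [1..<Suc n] = xs"
  by (rule nth_equalityI) (auto simp del: upt_Suc)

text \<open>Along \<open>cycle_edge\<close> the values of the map spell out, block by block, the
  tuples of \<open>edge_blocks\<close>.\<close>

lemma hom_of_assignment_in_homs:
  assumes ks: "length ks = Suc (Suc s)" and pos: "\<forall>j\<in>set ks. j > 0" and m: "m \<ge> 1"
    and \<phi>: "\<phi> \<in> good_assignments ks m H"
  shows "hom_of_assignment ks m \<phi> \<in> homs (hcycle ks m) H"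
proof -
  define \<alpha> where "\<alpha> = hom_of_assignment ks m \<phi>"
  have as: "\<phi> \<in> assignments m (verts H) ks" using \<phi> by (simp add: good_assignments_def)
  have "\<alpha> \<in> verts (hcycle ks m) \<rightarrow>\<^sub>E verts H"
  proof (rule PiE_I)
    fix c assume "c \<in> verts (hcycle ks m)"
    then obtain i v r where c: "c = cycle_quot ks m (i, v, r)" and x: "(i, v, r) \<in> {..<m} \<times> verts (step ks)"
      by (auto simp: verts_hcycle_quot)
    have "\<phi> (block_rep m (i, v)) \<in> tuples (verts H) (ks ! part_of v)"
      using x by (intro assignment_block[OF ks _ _ as]) auto
    moreover have "r - 1 < ks ! part_of v"
      using x in_verts_step[OF ks, of v r] by auto
    ultimately show "\<alpha> c \<in> verts H"
      unfolding \<alpha>_def c hom_of_assignment_quot[OF ks m x] by (auto simp: tuples_def)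
  qed (simp add: \<alpha>_def hom_of_assignment_def)
  moreover have "image_mset \<alpha> E \<in> edges H" if "E \<in> edges (hcycle ks m)" for E
  proof -
    obtain i w where i: "i < m" and w: "w \<in> bits (Suc s)"
      and E: "E = mset (map (cycle_quot ks m) (cycle_edge ks s i w))"
      using \<open>E \<in> edges (hcycle ks m)\<close> by (auto simp: edges_hcycle[OF ks])
    have vs: "(v, r) \<in> verts (step ks)" if "v \<in> set (step_edge s w)" "r \<in> {1..ks ! part_of v}" for v r
      using that w by (auto simp: in_verts_step[OF ks] step_edge_def bits_def length_remove_bit simp del: upt_Suc)
    have "map (\<lambda>r. \<alpha> (cycle_quot ks m (i, v, r))) [1..<Suc (ks ! part_of v)] = \<phi> (block_rep m (i, v))"
      if v: "v \<in> set (step_edge s w)" for v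
    proof -
      have "part_of v < length ks"
        using v by (auto simp: step_edge_def ks simp del: upt_Suc)
      then have "1 \<le> ks ! part_of v" using pos nth_mem by (auto simp: Suc_le_eq)
      then have "\<phi> (block_rep m (i, v)) \<in> tuples (verts H) (ks ! part_of v)"
        using vs[OF v, of 1] i by (intro assignment_block[OF ks _ _ as]) auto
      then have "length (\<phi> (block_rep m (i, v))) = ks ! part_of v" by (simp add: tuples_def)
      from map_nth_from_1[OF this]
      have "map (\<lambda>r. \<phi> (block_rep m (i, v)) ! (r - 1)) [1..<Suc (ks ! part_of v)] = \<phi> (block_rep m (i, v))" .
      moreover have "\<alpha> (cycle_quot ks m (i, v, r)) = \<phi> (block_rep m (i, v)) ! (r - 1)"
        if "r \<in> {1..ks ! part_of v}" for r
        unfolding \<alpha>_def using vs[OF v that] i by (intro hom_of_assignment_quot[OF ks m]) auto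
      then have "map (\<lambda>r. \<alpha> (cycle_quot ks m (i, v, r))) [1..<Suc (ks ! part_of v)]
          = map (\<lambda>r. \<phi> (block_rep m (i, v)) ! (r - 1)) [1..<Suc (ks ! part_of v)]"
        by (intro map_cong refl) (simp add: less_Suc_eq_le del: upt_Suc)
      ultimately show ?thesis by simp
    qed
    then have "map (\<lambda>v. map (\<lambda>r. \<alpha> (cycle_quot ks m (i, v, r))) [1..<Suc (ks ! part_of v)]) (step_edge s w)
        = map (\<lambda>v. \<phi> (block_rep m (i, v))) (step_edge s w)"
      by (intro map_cong refl)
    also have "\<dots> = edge_blocks m s \<phi> i w"
      by (simp add: step_edge_def edge_blocks_def del: upt_Suc)
    finally have "image_mset \<alpha> E = mset (concat (edge_blocks m s \<phi> i w))"
      by (simp add: E cycle_edge_def map_concat comp_def flip: mset_map del: upt_Suc)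
    then show ?thesis using \<phi> i w ks by (simp add: good_assignments_def)
  qed
  ultimately show ?thesis by (simp add: homs_def \<alpha>_def)
qed

lemma inj_on_hom_of_assignment:
  assumes ks: "length ks = Suc (Suc s)" and m: "m \<ge> 1"
  shows "inj_on (hom_of_assignment ks m) (assignments m V ks)"
proof (rule inj_onI)
  fix \<phi> \<phi>' assume \<phi>: "\<phi> \<in> assignments m V ks" "\<phi>' \<in> assignments m V ks"
    and eq: "hom_of_assignment ks m \<phi> = hom_of_assignment ks m \<phi>'"
  show "\<phi> = \<phi>'"
  proof (rule PiE_ext[OF \<phi>[unfolded assignments_def]])
    fix x assume x: "x \<in> cycle_blocks m (length ks - 2)"
    obtain i v where xe: "x = (i, v)" by (cases x)
    have len: "length (\<psi> x) = ks ! part_of v" if "\<psi> \<in> assignments m V ks" for \<psi>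
      using PiE_mem[OF that[unfolded assignments_def] x] by (simp add: xe tuples_def)
    show "\<phi> x = \<phi>' x"
    proof (rule nth_equalityI)
      fix r assume "r < length (\<phi> x)"
      then have c: "(i, v, Suc r) \<in> cycle_verts ks m"
        using x len[OF \<phi>(1)] by (auto simp: cycle_verts_def xe)
      then have D: "(i, v, Suc r) \<in> {..<m} \<times> verts (step ks)"
        using cycle_verts_subset[OF ks] by blast
      have "block_rep m (i, v) = (i, v)"
        using vertex_rep_cycle_verts[OF c] by (simp add: prod_eq_iff)
      then show "\<phi> x ! r = \<phi>' x ! r"
        using hom_of_assignment_quot[OF ks m D, of \<phi>] hom_of_assignment_quot[OF ks m D, of \<phi>'] eq
        by (simp add: xe)
    qed (simp add: len \<phi>)
  qed
qed

section \<open>Comparison of assignments, homomorphisms and labeled copies\<close>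

lemma finite_homs:
  assumes "finite (verts F)" "finite (verts H)"
  shows "finite (homs F H)"
  using finite_PiE[of "verts F" "\<lambda>_. verts H"] assms by (simp add: homs_def)

text \<open>An inequality suffices because the cycle count only serves as an upper bound.\<close>

lemma card_good_assignments_le:
  assumes "length ks = Suc (Suc s)" "\<forall>j\<in>set ks. j > 0" "m \<ge> 1" "finite (verts H)"
  shows "card (good_assignments ks m H) \<le> card (homs (hcycle ks m) H)"
proof (rule card_inj_on_le[of "hom_of_assignment ks m"])
  show "inj_on (hom_of_assignment ks m) (good_assignments ks m H)"
    by (rule inj_on_subset[OF inj_on_hom_of_assignment[OF assms(1,3)]])
       (auto simp: good_assignments_def)
  show "hom_of_assignment ks m ` good_assignments ks m H \<subseteq> homs (hcycle ks m) H"
    using hom_of_assignment_in_homs[OF assms(1-3)] by blast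
  show "finite (homs (hcycle ks m) H)"
    using assms card_verts_hcycle[OF assms(1,3)] by (intro finite_homs)
qed

text \<open>The value at \<open>x\<close> is recovered from the value at \<open>y\<close>, so
  forgetting \<open>x\<close> is injective.\<close>

lemma card_PiE_identify_le:
  assumes "finite A" "finite B" "x \<in> A" "y \<in> A" "x \<noteq> y"
  shows "card {\<alpha> \<in> A \<rightarrow>\<^sub>E B. \<alpha> x = \<alpha> y} \<le> card B ^ (card A - 1)"
proof -
  have "card {\<alpha> \<in> A \<rightarrow>\<^sub>E B. \<alpha> x = \<alpha> y} \<le> card ((A - {x}) \<rightarrow>\<^sub>E B)"
  proof (rule card_inj_on_le[of "\<lambda>\<alpha>. restrict \<alpha> (A - {x})"])
    show "inj_on (\<lambda>\<alpha>. restrict \<alpha> (A - {x})) {\<alpha> \<in> A \<rightarrow>\<^sub>E B. \<alpha> x = \<alpha> y}"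
    proof (rule inj_onI)
      fix \<alpha> \<beta> assume a: "\<alpha> \<in> {\<alpha> \<in> A \<rightarrow>\<^sub>E B. \<alpha> x = \<alpha> y}" "\<beta> \<in> {\<alpha> \<in> A \<rightarrow>\<^sub>E B. \<alpha> x = \<alpha> y}"
        and eq: "restrict \<alpha> (A - {x}) = restrict \<beta> (A - {x})"
      have e: "\<alpha> z = \<beta> z" if "z \<in> A" "z \<noteq> x" for z
        using fun_cong[OF eq, of z] that by simp
      have "\<alpha> z = \<beta> z" if "z \<in> A" for z
        using e[OF that] e[of y] a assms by (cases "z = x") auto
      then show "\<alpha> = \<beta>" using a by (auto intro: PiE_ext)
    qed
    show "(\<lambda>\<alpha>. restrict \<alpha> (A - {x})) ` {\<alpha> \<in> A \<rightarrow>\<^sub>E B. \<alpha> x = \<alpha> y} \<subseteq> (A - {x}) \<rightarrow>\<^sub>E B"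
      by (intro image_subsetI, subst restrict_PiE_iff) (auto dest: PiE_mem)
    show "finite ((A - {x}) \<rightarrow>\<^sub>E B)" using assms by (intro finite_PiE) auto
  qed
  also have "\<dots> = card B ^ (card A - 1)"
    using assms by (simp add: card_PiE)
  finally show ?thesis .
qed

text \<open>A homomorphism that is not a labeled copy identifies two distinct vertices; the union
  bound over all such pairs loses one power of the number of vertices of \<open>H\<close>.\<close>

lemma card_homs_le:
  assumes F: "finite (verts F)" and H: "finite (verts H)"
  shows "card (homs F H) \<le> card (labeled_copies F H)
     + card (verts F) ^ 2 * card (verts H) ^ (card (verts F) - 1)"
proof -
  define P where "P = {(x, y) \<in> verts F \<times> verts F. x \<noteq> y}"
  define S where "S = (\<lambda>(x, y). {\<alpha> \<in> verts F \<rightarrow>\<^sub>E verts H. \<alpha> x = \<alpha> y})"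
  have finP: "finite P" and cP: "card P \<le> card (verts F) ^ 2"
    using F card_mono[of "verts F \<times> verts F" P]
    by (auto simp: P_def card_cartesian_product power2_eq_square intro: finite_subset[of _ "verts F \<times> verts F"])
  have finA: "finite (verts F \<rightarrow>\<^sub>E verts H)" using F H by (intro finite_PiE) auto
  have finS: "finite (S z)" for z
    unfolding S_def case_prod_unfold by (rule finite_subset[OF _ finA]) auto
  have "homs F H \<subseteq> labeled_copies F H \<union> (\<Union>z\<in>P. S z)"
    by (auto simp: homs_def labeled_copies_def inj_on_def P_def S_def)
  moreover have "finite (labeled_copies F H)"
    unfolding labeled_copies_def by (rule finite_subset[OF _ finA]) auto
  ultimately have "card (homs F H) \<le> card (labeled_copies F H \<union> (\<Union>z\<in>P. S z))"
    using finP finS by (intro card_mono) auto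
  also have "\<dots> \<le> card (labeled_copies F H) + card (\<Union>z\<in>P. S z)"
    by (rule card_Un_le)
  also have "card (\<Union>z\<in>P. S z) \<le> (\<Sum>z\<in>P. card (S z))"
    by (rule card_UN_le[OF finP])
  also have "\<dots> \<le> of_nat (card P) * card (verts H) ^ (card (verts F) - 1)"
    by (rule sum_bounded_above) (use card_PiE_identify_le[OF F H] in \<open>auto simp: P_def S_def\<close>)
  also have "\<dots> \<le> card (verts F) ^ 2 * card (verts H) ^ (card (verts F) - 1)"
    using cP by simp
  finally show ?thesis by simp
qed

definition adj :: "'a hypergraph \<Rightarrow> 'a list list \<Rightarrow> real" where
  "adj H bs = (if mset (concat bs) \<in> edges H then 1 else 0)"

lemma finite_cycle_blocks: "finite (cycle_blocks m s)"
proof -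
  have "{v. cycle_block s v} \<subseteq> PartA ` bits (Suc s) \<union> (\<lambda>(j, w). PartB j w) ` ({..Suc s} \<times> bits s)"
  proof
    fix v assume "v \<in> {v. cycle_block s v}"
    then show "v \<in> PartA ` bits (Suc s) \<union> (\<lambda>(j, w). PartB j w) ` ({..Suc s} \<times> bits s)"
      by (cases v) (auto simp: bits_def)
  qed
  from finite_subset[OF this] show ?thesis unfolding cycle_blocks_def by auto
qed

lemma cyc_adj:
  assumes "finite (verts H)" "length ks = Suc (Suc s)"
  shows "cyc m (verts H) (adj H) ks = card (good_assignments ks m H)"
proof -
  have fin: "finite (assignments m (verts H) ks)"
    unfolding assignments_def using assms finite_cycle_blocks by (intro finite_PiE) auto
  have "(\<Prod>i<m. \<Prod>w\<in>bits (Suc s). adj H (edge_blocks m s \<phi> i w))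
      = (if \<forall>i<m. \<forall>w\<in>bits (Suc s). mset (concat (edge_blocks m s \<phi> i w)) \<in> edges H then 1 else 0)" for \<phi>
  proof (cases "\<forall>i<m. \<forall>w\<in>bits (Suc s). mset (concat (edge_blocks m s \<phi> i w)) \<in> edges H")
    case True
    then show ?thesis by (simp add: adj_def)
  next
    case False
    then obtain i w where "i < m" "w \<in> bits (Suc s)" "adj H (edge_blocks m s \<phi> i w) = 0"
      by (auto simp: adj_def)
    then have "\<exists>i\<in>{..<m}. (\<Prod>w\<in>bits (Suc s). adj H (edge_blocks m s \<phi> i w)) = 0"
      by (intro bexI[of _ i] prod_zero) auto
    then have "(\<Prod>i<m. \<Prod>w\<in>bits (Suc s). adj H (edge_blocks m s \<phi> i w)) = 0"
      by (intro prod_zero) auto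
    then show ?thesis by (simp only: if_not_P[OF False])
  qed
  then show ?thesis
    using fin by (simp add: cyc_unroll[OF assms] good_assignments_def assms(2) sum.If_cases Int_def)
qed

lemma cyc_scale:
  assumes "finite V" "length ks = Suc (Suc s)"
  shows "cyc m V (\<lambda>bs. g bs * c) ks = cyc m V g ks * c ^ (m * 2 ^ Suc s)"
  by (simp add: cyc_unroll[OF assms] prod.distrib card_bits power_mult[symmetric] mult.commute
      sum_distrib_left[symmetric] sum_distrib_right[symmetric])

section \<open>Forms and partition maps\<close>

lemma blocks_iff:
  "bs \<in> blocks V ks \<longleftrightarrow> length bs = length ks \<and> (\<forall>i<length ks. bs ! i \<in> tuples V (ks ! i))"
proof (induction ks arbitrary: bs)
  case (Cons k ks)
  show ?case
  proof (cases bs)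
    case (Cons b bs')
    then show ?thesis using Cons.IH[of bs'] by (auto simp: blocks_Cons All_less_Suc2)
  qed (auto simp: blocks_Cons)
qed auto

lemma weight_prod: "length us = length bs \<Longrightarrow> weight us bs = (\<Prod>i<length bs. (us ! i) (bs ! i))"
proof (induction us bs rule: list_induct2)
  case (Cons u us b bs)
  then show ?case by (simp add: prod.lessThan_Suc_shift del: prod.lessThan_Suc)
qed simp

lemma sum_blocks_permute:
  fixes c :: "'a multiset \<Rightarrow> real"
  assumes p: "p permutes {..<length ks'}" and ks: "permute_list p ks' = ks" and us: "length us = length ks'"
  shows "(\<Sum>bs\<in>blocks V ks'. c (mset (concat bs)) * weight us bs)
     = (\<Sum>bs\<in>blocks V ks. c (mset (concat bs)) * weight (permute_list p us) bs)"
proof (rule sum.reindex_bij_witness[of _ "permute_list (inv p)" "permute_list p"])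
  have len: "length ks = length ks'" using ks by auto
  note pinv = permutes_inv[OF p]
  have pi: "p i < length ks'" "inv p i < length ks'" if "i < length ks'" for i
    using permutes_in_image[OF p, of i] permutes_in_image[OF pinv, of i] that by auto
  have ksi: "ks ! i = ks' ! p i" if "i < length ks'" for i
    using permute_list_nth[OF p that] ks by simp
  fix bs assume "bs \<in> blocks V ks'"
  then have l: "length bs = length ks'" and b: "\<And>i. i < length ks' \<Longrightarrow> bs ! i \<in> tuples V (ks' ! i)"
    by (auto simp: blocks_iff)
  have p': "p permutes {..<length bs}" "p permutes {..<length us}" using p l us by auto
  show "permute_list (inv p) (permute_list p bs) = bs"
    using permute_list_compose[of "inv p" bs p] pinv l permutes_inv_o(1)[OF p] by simp
  show "permute_list p bs \<in> blocks V ks"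
    using b pi by (auto simp: blocks_iff len l permute_list_nth[OF p'(1)] ksi)
  have "mset (concat (permute_list p bs)) = mset (concat bs)"
    by (simp add: mset_concat flip: sum_mset_sum_list) (simp add: p')
  moreover have "weight (permute_list p us) (permute_list p bs) = weight us bs"
  proof -
    have "weight (permute_list p us) (permute_list p bs)
        = (\<Prod>i<length ks'. (us ! p i) (bs ! p i))"
      using l us by (simp add: weight_prod permute_list_nth[OF p'(1)] permute_list_nth[OF p'(2)])
    also have "\<dots> = (\<Prod>i<length ks'. (us ! i) (bs ! i))"
      using prod.permute[OF p, of "\<lambda>i. (us ! i) (bs ! i)"] by (simp add: comp_def)
    finally show ?thesis using l us by (simp add: weight_prod)
  qed
  ultimately show "c (mset (concat (permute_list p bs))) * weight (permute_list p us) (permute_list p bs)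
      = c (mset (concat bs)) * weight us bs" by simp
next
  have len: "length ks = length ks'" using ks by auto
  note pinv = permutes_inv[OF p]
  have pi: "inv p i < length ks'" if "i < length ks'" for i
    using permutes_in_image[OF pinv, of i] that by auto
  fix bs assume "bs \<in> blocks V ks"
  then have l: "length bs = length ks'" and b: "\<And>i. i < length ks' \<Longrightarrow> bs ! i \<in> tuples V (ks ! i)"
    by (auto simp: blocks_iff len)
  show "permute_list p (permute_list (inv p) bs) = bs"
    using permute_list_compose[of p bs "inv p"] p l permutes_inv_o(2)[OF p] by simp
  have "permute_list (inv p) bs ! i \<in> tuples V (ks' ! i)" if i: "i < length ks'" for i
  proof -
    have "bs ! inv p i \<in> tuples V (ks ! inv p i)" using b pi[OF i] by blast
    also have "ks ! inv p i = ks' ! i"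
      using permute_list_nth[OF p pi[OF i]] ks permutes_inverses(1)[OF p] by simp
    finally show ?thesis using permute_list_nth[of "inv p" bs i] pinv l i by simp
  qed
  then show "permute_list (inv p) bs \<in> blocks V ks'" by (simp add: blocks_iff l)
qed

lemma unit_vecs_iff:
  "unit_vecs V ks us \<longleftrightarrow> length us = length ks \<and> (\<forall>i<length ks. L2_set (us ! i) (tuples V (ks ! i)) = 1)"
  by (auto simp: unit_vecs_def list_all2_conv_all_nth L2_set_def)

lemma unit_vecs_permute:
  assumes p: "p permutes {..<length ks'}" and us: "unit_vecs V ks' us"
  shows "unit_vecs V (permute_list p ks') (permute_list p us)"
  using us p permutes_in_image[OF p]
  by (auto simp: unit_vecs_iff permute_list_nth)

text \<open>In this form \<open>sum_blocks_permute\<close> applies to \<open>prodip\<close>, and it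
  can be identified with the all-ones map.\<close>

lemma prodip_form:
  "length us = length ls \<Longrightarrow> prodip V ls us = form V (\<lambda>_. (1 / sqrt (real (card V))) ^ sum_list ls) ls us"
proof (induction us ls rule: list_induct2)
  case Nil
  then show ?case by (simp add: form_def)
next
  case (Cons u us L ls)
  have "(\<Sum>b\<in>tuples V L. u b * cvec V b) = (\<Sum>b\<in>tuples V L. u b * (1 / sqrt (real (card V))) ^ L)"
    by (intro sum.cong refl) (simp add: cvec_def tuples_def)
  then show ?case
    using Cons.IH by (simp only: prodip.simps form_def sum_blocks_Cons sum_product weight.simps
      sum_list.Cons power_add mult_ac)
qed

lemma concat_blocks: "bs \<in> blocks V ks \<Longrightarrow> concat bs \<in> tuples V (sum_list ks)"
proof (induction ks arbitrary: bs)
  case (Cons k ks)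
  then obtain b bs' where "bs = b # bs'" "b \<in> tuples V k" "bs' \<in> blocks V ks"
    by (auto simp: blocks_Cons)
  then show ?case using Cons.IH[of bs'] by (auto simp: tuples_def)
qed (auto simp: tuples_def)

lemma multilinear_extension_basis:
  assumes "finite V" "vs \<in> tuples V k"
  shows "multilinear_extension V k c (map std_basis vs) = c vs"
proof -
  have "c us * (\<Prod>i<k. (map std_basis vs ! i) (us ! i)) = (if us = vs then c vs else 0)"
    if us: "us \<in> tuples V k" for us
  proof (cases "us = vs")
    case True
    then show ?thesis using assms by (simp add: tuples_def std_basis_def)
  next
    case False
    then obtain i where "i < k" "us ! i \<noteq> vs ! i"
      using us assms by (auto simp: tuples_def list_eq_iff_nth_eq)
    then have "(\<Prod>i<k. (map std_basis vs ! i) (us ! i)) = 0"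
      using assms by (intro prod_zero) (auto simp: tuples_def std_basis_def intro!: bexI[of _ i])
    then show ?thesis using False by simp
  qed
  then have "multilinear_extension V k c (map std_basis vs) = (\<Sum>us\<in>tuples V k. if us = vs then c vs else 0)"
    unfolding multilinear_extension_def by (intro sum.cong refl)
  then show ?thesis using assms by simp
qed

lemma partition_map_form:
  assumes "finite V" "length us = length ks"
  shows "partition_map V ks (multilinear_extension V (sum_list ks) c) us = form V (\<lambda>bs. c (concat bs)) ks us"
proof -
  have "{bs. length bs = length ks \<and> (\<forall>i<length ks. bs ! i \<in> tuples V (ks ! i))} = blocks V ks"
    by (auto simp: blocks_iff)
  then show ?thesis
    unfolding partition_map_def form_def
    using assms(2) length_blocks[of _ V ks] multilinear_extension_basis[OF assms(1) concat_blocks]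
    by (intro sum.cong) (auto simp: weight_prod)
qed

lemma sum_tuples_add:
  "(\<Sum>z\<in>tuples V (L + M). h z) = (\<Sum>a\<in>tuples V L. \<Sum>b\<in>tuples V M. h (a @ b))"
proof -
  have "(\<Sum>z\<in>tuples V (L + M). h z) = (\<Sum>(a, b)\<in>tuples V L \<times> tuples V M. h (a @ b))"
    by (rule sum.reindex_bij_witness[of _ "\<lambda>(a, b). a @ b" "\<lambda>z. (take L z, drop L z)"])
       (auto simp: tuples_def dest: in_set_takeD in_set_dropD)
  then show ?thesis by (simp add: sum.cartesian_product)
qed

lemma sum_blocks_concat: "(\<Sum>bs\<in>blocks V ks. h (concat bs)) = (\<Sum>vs\<in>tuples V (sum_list ks). h vs)"
proof (induction ks arbitrary: h)
  case Nil
  have "tuples V 0 = {[]}" by (auto simp: tuples_def)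
  then show ?case by simp
next
  case (Cons k ks)
  then show ?case using Cons[of "\<lambda>z. h (_ @ z)"] by (simp add: sum_blocks_Cons sum_tuples_add)
qed

section \<open>Counting edges\<close>

definition distinct_tuples :: "'a set \<Rightarrow> nat \<Rightarrow> 'a list set" where
  "distinct_tuples V k = {vs \<in> tuples V k. distinct vs}"

lemma card_distinct_tuples:
  assumes "finite V" "k \<le> card V"
  shows "card (distinct_tuples V k) = fact k * (card V choose k)"
    and "(card V - k) ^ k \<le> card (distinct_tuples V k)"
proof -
  have 1: "card (distinct_tuples V k) = \<Prod>{card V - k + 1..card V}"
    using card_lists_distinct_length_eq[OF assms]
    by (simp add: distinct_tuples_def tuples_def conj_commute conj_left_commute)
  have "fact (card V) = fact (card V - k) * \<Prod>{card V - k + 1..card V}"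
  proof -
    have "{1..card V} = {1..card V - k} \<union> {card V - k + 1..card V}" using assms(2) by auto
    moreover have "\<Prod>({1..card V - k} \<union> {card V - k + 1..card V}) = \<Prod>{1..card V - k} * \<Prod>{card V - k + 1..card V}"
      by (rule prod.union_disjoint) auto
    ultimately show ?thesis by (simp add: fact_prod)
  qed
  also have "fact (card V) = fact k * fact (card V - k) * (card V choose k)"
    using binomial_fact_lemma[OF assms(2)] by simp
  finally show "card (distinct_tuples V k) = fact k * (card V choose k)"
    unfolding 1 by (simp add: mult.assoc mult.left_commute)
  have "(card V - k) ^ k = (\<Prod>i\<in>{card V - k + 1..card V}. card V - k)"
    using assms(2) by simp
  also have "\<dots> \<le> \<Prod>{card V - k + 1..card V}"
    by (rule prod_mono) auto
  finally show "(card V - k) ^ k \<le> card (distinct_tuples V k)" unfolding 1 .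
qed

lemma card_orderings:
  assumes "distinct vs"
  shows "card {us. mset us = mset vs} = fact (length vs)"
proof -
  have "{us. mset us = mset vs} = permutations_of_set (set vs)"
  proof (intro set_eqI iffI)
    fix us assume "us \<in> {us. mset us = mset vs}"
    then have "mset us = mset vs" by simp
    then show "us \<in> permutations_of_set (set vs)"
      using assms mset_eq_setD[of us vs] mset_eq_imp_distinct_iff[of us vs]
      by (auto simp: permutations_of_set_def)
  next
    fix us assume "us \<in> permutations_of_set (set vs)"
    then show "us \<in> {us. mset us = mset vs}"
      using assms set_eq_iff_mset_eq_distinct[of us vs] by (auto simp: permutations_of_set_def)
  qed
  then show ?thesis using assms by (simp add: distinct_card)
qed

text \<open>Each edge that is not a loop has \<open>k!\<close> orderings, and there are at most as many loops as
  tuples with a repeated entry.\<close>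

lemma card_edge_tuples_ge:
  assumes H: "uniform_hypergraph_with_loops k H"
  shows "real (card {vs \<in> tuples (verts H) k. mset vs \<in> edges H}) \<ge>
    fact k * (real (card (edges H)) - (real (card (verts H)) ^ k - real (card (distinct_tuples (verts H) k))))"
proof -
  define V where "V = verts H"
  have V: "finite V" using H by (simp add: V_def uniform_hypergraph_with_loops_def)
  define E1 where "E1 = edges H \<inter> mset ` distinct_tuples V k"
  define N where "N = tuples V k - distinct_tuples V k"
  have fT: "finite (tuples V k)" using V by simp
  have sub: "distinct_tuples V k \<subseteq> tuples V k" by (auto simp: distinct_tuples_def)
  have ed: "edges H \<subseteq> mset ` tuples V k"
  proof
    fix E assume E: "E \<in> edges H"
    obtain vs where vs: "mset vs = E" using ex_mset by blast
    have "size E = k" "set_mset E \<subseteq> V"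
      using H E by (auto simp: uniform_hypergraph_with_loops_def V_def)
    then have "vs \<in> tuples V k" unfolding vs[symmetric] by (simp add: tuples_def)
    then show "E \<in> mset ` tuples V k" using vs by blast
  qed
  then have fE: "finite (edges H)" using fT by (meson finite_imageI finite_subset)
  have "card (edges H) \<le> card (E1 \<union> mset ` N)"
    using ed fE fT by (intro card_mono) (auto simp: E1_def N_def)
  also have "\<dots> \<le> card E1 + card (mset ` N)" by (rule card_Un_le)
  also have "card (mset ` N) \<le> card N" using fT by (intro card_image_le) (simp add: N_def)
  also have "card N = card V ^ k - card (distinct_tuples V k)"
    using card_Diff_subset[OF finite_subset[OF sub fT] sub] V by (simp add: N_def card_tuples)
  finally have "card (edges H) \<le> card E1 + (card V ^ k - card (distinct_tuples V k))" by simp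
  moreover have "card (distinct_tuples V k) \<le> card V ^ k"
    using card_mono[OF fT sub] V by (simp add: card_tuples)
  ultimately have 1: "real (card (edges H)) - (real (card V) ^ k - real (card (distinct_tuples V k))) \<le> real (card E1)"
    by (simp add: of_nat_diff algebra_simps flip: of_nat_power of_nat_add)
  have fib: "card {us. mset us = E} = fact k \<and> {us. mset us = E} \<subseteq> {vs \<in> tuples V k. mset vs \<in> edges H}"
    if E: "E \<in> E1" for E
  proof -
    obtain vs where vs: "vs \<in> distinct_tuples V k" "E = mset vs" "E \<in> edges H" using E by (auto simp: E1_def)
    then show ?thesis
      using card_orderings[of vs]
      by (auto simp: distinct_tuples_def tuples_def dest: mset_eq_setD mset_eq_length)
  qed
  have "fact k * card E1 = (\<Sum>E\<in>E1. card {us. mset us = E})"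
    using fib by simp
  also have "\<dots> = card (\<Union>E\<in>E1. {us. mset us = E})"
  proof (rule card_UN_disjoint[symmetric])
    show "finite E1" using fE by (simp add: E1_def)
    show "\<forall>E\<in>E1. finite {us. mset us = E}"
    proof
      fix E assume "E \<in> E1"
      from conjunct2[OF fib[OF this]] show "finite {us. mset us = E}"
        by (rule finite_subset) (use fT in simp)
    qed
  qed auto
  also have "\<dots> \<le> card {vs \<in> tuples V k. mset vs \<in> edges H}"
    using fib fT by (intro card_mono) auto
  finally have "real (fact k * card E1) \<le> real (card {vs \<in> tuples V k. mset vs \<in> edges H})"
    by (simp only: of_nat_le_iff)
  then have "fact k * real (card E1) \<le> real (card {vs \<in> tuples V k. mset vs \<in> edges H})"
    by simp
  moreover have "fact k * (real (card (edges H)) - (real (card V) ^ k - real (card (distinct_tuples V k))))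
      \<le> fact k * real (card E1)"
    using 1 by (rule mult_left_mono) simp
  ultimately show ?thesis unfolding V_def by linarith
qed

lemma binomial_density_tendsto:
  "(\<lambda>n. fact k * real (n choose k) / real n ^ k) \<longlonglongrightarrow> 1"
proof (rule tendsto_sandwich)
  have card: "real (n - k) ^ k \<le> fact k * real (n choose k) \<and> fact k * real (n choose k) \<le> real n ^ k"
    if "n \<ge> k" for n
  proof -
    have fin: "finite {..<n}" "k \<le> card {..<n}" using that by auto
    have "distinct_tuples {..<n} k \<subseteq> tuples {..<n} k" by (auto simp: distinct_tuples_def)
    then have "card (distinct_tuples {..<n} k) \<le> n ^ k"
      using card_mono[of "tuples {..<n} k"] by (simp add: card_tuples)
    then have "(n - k) ^ k \<le> fact k * (n choose k) \<and> fact k * (n choose k) \<le> n ^ k"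
      using card_distinct_tuples[OF fin] by simp
    then have "real ((n - k) ^ k) \<le> real (fact k * (n choose k)) \<and> real (fact k * (n choose k)) \<le> real (n ^ k)"
      by (simp only: of_nat_le_iff)
    then show ?thesis by simp
  qed
  show "eventually (\<lambda>n. fact k * real (n choose k) / real n ^ k \<le> 1) sequentially"
    using eventually_ge_at_top[of "max 1 k"] by eventually_elim (use card in simp)
  show "eventually (\<lambda>n. (1 - real k / real n) ^ k \<le> fact k * real (n choose k) / real n ^ k) sequentially"
    using eventually_ge_at_top[of "max 1 k"]
  proof eventually_elim
    case (elim n)
    then have "(1 - real k / real n) ^ k = real (n - k) ^ k / real n ^ k"
      by (simp add: of_nat_diff diff_divide_distrib flip: power_divide)
    then show ?case using card[of n] elim by (simp add: divide_right_mono)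
  qed
  have "(\<lambda>n. (1 - real k / real n) ^ k) \<longlonglongrightarrow> (1 - 0) ^ k"
    by (intro tendsto_intros lim_const_over_n)
  then show "(\<lambda>n. (1 - real k / real n) ^ k) \<longlonglongrightarrow> 1" by simp
qed simp

section \<open>Bounds for the spectral norms\<close>

lemma weight_cvec: "weight (replicate (length bs) (cvec V)) bs = cvec V (concat bs)"
  by (induction bs) (auto simp: cvec_def power_add)

text \<open>The kernel and the constant vectors each carry a factor
  \<open>1 / sqrt (real (card V)) ^ k\<close>; together they produce the density of ordered edge
  tuples.\<close>

lemma form_adj_cvec:
  assumes "finite V" "sum_list ks = k" "V = verts H"
  shows "form V (\<lambda>bs. adj H bs * (1 / sqrt (real (card V)) ^ k)) ks (replicate (length ks) (cvec V))
    = real (card {vs \<in> tuples V k. mset vs \<in> edges H}) / real (card V) ^ k"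
proof -
  have pw: "sqrt (real (card V)) ^ k * sqrt (real (card V)) ^ k = real (card V) ^ k"
    by (simp flip: power_mult_distrib)
  have "form V (\<lambda>bs. adj H bs * (1 / sqrt (real (card V)) ^ k)) ks (replicate (length ks) (cvec V))
      = (\<Sum>bs\<in>blocks V ks. (\<lambda>vs. (if mset vs \<in> edges H then 1 else 0) * (1 / real (card V) ^ k)) (concat bs))"
    unfolding form_def
  proof (intro sum.cong refl)
    fix bs assume bs: "bs \<in> blocks V ks"
    have "length (concat bs) = k" using concat_blocks[OF bs] assms(2) by (simp add: tuples_def)
    then have "weight (replicate (length ks) (cvec V)) bs = (1 / sqrt (real (card V))) ^ k"
      using weight_cvec[of bs V] length_blocks[OF bs] by (simp add: cvec_def)
    then show "adj H bs * (1 / sqrt (real (card V)) ^ k) * weight (replicate (length ks) (cvec V)) bs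
        = (\<lambda>vs. (if mset vs \<in> edges H then 1 else 0) * (1 / real (card V) ^ k)) (concat bs)"
      by (simp add: adj_def power_divide pw)
  qed
  also have "\<dots> = (\<Sum>vs\<in>tuples V k. (if mset vs \<in> edges H then 1 else 0) * (1 / real (card V) ^ k))"
    by (subst sum_blocks_concat) (simp add: assms(2))
  also have "\<dots> = real (card {vs \<in> tuples V k. mset vs \<in> edges H}) / real (card V) ^ k"
    using assms(1) by (simp add: sum.If_cases Int_def flip: sum_divide_distrib)
  finally show ?thesis .
qed

text \<open>The real supremum needs both a nonempty and a bounded set: the constant vectors give the
  former, the bound \<open>B\<close> the latter.\<close>

lemma spectral_norm_bounds:
  assumes V: "finite V" "V \<noteq> {}" and B: "\<And>us. unit_vecs V ks us \<Longrightarrow> \<bar>\<phi> us\<bar> \<le> B"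
  shows "spectral_norm V ks \<phi> \<le> B"
    and "unit_vecs V ks us \<Longrightarrow> \<bar>\<phi> us\<bar> \<le> spectral_norm V ks \<phi>"
proof -
  have eq: "spectral_norm V ks \<phi> = (SUP us\<in>{us. unit_vecs V ks us}. \<bar>\<phi> us\<bar>)"
    by (simp add: spectral_norm_def unit_vecs_iff)
  show "spectral_norm V ks \<phi> \<le> B"
    unfolding eq using unit_cvec[OF V, of ks] B by (intro cSUP_least) auto
  show "\<bar>\<phi> us\<bar> \<le> spectral_norm V ks \<phi>" if "unit_vecs V ks us"
    unfolding eq using that B by (intro cSUP_upper bdd_aboveI2[of _ _ B]) auto
qed

lemma cyc_normalized_le:
  assumes ks: "length ks = Suc (Suc s)" "\<forall>j\<in>set ks. j > 0" "sum_list ks = k" and m: "m \<ge> 1"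
    and H: "finite (verts H)" "verts H \<noteq> {}"
    and v: "v = card (verts (hcycle ks m))"
  shows "cyc m (verts H) (\<lambda>bs. adj H bs * (1 / sqrt (real (card (verts H))) ^ k)) ks
    \<le> real (card (labeled_copies (hcycle ks m) H)) / real (card (verts H)) ^ v
       + real v ^ 2 / real (card (verts H))"
proof -
  define n where "n = card (verts H)"
  have n: "n > 0" using H by (simp add: n_def card_gt_0_iff)
  have vv: "v = m * 2 ^ s * k" using card_verts_hcycle[OF ks(1) m] ks(3) v by simp
  \<comment> \<open>\<open>k\<close> times the number \<open>m * 2 ^ Suc s\<close> of factors is
    \<open>2 * v\<close>, so the square roots disappear.\<close>
  have "(sqrt (real n) ^ k) ^ (m * 2 ^ Suc s) = sqrt (real n) ^ (2 * v)"
    by (simp add: vv power_mult[symmetric] mult_ac)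
  also have "\<dots> = real n ^ v" by (simp add: power_mult)
  finally have pw: "(1 / sqrt (real n) ^ k) ^ (m * 2 ^ Suc s) = 1 / real n ^ v"
    by (simp add: power_divide)
  have "real (card (good_assignments ks m H)) \<le> real (card (labeled_copies (hcycle ks m) H) + v ^ 2 * n ^ (v - 1))"
    using card_good_assignments_le[OF ks(1,2) m H(1)]
      card_homs_le[OF card_verts_hcycle(1)[OF ks(1) m] H(1)]
    unfolding of_nat_le_iff by (simp add: v n_def)
  then have "real (card (good_assignments ks m H)) / real n ^ v
      \<le> (real (card (labeled_copies (hcycle ks m) H)) + real v ^ 2 * real n ^ (v - 1)) / real n ^ v"
    by (intro divide_right_mono) auto
  also have "\<dots> = real (card (labeled_copies (hcycle ks m) H)) / real n ^ v + real v ^ 2 * (real n ^ (v - 1) / real n ^ v)"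
    by (simp add: add_divide_distrib)
  also have "real v ^ 2 * (real n ^ (v - 1) / real n ^ v) = real v ^ 2 / real n"
    using n by (cases v) auto
  finally show ?thesis
    unfolding cyc_scale[OF H(1) ks(1)] cyc_adj[OF H(1) ks(1)] pw[unfolded n_def] by (simp add: n_def)
qed

text \<open>The adjacency kernel depends on the multiset of entries only, and so does the constant
  kernel behind \<open>prodip\<close>.\<close>

lemma form_near_product_permute:
  assumes ks: "mset ks = mset ks'"
    and near: "\<And>us. unit_vecs (verts H) ks us \<Longrightarrow>
      \<bar>form (verts H) (\<lambda>bs. adj H bs * c) ks us - p * prodip (verts H) ks us\<bar> \<le> \<epsilon>"
    and us: "unit_vecs (verts H) ks' us"
  shows "\<bar>form (verts H) (\<lambda>bs. adj H bs * c) ks' us - p * prodip (verts H) ks' us\<bar> \<le> \<epsilon>"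
proof -
  obtain \<sigma> where \<sigma>: "\<sigma> permutes {..<length ks'}" "permute_list \<sigma> ks' = ks"
    using mset_eq_permutation[OF ks] by metis
  have len: "length us = length ks'" using us by (simp add: unit_vecs_iff)
  have sl: "sum_list ks = sum_list ks'" using ks by (metis sum_mset_sum_list)
  have "form (verts H) (\<lambda>bs. adj H bs * c) ks' us = form (verts H) (\<lambda>bs. adj H bs * c) ks (permute_list \<sigma> us)"
    unfolding form_def adj_def
    using sum_blocks_permute[OF \<sigma> len, of "\<lambda>E. (if E \<in> edges H then 1 else 0) * c" "verts H"] by simp
  moreover have "prodip (verts H) ks' us = prodip (verts H) ks (permute_list \<sigma> us)"
    using sum_blocks_permute[OF \<sigma> len, of "\<lambda>_. (1 / sqrt (real (card (verts H)))) ^ sum_list ks" "verts H"]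
      \<sigma> len mset_eq_length[OF ks]
    by (simp add: prodip_form form_def sl)
  ultimately show ?thesis
    using near[of "permute_list \<sigma> us"] unit_vecs_permute[OF \<sigma>(1) us] \<sigma>(2) by simp
qed

lemma partition_map_adjacency:
  assumes "finite (verts H)" "verts H \<noteq> {}" "length us = length ks" "sum_list ks = k"
  shows "partition_map (verts H) ks (adjacency_map k H) us = sqrt (real (card (verts H))) ^ k
      * form (verts H) (\<lambda>bs. adj H bs * (1 / sqrt (real (card (verts H))) ^ k)) ks us"
    and "partition_map (verts H) ks (all_ones_map k (verts H)) us
      = sqrt (real (card (verts H))) ^ k * prodip (verts H) ks us"
proof -
  define N where "N = sqrt (real (card (verts H))) ^ k"
  have N: "N > 0" using assms by (simp add: N_def card_gt_0_iff)
  have "partition_map (verts H) ks (adjacency_map k H) us = form (verts H) (adj H) ks us"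
    unfolding adjacency_map_def assms(4)[symmetric]
    using partition_map_form[OF assms(1,3), of "\<lambda>vs. if mset vs \<in> edges H then 1 else 0"]
    by (simp add: adj_def[abs_def])
  also have "\<dots> = N * form (verts H) (\<lambda>bs. adj H bs * (1 / N)) ks us"
    using N by (simp add: form_def sum_distrib_left)
  finally show "partition_map (verts H) ks (adjacency_map k H) us = sqrt (real (card (verts H))) ^ k
      * form (verts H) (\<lambda>bs. adj H bs * (1 / sqrt (real (card (verts H))) ^ k)) ks us"
    by (simp add: N_def)
  have "partition_map (verts H) ks (all_ones_map k (verts H)) us = form (verts H) (\<lambda>_. 1) ks us"
    unfolding all_ones_map_def assms(4)[symmetric]
    using partition_map_form[OF assms(1,3), of "\<lambda>_. 1"] by simp
  also have "\<dots> = N * form (verts H) (\<lambda>_. 1 / N) ks us"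
    using N by (simp add: form_def sum_distrib_left)
  also have "form (verts H) (\<lambda>_. 1 / N) ks us = prodip (verts H) ks us"
    by (simp add: prodip_form[OF assms(3)] assms(4) N_def power_divide)
  finally show "partition_map (verts H) ks (all_ones_map k (verts H)) us
      = sqrt (real (card (verts H))) ^ k * prodip (verts H) ks us"
    by (simp add: N_def)
qed

text \<open>Testing at the constant vectors gives the lower bound for \<open>lambda1\<close>. In
  \<open>lambda2\<close> the coefficient of the all-ones map is the actual edge density; exchanging
  it for \<open>p\<close> costs the second \<epsilon>.\<close>

lemma lambda_bounds:
  assumes H: "finite (verts H)" "verts H \<noteq> {}" and k: "sum_list ks = k" and "0 < p" "0 \<le> \<epsilon>"
    and near: "\<And>us. unit_vecs (verts H) ks us \<Longrightarrow>
      \<bar>form (verts H) (\<lambda>bs. adj H bs * (1 / sqrt (real (card (verts H))) ^ k)) ks us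
        - p * prodip (verts H) ks us\<bar> \<le> \<epsilon>"
    and q: "\<bar>fact k * real (card (edges H)) / real (card (verts H)) ^ k - p\<bar> \<le> \<epsilon>"
  shows "\<bar>lambda1 ks H - p * sqrt (real (card (verts H))) ^ k\<bar> \<le> \<epsilon> * sqrt (real (card (verts H))) ^ k"
    and "\<bar>lambda2 ks H\<bar> \<le> 2 * \<epsilon> * sqrt (real (card (verts H))) ^ k"
proof -
  define N where "N = sqrt (real (card (verts H))) ^ k"
  define F where "F = form (verts H) (\<lambda>bs. adj H bs * (1 / N)) ks"
  define P where "P = prodip (verts H) ks"
  define \<phi> where "\<phi> = partition_map (verts H) ks (adjacency_map k H)"
  define \<psi> where "\<psi> us = \<phi> us - fact k * real (card (edges H)) / real (card (verts H)) ^ k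
     * partition_map (verts H) ks (all_ones_map k (verts H)) us" for us
  have N: "N \<ge> 0" by (simp add: N_def)
  have near': "\<bar>F us - p * P us\<bar> \<le> \<epsilon>" if "unit_vecs (verts H) ks us" for us
    using near[OF that] by (simp add: F_def P_def N_def)
  have \<phi>: "\<phi> us = N * F us"
    and ones: "partition_map (verts H) ks (all_ones_map k (verts H)) us = N * P us"
    if "unit_vecs (verts H) ks us" for us
    using partition_map_adjacency[OF H _ k, of us] that by (simp_all add: \<phi>_def F_def P_def N_def unit_vecs_iff)
  have P1: "\<bar>P us\<bar> \<le> 1" if "unit_vecs (verts H) ks us" for us
    unfolding P_def by (rule abs_prodip_le[OF H that])
  have l1: "lambda1 ks H = spectral_norm (verts H) ks \<phi>"
    by (simp add: lambda1_def \<phi>_def k)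
  have l2: "lambda2 ks H = spectral_norm (verts H) ks \<psi>"
    by (simp add: lambda2_def \<psi>_def[abs_def] \<phi>_def k Let_def)
  have b1: "\<bar>\<phi> us\<bar> \<le> (p + \<epsilon>) * N" if u: "unit_vecs (verts H) ks us" for us
  proof -
    have "\<bar>p * P us\<bar> \<le> p" using P1[OF u] \<open>0 < p\<close> by (simp add: abs_mult mult_left_le)
    then have "\<bar>F us\<bar> \<le> p + \<epsilon>" using near'[OF u] by linarith
    then show ?thesis using N by (simp add: \<phi>[OF u] abs_mult mult.commute mult_left_mono)
  qed
  have b2: "\<bar>\<psi> us\<bar> \<le> 2 * \<epsilon> * N" if u: "unit_vecs (verts H) ks us" for us
  proof -
    define q where "q = fact k * real (card (edges H)) / real (card (verts H)) ^ k"
    have "\<psi> us = N * ((F us - p * P us) + (p - q) * P us)"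
      unfolding \<psi>_def \<phi>[OF u] ones[OF u] q_def[symmetric] by (simp add: algebra_simps)
    moreover have "\<bar>(p - q) * P us\<bar> \<le> \<epsilon> * 1"
      unfolding abs_mult using q P1[OF u] \<open>0 \<le> \<epsilon>\<close> by (intro mult_mono) (auto simp: q_def)
    then have "\<bar>(F us - p * P us) + (p - q) * P us\<bar> \<le> 2 * \<epsilon>" using near'[OF u] by linarith
    ultimately show ?thesis using N by (simp add: abs_mult mult.commute mult_left_mono)
  qed
  define E :: "('a list \<Rightarrow> real) list" where "E = replicate (length ks) (cvec (verts H))"
  have uE: "unit_vecs (verts H) ks E" and PE: "P E = 1"
    using unit_cvec[OF H, of ks] prodip_cvec[OF H, of ks] by (simp_all add: E_def P_def)
  have "p - \<epsilon> \<le> F E" using near'[OF uE] by (simp add: PE abs_le_iff)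
  then have "(p - \<epsilon>) * N \<le> \<phi> E" using N by (simp add: \<phi>[OF uE] mult.commute mult_left_mono)
  also have "\<dots> \<le> lambda1 ks H"
    using spectral_norm_bounds(2)[where \<phi> = \<phi>, OF H b1 uE] unfolding l1 by linarith
  finally have "(p - \<epsilon>) * N \<le> lambda1 ks H" .
  moreover have "lambda1 ks H \<le> (p + \<epsilon>) * N"
    unfolding l1 by (rule spectral_norm_bounds(1)[OF H b1])
  ultimately have "\<bar>lambda1 ks H - p * N\<bar> \<le> \<epsilon> * N"
    by (simp add: abs_le_iff algebra_simps)
  then show "\<bar>lambda1 ks H - p * sqrt (real (card (verts H))) ^ k\<bar> \<le> \<epsilon> * sqrt (real (card (verts H))) ^ k"
    by (simp add: N_def)
  have "lambda2 ks H \<le> 2 * \<epsilon> * N"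
    unfolding l2 by (rule spectral_norm_bounds(1)[OF H b2])
  moreover have "0 \<le> lambda2 ks H"
    using spectral_norm_bounds(2)[where \<phi> = \<psi>, OF H b2 uE] unfolding l2 by linarith
  ultimately show "\<bar>lambda2 ks H\<bar> \<le> 2 * \<epsilon> * sqrt (real (card (verts H))) ^ k"
    by (simp add: N_def)
qed

theorem theorem1:
  fixes k l :: nat and p :: real and H :: "nat \<Rightarrow> 'a hypergraph"
    and \<pi> :: "nat multiset" and ks ks' :: "nat list" and err :: "nat \<Rightarrow> real"
  assumes "k \<ge> 2" and "0 < p" and "p < 1"
    and "\<And>n. uniform_hypergraph_with_loops k (H n)"
    and "\<And>n. card (verts (H n)) = n"
    and "\<And>n. real (card (edges (H n))) \<ge> p * real (n choose k)"
    and "proper_partition k \<pi>"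
    and "mset ks = \<pi>" and "mset ks' = \<pi>"
    and "l \<ge> 1"
    and "err \<in> o(\<lambda>n. real n ^ card (verts (hcycle ks (2 * l))))"
    and "\<And>n. real (card (labeled_copies (hcycle ks (2 * l)) (H n)))
               \<le> p ^ card (edges (hcycle ks (2 * l))) * real n ^ card (verts (hcycle ks (2 * l)))
                 + err n"
  shows "(\<lambda>n. lambda1 ks' (H n) - p * real n powr (real k / 2)) \<in> o(\<lambda>n. real n powr (real k / 2))
       \<and> (\<lambda>n. lambda2 ks' (H n)) \<in> o(\<lambda>n. real n powr (real k / 2))"
proof -
  define v where "v = card (verts (hcycle ks (2 * l)))"
  have "length ks \<ge> 2"
    using assms(7) assms(8)[symmetric] by (simp add: proper_partition_def)
  then obtain s where len: "length ks = Suc (Suc s)"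
    by (metis Suc_le_D Suc_le_mono numeral_2_eq_2)
  have pos: "\<forall>j\<in>set ks. j > 0" and sum: "sum_list ks = k" and sum': "sum_list ks' = k"
    using assms(7) assms(8)[symmetric] assms(9)[symmetric]
    by (auto simp: proper_partition_def sum_mset_sum_list)
       (metis sum_mset_sum_list)
  have m: "2 * l \<ge> 1" "2 * l \<ge> 2" using assms(10) by auto
  have edges: "card (edges (hcycle ks (2 * l))) = 2 * l * 2 ^ Suc s"
    by (rule card_edges_hcycle[OF len pos m(2)])
  \<comment> \<open>\<open>q n\<close> is the coefficient in \<open>lambda2\<close>. It need not be
    the density of edge tuples, since loops have fewer orderings; \<open>r n\<close>, which tends to
    1, measures how rare repeated entries are.\<close>
  define r where "r n = fact k * real (n choose k) / real n ^ k" for n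
  define q where "q n = fact k * real (card (edges (H n))) / real n ^ k" for n
  have r: "r \<longlonglongrightarrow> 1" unfolding r_def by (rule binomial_density_tendsto)
  have err: "(\<lambda>n. err n / real n ^ v) \<longlonglongrightarrow> 0"
    using assms(11) unfolding v_def by (rule smalloD_tendsto)
  have near: "eventually (\<lambda>n. n > 0 \<and>
      \<bar>lambda1 ks' (H n) - p * sqrt (real n) ^ k\<bar> \<le> \<epsilon> * sqrt (real n) ^ k \<and>
      \<bar>lambda2 ks' (H n)\<bar> \<le> 2 * \<epsilon> * sqrt (real n) ^ k) sequentially" if \<epsilon>: "\<epsilon> > 0" for \<epsilon> :: real
  proof -
    \<comment> \<open>The other half of \<epsilon> is kept for the passage from the density of edge
      tuples to \<open>q n\<close>.\<close>
    have e2: "\<epsilon> / 2 > 0" using \<epsilon> by simp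
    from form_near_product[OF assms(2) e2 assms(10), of s, where ?'a = 'a]
    obtain \<delta> where \<delta>: "\<delta> > 0" and core: "\<And>(V :: 'a set) ls g us. finite V \<Longrightarrow> V \<noteq> {} \<Longrightarrow>
       length ls = Suc (Suc s) \<Longrightarrow> p - \<delta> \<le> form V g ls (replicate (Suc (Suc s)) (cvec V)) \<Longrightarrow>
       cyc (2 * l) V g ls \<le> p ^ (2 * l * 2 ^ Suc s) + \<delta> \<Longrightarrow> unit_vecs V ls us \<Longrightarrow>
       \<bar>form V g ls us - p * prodip V ls us\<bar> \<le> \<epsilon> / 2"
      by blast
    have t1: "(\<lambda>n. p * r n - fact k * (1 - r n)) \<longlonglongrightarrow> p * 1 - fact k * (1 - 1)"
      and t2: "(\<lambda>n. fact k * (1 - r n)) \<longlonglongrightarrow> fact k * (1 - 1)"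
      and t3: "(\<lambda>n. p * r n) \<longlonglongrightarrow> p * 1"
      by (intro tendsto_intros r)+
    have t4: "(\<lambda>n. err n / real n ^ v + real v ^ 2 / real n) \<longlonglongrightarrow> 0 + 0"
      by (intro tendsto_add err lim_const_over_n)
    have "eventually (\<lambda>n. p - \<delta> < p * r n - fact k * (1 - r n)) sequentially"
      by (rule order_tendstoD(1)[OF t1]) (use \<delta> in simp)
    moreover have "eventually (\<lambda>n. fact k * (1 - r n) < \<epsilon> / 2) sequentially"
      by (rule order_tendstoD(2)[OF t2]) (use \<epsilon> in simp)
    moreover have "eventually (\<lambda>n. p - \<epsilon> < p * r n) sequentially"
      by (rule order_tendstoD(1)[OF t3]) (use \<epsilon> in simp)
    moreover have "eventually (\<lambda>n. err n / real n ^ v + real v ^ 2 / real n < \<delta>) sequentially"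
      by (rule order_tendstoD(2)[OF t4]) (use \<delta> in simp)
    moreover have "eventually (\<lambda>n. n \<ge> max 1 k) sequentially"
      by (rule eventually_ge_at_top)
    ultimately show ?thesis
    proof eventually_elim
      case (elim n)
      define V where "V = verts (H n)"
      define g where "g bs = adj (H n) bs * (1 / sqrt (real (card (verts (H n)))) ^ k)" for bs
      define d where "d = form V g ks (replicate (Suc (Suc s)) (cvec V))"
      have n: "n > 0" "k \<le> n" using elim by auto
      have cV: "card V = n" by (simp add: V_def assms(5))
      have V: "finite V" "V \<noteq> {}"
        using assms(4)[of n] n cV by (auto simp: V_def uniform_hypergraph_with_loops_def)
      have VH: "finite (verts (H n))" "verts (H n) \<noteq> {}" using V by (simp_all add: V_def)
      have d: "d = real (card {vs \<in> tuples V k. mset vs \<in> edges (H n)}) / real n ^ k"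
        using form_adj_cvec[OF V(1) sum V_def] by (simp add: d_def g_def[abs_def] len cV flip: V_def)
      have dt: "real (card (distinct_tuples V k)) = fact k * real (n choose k)"
        using card_distinct_tuples(1)[OF V(1), of k] n cV by simp
      \<comment> \<open>Loops cost at most \<open>fact k * (1 - r n)\<close> here, a quantity that
        tends to 0.\<close>
      have "d \<ge> (fact k * (real (card (edges (H n))) - (real n ^ k - fact k * real (n choose k)))) / real n ^ k"
        unfolding d using card_edge_tuples_ge[OF assms(4)[of n]] dt cV
        by (intro divide_right_mono) (simp_all add: V_def)
      also have "(fact k * (real (card (edges (H n))) - (real n ^ k - fact k * real (n choose k)))) / real n ^ k
          = q n - fact k * (1 - r n)"
        using n by (simp add: q_def r_def field_simps)
      finally have dq: "q n - fact k * (1 - r n) \<le> d" .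
      have "fact k * (p * real (n choose k)) / real n ^ k \<le> q n"
        unfolding q_def using assms(6)[of n] by (intro divide_right_mono mult_left_mono) auto
      then have qr: "p * r n \<le> q n" by (simp add: r_def mult_ac)
      have low: "p - \<delta> \<le> d" using dq qr elim(1) by linarith
      have "cyc (2 * l) V g ks
          \<le> real (card (labeled_copies (hcycle ks (2 * l)) (H n))) / real n ^ v + real v ^ 2 / real n"
        using cyc_normalized_le[OF len pos sum m(1) VH v_def] by (simp add: g_def[abs_def] V_def assms(5))
      also have "real (card (labeled_copies (hcycle ks (2 * l)) (H n))) / real n ^ v
          \<le> (p ^ (2 * l * 2 ^ Suc s) * real n ^ v + err n) / real n ^ v"
        using assms(12)[of n] unfolding edges v_def by (intro divide_right_mono) auto
      also have "\<dots> = p ^ (2 * l * 2 ^ Suc s) + err n / real n ^ v"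
        using n by (simp add: add_divide_distrib)
      finally have up: "cyc (2 * l) V g ks \<le> p ^ (2 * l * 2 ^ Suc s) + \<delta>"
        using elim(4) by linarith
      have near: "\<bar>form V g ks us - p * prodip V ks us\<bar> \<le> \<epsilon> / 2" if "unit_vecs V ks us" for us
        by (rule core[OF V len low[unfolded d_def] up that])
      \<comment> \<open>The edge hypothesis bounds \<open>q n\<close> only from below. Testing
        \<open>near\<close> at the constant vectors gives \<open>d \<le> p + \<epsilon> / 2\<close>,
        and \<open>q n \<le> d + fact k * (1 - r n)\<close> turns this into the missing upper
        bound.\<close>
      have "\<bar>d - p\<bar> \<le> \<epsilon> / 2"
        using near[OF unit_cvec[OF V]] prodip_cvec[OF V, of ks] by (simp add: d_def len)
      then have qp: "\<bar>q n - p\<bar> \<le> \<epsilon>"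
        using dq qr elim(2,3) by linarith
      have near': "\<bar>form V g ks' us - p * prodip V ks' us\<bar> \<le> \<epsilon>" if "unit_vecs V ks' us" for us
      proof -
        have "mset ks = mset ks'" using assms(8,9) by simp
        then have "\<bar>form V g ks' us - p * prodip V ks' us\<bar> \<le> \<epsilon> / 2"
          unfolding V_def g_def[abs_def]
          by (rule form_near_product_permute[OF _ near[unfolded V_def g_def[abs_def]] that[unfolded V_def]])
        then show ?thesis using \<epsilon> by simp
      qed
      have "\<bar>lambda1 ks' (H n) - p * sqrt (real (card (verts (H n)))) ^ k\<bar> \<le> \<epsilon> * sqrt (real (card (verts (H n)))) ^ k"
        "\<bar>lambda2 ks' (H n)\<bar> \<le> 2 * \<epsilon> * sqrt (real (card (verts (H n)))) ^ k"
        using \<epsilon> near' qp by (intro lambda_bounds[OF VH sum' assms(2)];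
          simp add: V_def g_def[abs_def] q_def assms(5))+
      then show ?case using n by (simp add: assms(5))
    qed
  qed
  have pw: "real n powr (real k / 2) = sqrt (real n) ^ k" if "n > 0" for n
  proof -
    have "real n powr (real k / 2) = (real n powr (1 / 2)) powr real k" by (simp add: powr_powr)
    also have "\<dots> = sqrt (real n) ^ k" using that by (simp add: powr_half_sqrt powr_realpow)
    finally show ?thesis .
  qed
  show ?thesis
  proof (intro conjI landau_o.smallI)
    fix c :: real assume c: "c > 0"
    show "eventually (\<lambda>n. norm (lambda1 ks' (H n) - p * real n powr (real k / 2))
        \<le> c * norm (real n powr (real k / 2))) sequentially"
      using near[OF c] by eventually_elim (simp add: pw)
    have "c / 2 > 0" using c by simp
    from near[OF this] show "eventually (\<lambda>n. norm (lambda2 ks' (H n)) \<le> c * norm (real n powr (real k / 2))) sequentially"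
      by eventually_elim (simp add: pw)
  qed
qed

end
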